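(* For every integer $n\ge 1$, $$Q_{\mathrm{XOR}}(\mathrm{GarbageSimon}_n)\le n+2,\qquad Q_{\mathrm{erase}}(\mathrm{GarbageSimon}_n)=\Theta(2^{n/2}),$$ $$Q_{\mathrm{XOR}}(\mathrm{PermutationGarbageSimon}_n)\le n+2,\qquad Q_{\mathrm{IP}}(\mathrm{PermutationGarbageSimon}_n)=\Theta(2^{n/2}),$$ where the constants hidden in $\Theta$ are absolute. Moreover, the compressed permutation problem $\mathrm{CompressedPermutationGarbageSimon}_n$ (obtained by replacing the returned copy of $x$ by a one-bit separator), which is a promise problem about permutations of a set of $L'=2^{2n+2}=4N^2$ points (with $N=2^n$), satisfies $$Q_{\mathrm{XOR}}\le n+2,\qquad Q_{\mathrm{IP}}=\Theta(2^{n/2})=\Theta((L')^{1/4}).$$ Finally, these lower bounds ($\Omega(2^{n/2})$ for $Q_{\mathrm{erase}}$ of the first problem and for $Q_{\mathrm{IP}}$ of the other two) remain valid if the forward-erasing, respectively forward in-place, oracle is supplied with a clean coherent bypass control.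
   Context: Let $X=\mathbb F_2^n$, $N=|X|=2^n$, and let $\oplus$ be bitwise XOR. A Simon function with nonzero shift $s\in X$ is a function $h:X\to X$ such that $h(x)=h(y)\iff y\in\{x,x\oplus s\}$. A tag table is an arbitrary function $r:X\to X$, $r_x=r(x)$. Problems. (1) $\mathrm{GarbageSimon}_n$: the input is an injection $f_{h,r}:X\to X^3$, $f_{h,r}(x)=(h(x),x,r_x)$, with $r$ an arbitrary tag table. NO instances: $h$ is a permutation of $X$. YES instances: $h$ is a Simon function with some nonzero shift. Decide which. (2) $\mathrm{PermutationGarbageSimon}_n$: let $\Omega=\{0,1\}\times X^3\cong\{0,1\}^{3n+1}$. The input is any permutation $P$ of $\Omega$ for which there are $h,r:X\to X$ with $P(0,x,0^n,0^n)=(1,h(x),x,r_x)$ for all $x\in X$ ($P$ is otherwise arbitrary), where $h$ is a permutation (NO) or a Simon function with some nonzero shift (YES); $r$ is unrestricted. Decide which. (3) $\mathrm{CompressedPermutationGarbageSimon}_n$: let $\Omega'=\{0,1\}\times X\times\{0,1\}\times X\cong\{0,1\}^{2n+2}$, $L'=|\Omega'|=4N^2$. The input is any permutation $P'$ of $\Omega'$ for which there are $h,r:X\to X$ and a bit table $b:X\to\{0,1\}$ such that $x\mapsto(h(x),b_x)$ is injective and $P'(0,x,0,0^n)=(1,h(x),b_x,r_x)$ for all $x\in X$ ($P'$ is otherwise arbitrary), where $h$ is a permutation (NO) or a Simon function with some nonzero shift (YES). Decide which. Oracles. The standard XOR oracle of $f:\{0,1\}^k\to\{0,1\}^\ell$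 is the unitary $O_f|x,z\rangle=|x,z\oplus f(x)\rangle$. The forward-erasing oracle of an injection $f:\{0,1\}^k\to\{0,1\}^\ell$ is the isometry $E_f|x\rangle=|f(x)\rangle$ from $\mathbb C^{\{0,1\}^k}$ to $\mathbb C^{\{0,1\}^\ell}$; neither $E_f^\dagger$ nor a unitary extension is available. The forward in-place oracle of a permutation $P$ of a finite set $\Omega$ is the unitary $U_P|w\rangle=|P(w)\rangle$ on $\mathbb C^\Omega$; $U_P^\dagger$ is not available. Query algorithms. A $T$-query algorithm starts in a fixed pure state on a finite-dimensional system, applies the oracle map $T$ times to a query register (tensored with the identity on a workspace), with arbitrary oracle-independent isometries (equivalently, after purification, arbitrary quantum channels, ancillas and adaptive measurements) before, between and after the queries, and finally makes a two-outcome measurement. $Q_{\mathrm{XOR}},Q_{\mathrm{erase}},Q_{\mathrm{IP}}$ denote the minimum $T$ for which there is a $T$-query algorithm, using respectively the standard XOR, forward-erasing, or forward in-place oracle of the input, that answers correctly with probability at least $2/3$ on every promised input. Clean coherent bypass: instead of a query isometry $\mathcal Q:\mathcal K_{\mathrm{in}}\to\mathcal K_{\mathrm{out}}$ ($\mathcal Q=E_f$ or $U_P$), each call supplies $|0\rangle\langle0|\otimes J+|1\rangle\langle1|\otimes\mathcal Q$, with a control qubit, where $J:\mathcal K_{\mathrm{in}}\to\mathcal K_{\mathrm{out}}$ is a fixed isometry independent of the oracle instance. *)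

theory Defs
  imports
    Complex_Main
    "HOL-Library.FuncSet"
    "HOL-Library.Extended_Real"
    "HOL-Combinatorics.Permutations"
begin

section \<open>Bit strings and the promise problems\<close>

text \<open>Bit strings are Boolean lists. Tuples of bit strings are identified with bit strings by
  concatenation, so that \<open>X\<close> is \<open>bits n\<close>, \<open>X\<^sup>3\<close> is \<open>bits (3 * n)\<close>,
  \<open>{0,1} \<times> X\<^sup>3\<close> is \<open>bits (3 * n + 1)\<close> and \<open>{0,1} \<times> X \<times> {0,1} \<times> X\<close> is \<open>bits (2 * n + 2)\<close>.\<close>

definition bits :: "nat \<Rightarrow> bool list set" where
  "bits k = {x. length x = k}"

definition zeros :: "nat \<Rightarrow> bool list" where
  "zeros k = replicate k False"

definition bxor :: "bool list \<Rightarrow> bool list \<Rightarrow> bool list" where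
  "bxor x y = map2 (\<noteq>) x y"

definition simon_function :: "nat \<Rightarrow> bool list \<Rightarrow> (bool list \<Rightarrow> bool list) \<Rightarrow> bool" where
  "simon_function n s h \<longleftrightarrow>
     s \<in> bits n \<and> s \<noteq> zeros n \<and> h \<in> bits n \<rightarrow> bits n \<and>
     (\<forall>x\<in>bits n. \<forall>y\<in>bits n. h x = h y \<longleftrightarrow> y \<in> {x, bxor x s})"

definition yes_fun :: "nat \<Rightarrow> (bool list \<Rightarrow> bool list) \<Rightarrow> bool" where
  "yes_fun n h \<longleftrightarrow> (\<exists>s. simon_function n s h)"

definition no_fun :: "nat \<Rightarrow> (bool list \<Rightarrow> bool list) \<Rightarrow> bool" where
  "no_fun n h \<longleftrightarrow> bij_betw h (bits n) (bits n)"

text \<open>A promise problem is the pair of its set of YES inputs and its set of NO inputs.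
  Inputs are total functions of which only the values on the relevant \<open>bits k\<close> matter.\<close>

type_synonym input = "bool list \<Rightarrow> bool list"
type_synonym promise_problem = "input set \<times> input set"

definition garbage_fun :: "(bool list \<Rightarrow> bool list) \<Rightarrow> (bool list \<Rightarrow> bool list) \<Rightarrow> input" where
  "garbage_fun h r = (\<lambda>x. h x @ x @ r x)"

definition garbage_simon :: "nat \<Rightarrow> promise_problem" where
  "garbage_simon n =
     ({garbage_fun h r | h r. yes_fun n h \<and> r \<in> bits n \<rightarrow> bits n},
      {garbage_fun h r | h r. no_fun n h \<and> r \<in> bits n \<rightarrow> bits n})"

definition perm_garbage_instance :: "nat \<Rightarrow> (bool list \<Rightarrow> bool list) \<Rightarrow> input \<Rightarrow> bool" where
  "perm_garbage_instance n h P \<longleftrightarrow>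
     P permutes bits (3 * n + 1) \<and>
     (\<exists>r \<in> bits n \<rightarrow> bits n. \<forall>x\<in>bits n.
        P (False # x @ zeros n @ zeros n) = True # h x @ x @ r x)"

definition perm_garbage_simon :: "nat \<Rightarrow> promise_problem" where
  "perm_garbage_simon n =
     ({P. \<exists>h. yes_fun n h \<and> perm_garbage_instance n h P},
      {P. \<exists>h. no_fun n h \<and> perm_garbage_instance n h P})"

definition compressed_instance :: "nat \<Rightarrow> (bool list \<Rightarrow> bool list) \<Rightarrow> input \<Rightarrow> bool" where
  "compressed_instance n h P \<longleftrightarrow>
     P permutes bits (2 * n + 2) \<and>
     (\<exists>r \<in> bits n \<rightarrow> bits n. \<exists>b :: bool list \<Rightarrow> bool.
        inj_on (\<lambda>x. (h x, b x)) (bits n) \<and>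
        (\<forall>x\<in>bits n. P (False # x @ [False] @ zeros n) = True # h x @ [b x] @ r x))"

definition compressed_perm_garbage_simon :: "nat \<Rightarrow> promise_problem" where
  "compressed_perm_garbage_simon n =
     ({P. \<exists>h. yes_fun n h \<and> compressed_instance n h P},
      {P. \<exists>h. no_fun n h \<and> compressed_instance n h P})"


section \<open>Operators between the spaces \<open>\<complex>\<^sup>A\<close> for finite sets \<open>A\<close>\<close>

text \<open>For a finite set \<open>A\<close> of basis labels, a vector of \<open>\<complex>\<^sup>A\<close> is its amplitude function, and an
  operator \<open>\<complex>\<^sup>A \<rightarrow> \<complex>\<^sup>B\<close> is its matrix \<open>K b a\<close> (row \<open>b \<in> B\<close>, column \<open>a \<in> A\<close>);
  values at labels outside \<open>A\<close> and \<open>B\<close> are irrelevant.\<close>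

type_synonym 'a state = "'a \<Rightarrow> complex"
type_synonym ('a, 'b) operator = "'b \<Rightarrow> 'a \<Rightarrow> complex"

definition apply_op :: "'a set \<Rightarrow> ('a, 'b) operator \<Rightarrow> 'a state \<Rightarrow> 'b state" where
  "apply_op A K \<psi> = (\<lambda>b. \<Sum>a\<in>A. K b a * \<psi> a)"

text \<open>\<open>K\<^sup>\<dagger> K = 1\<close>, entry by entry.\<close>

definition is_isometry :: "'a set \<Rightarrow> 'b set \<Rightarrow> ('a, 'b) operator \<Rightarrow> bool" where
  "is_isometry A B K \<longleftrightarrow>
     (\<forall>a\<in>A. \<forall>a'\<in>A. (\<Sum>b\<in>B. cnj (K b a) * K b a') = (if a = a' then 1 else 0))"

definition unit_state :: "'a set \<Rightarrow> 'a state \<Rightarrow> bool" where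
  "unit_state A \<psi> \<longleftrightarrow> (\<Sum>a\<in>A. (cmod (\<psi> a))\<^sup>2) = 1"

text \<open>\<open>K \<otimes> 1\<close>, the second factor being a workspace.\<close>

definition tensor_id :: "('a, 'b) operator \<Rightarrow> ('a \<times> 'w, 'b \<times> 'w) operator" where
  "tensor_id K = (\<lambda>(b, v) (a, w). if v = w then K b a else 0)"

definition quad_form :: "'a set \<Rightarrow> ('a, 'a) operator \<Rightarrow> 'a state \<Rightarrow> complex" where
  "quad_form A M \<psi> = (\<Sum>a\<in>A. \<Sum>a'\<in>A. cnj (\<psi> a) * M a a' * \<psi> a')"

text \<open>\<open>0 \<le> M \<le> 1\<close>: a two-outcome measurement is the pair \<open>{M, 1 - M}\<close>.\<close>

definition is_effect :: "'a set \<Rightarrow> ('a, 'a) operator \<Rightarrow> bool" where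
  "is_effect A M \<longleftrightarrow>
     (\<forall>\<psi>. Im (quad_form A M \<psi>) = 0 \<and> 0 \<le> Re (quad_form A M \<psi>) \<and>
          Re (quad_form A M \<psi>) \<le> (\<Sum>a\<in>A. (cmod (\<psi> a))\<^sup>2))"


section \<open>Oracles\<close>

text \<open>\<open>|a\<rangle> \<mapsto> |f a\<rangle>\<close>\<close>

definition basis_op :: "('a \<Rightarrow> 'b) \<Rightarrow> ('a, 'b) operator" where
  "basis_op f = (\<lambda>b a. if b = f a then 1 else 0)"

lemma is_isometry_basis_op:
  assumes "finite B" "f \<in> A \<rightarrow> B" "inj_on f A"
  shows "is_isometry A B (basis_op f)"
  unfolding is_isometry_def basis_op_def
proof (intro ballI)
  fix a a' assume a: "a \<in> A" "a' \<in> A"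
  have "(\<Sum>b\<in>B. cnj (if b = f a then 1 else 0) * (if b = f a' then 1 else 0)) =
        (\<Sum>b\<in>B. if b = f a then if f a = f a' then 1 else 0 else (0 :: complex))"
    by (rule sum.cong) auto
  also have "\<dots> = (if a = a' then 1 else 0)"
    using assms a by (auto simp: inj_on_eq_iff)
  finally show "(\<Sum>b\<in>B. cnj (if b = f a then 1 else 0) * (if b = f a' then 1 else 0)) =
        (if a = a' then 1 else (0 :: complex))" .
qed

definition xor_oracle :: "input \<Rightarrow> (bool list \<times> bool list, bool list \<times> bool list) operator" where
  "xor_oracle f = basis_op (\<lambda>(x, z). (x, bxor z (f x)))"

definition erasing_oracle :: "input \<Rightarrow> (bool list, bool list) operator" where
  "erasing_oracle f = basis_op f"

definition in_place_oracle :: "input \<Rightarrow> (bool list, bool list) operator" where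
  "in_place_oracle P = basis_op P"

text \<open>\<open>|0\<rangle>\<langle>0| \<otimes> J + |1\<rangle>\<langle>1| \<otimes> Q\<close>\<close>

definition bypass ::
    "('a, 'b) operator \<Rightarrow> ('a, 'b) operator \<Rightarrow> (bool \<times> 'a, bool \<times> 'b) operator" where
  "bypass J Q = (\<lambda>(c', b) (c, a). if c' = c then (if c then Q b a else J b a) else 0)"


section \<open>Query algorithms and query complexity\<close>

text \<open>Between queries, the algorithm's state lives in a system of dimension \<open>sys_dim t\<close>
  (\<open>t\<close> is the number of queries made so far). One query step applies an isometry \<open>pre t\<close>
  into query register and workspace, the oracle on the query register, and an
  isometry \<open>post t\<close> to the next system. The measurement acts on the last system.\<close>

record ('a, 'b) query_alg =
  sys_dim :: "nat \<Rightarrow> nat"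
  work_dim :: "nat \<Rightarrow> nat"
  init :: "nat state"
  pre :: "nat \<Rightarrow> (nat, 'a \<times> nat) operator"
  post :: "nat \<Rightarrow> ('b \<times> nat, nat) operator"
  accept :: "(nat, nat) operator"

text \<open>\<open>A\<close> and \<open>B\<close> are the basis labels of the input and of the output space of the oracle.\<close>

definition is_query_alg :: "'a set \<Rightarrow> 'b set \<Rightarrow> nat \<Rightarrow> ('a, 'b) query_alg \<Rightarrow> bool" where
  "is_query_alg A B T \<A> \<longleftrightarrow>
     unit_state {..<sys_dim \<A> 0} (init \<A>) \<and>
     (\<forall>t<T. is_isometry {..<sys_dim \<A> t} (A \<times> {..<work_dim \<A> t}) (pre \<A> t) \<and>
            is_isometry (B \<times> {..<work_dim \<A> t}) {..<sys_dim \<A> (Suc t)} (post \<A> t)) \<and>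
     is_effect {..<sys_dim \<A> T} (accept \<A>)"

primrec run_alg ::
    "'a set \<Rightarrow> 'b set \<Rightarrow> ('a, 'b) query_alg \<Rightarrow> ('a, 'b) operator \<Rightarrow> nat \<Rightarrow> nat state" where
  "run_alg A B \<A> Q 0 = init \<A>"
| "run_alg A B \<A> Q (Suc t) =
     apply_op (B \<times> {..<work_dim \<A> t}) (post \<A> t)
       (apply_op (A \<times> {..<work_dim \<A> t}) (tensor_id Q)
         (apply_op {..<sys_dim \<A> t} (pre \<A> t) (run_alg A B \<A> Q t)))"

definition accept_prob ::
    "'a set \<Rightarrow> 'b set \<Rightarrow> nat \<Rightarrow> ('a, 'b) query_alg \<Rightarrow> ('a, 'b) operator \<Rightarrow> real" where
  "accept_prob A B T \<A> Q = Re (quad_form {..<sys_dim \<A> T} (accept \<A>) (run_alg A B \<A> Q T))"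

definition solves ::
    "'a set \<Rightarrow> 'b set \<Rightarrow> (input \<Rightarrow> ('a, 'b) operator) \<Rightarrow> promise_problem \<Rightarrow>
     nat \<Rightarrow> ('a, 'b) query_alg \<Rightarrow> bool" where
  "solves A B oracle_of Pr T \<A> \<longleftrightarrow>
     is_query_alg A B T \<A> \<and>
     (\<forall>f \<in> fst Pr. accept_prob A B T \<A> (oracle_of f) \<ge> 2 / 3) \<and>
     (\<forall>f \<in> snd Pr. 1 - accept_prob A B T \<A> (oracle_of f) \<ge> 2 / 3)"

text \<open>The least number of queries; it is \<open>\<infinity>\<close> if no algorithm solves the problem.\<close>

definition query_complexity ::
    "'a set \<Rightarrow> 'b set \<Rightarrow> (input \<Rightarrow> ('a, 'b) operator) \<Rightarrow> promise_problem \<Rightarrow> enat" where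
  "query_complexity A B oracle_of Pr = Inf {enat T | T. \<exists>\<A>. solves A B oracle_of Pr T \<A>}"

text \<open>The numbers \<open>k\<close> and \<open>l\<close> are the input and output length of the problem's inputs.\<close>

definition Q_XOR :: "nat \<Rightarrow> nat \<Rightarrow> promise_problem \<Rightarrow> enat" where
  "Q_XOR k l = query_complexity (bits k \<times> bits l) (bits k \<times> bits l) xor_oracle"

definition Q_erase :: "nat \<Rightarrow> nat \<Rightarrow> promise_problem \<Rightarrow> enat" where
  "Q_erase k l = query_complexity (bits k) (bits l) erasing_oracle"

definition Q_IP :: "nat \<Rightarrow> promise_problem \<Rightarrow> enat" where
  "Q_IP k = query_complexity (bits k) (bits k) in_place_oracle"

definition Q_erase_bypass ::
    "nat \<Rightarrow> nat \<Rightarrow> (bool list, bool list) operator \<Rightarrow> promise_problem \<Rightarrow> enat" where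
  "Q_erase_bypass k l J =
     query_complexity (UNIV \<times> bits k) (UNIV \<times> bits l) (\<lambda>f. bypass J (erasing_oracle f))"

definition Q_IP_bypass :: "nat \<Rightarrow> (bool list, bool list) operator \<Rightarrow> promise_problem \<Rightarrow> enat" where
  "Q_IP_bypass k J =
     query_complexity (UNIV \<times> bits k) (UNIV \<times> bits k) (\<lambda>P. bypass J (in_place_oracle P))"

text \<open>\<open>q n = \<Theta>(g n)\<close> with constants valid for all \<open>n \<ge> 1\<close>.\<close>

definition is_Theta :: "(nat \<Rightarrow> enat) \<Rightarrow> (nat \<Rightarrow> real) \<Rightarrow> bool" where
  "is_Theta q g \<longleftrightarrow>
     (\<exists>c C. c > 0 \<and> C > 0 \<and>
        (\<forall>n\<ge>1. ereal (c * g n) \<le> ereal_of_enat (q n) \<and> ereal_of_enat (q n) \<le> ereal (C * g n)))"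

end

theory Submission
  imports Defs "HOL-Analysis.L2_Norm"
begin

text \<open>An XOR query can absorb garbage in a state that is invariant under XOR, whereas a
  forward oracle leaves a fresh tag in its output with no means of erasing it. The obstacle is that
  an exact query does not only enlarge \<open>S\<close>: a tag may be averaged out again, and for a
  permutation the answers at other points depend on tags outside \<open>S\<close>. Each query is
  therefore replaced by a truncated map without these terms, the components are defined by that map,
  and the replacement is paid for in norm. The dependence of component \<open>S\<close> on
  \<open>h\<close> through \<open>S\<close> alone then holds by construction. For permutations the
  instance-independent part of the oracle comes from \<open>G\<close>. The columns where
  \<open>G\<close> and \<open>P\<close> still disagree are set to zero, so the oracle of the process
  is only a contraction. Since \<open>G\<close> is indexed by \<open>n\<close> hidden bits, each
  \<open>P\<close> has \<open>2 ^ n\<close> pairwise disjoint candidate sets of such columns, and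
  the loss averaged over them is of order \<open>T / sqrt (2 ^ n)\<close>. The constant 150 is
  chosen so that all losses together stay below the gap 1/3 between the rejection
  probabilities.\<close>

text \<open>
  Upper bounds. With an XOR oracle the garbage part of the output register is put into the uniform
  superposition, where it is left unchanged, so that one query yields one sample of Simon's
  algorithm; \<open>n + 2\<close> samples have full rank with probability at least 3/4. With the other oracles a
  set of \<open>O(2\<^sup>n\<^sup>/\<^sup>2)\<close> points whose pairwise sums cover \<open>X\<close> is queried classically.

  Lower bounds. Let the tags \<open>r x\<close> be independent and uniform. Decompose the state, as a function of
  the tags, into its Efron-Stein components: the component of \<open>S\<close> depends on the tags in \<open>S\<close> only and
  has mean zero in each of them. A forward query of \<open>x\<close> moves component \<open>S\<close> to \<open>S \<union> {x}\<close> up to an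
  error of order \<open>2\<^sup>-\<^sup>n\<^sup>/\<^sup>2\<close>, since the part of the output that does not depend on \<open>r x\<close> is that
  small. Hence \<open>S\<close> records the queried points, component \<open>S\<close> depends on \<open>h\<close> on \<open>S\<close> only, and
  different components are orthogonal. If \<open>S\<close> contains no pair \<open>x, x \<oplus> s\<close>, then a random permutation
  and a random Simon function with shift \<open>s\<close> agree on \<open>S\<close> in distribution, and a set of size \<open>T\<close>
  contains such a pair for at most \<open>T\<^sup>2\<close> shifts.

  For a permutation \<open>P\<close> the points outside the queried domain must not reveal \<open>h\<close> either. A random
  hidden exchange of values turns \<open>P\<close> into a permutation \<open>G\<close> that is independent of \<open>h\<close> and of the
  tags; \<open>P\<close> and \<open>G\<close> differ on a set that looks random of density \<open>2\<^sup>-\<^sup>n\<close> to an algorithm that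
  queries \<open>P\<close>, so each query costs an error of order \<open>2\<^sup>-\<^sup>n\<^sup>/\<^sup>2\<close>.
\<close>

subsection \<open>Vectors, contractions and effects\<close>

definition vnorm :: "'a set \<Rightarrow> 'a state \<Rightarrow> real" where
  "vnorm A \<psi> = L2_set (\<lambda>a. cmod (\<psi> a)) A"

definition contraction :: "'a set \<Rightarrow> 'b set \<Rightarrow> ('a, 'b) operator \<Rightarrow> bool" where
  "contraction A B K \<longleftrightarrow> (\<forall>\<psi>. vnorm B (apply_op A K \<psi>) \<le> vnorm A \<psi>)"

lemma vnorm_nonneg [simp]: "0 \<le> vnorm A \<psi>"
  by (simp add: vnorm_def)

lemma vnorm_power2: "(vnorm A \<psi>)\<^sup>2 = (\<Sum>a\<in>A. (cmod (\<psi> a))\<^sup>2)"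
  by (simp add: vnorm_def L2_set_def sum_nonneg)

lemma of_real_vnorm_power2:
  "complex_of_real ((vnorm A \<psi>)\<^sup>2) = (\<Sum>a\<in>A. cnj (\<psi> a) * \<psi> a)"
  unfolding vnorm_power2 of_real_sum complex_norm_square by (simp add: mult.commute)

lemma vnorm_cong: "(\<And>a. a \<in> A \<Longrightarrow> \<psi> a = \<phi> a) \<Longrightarrow> vnorm A \<psi> = vnorm A \<phi>"
  unfolding vnorm_def by (rule L2_set_cong) auto

lemma vnorm_add_le: "vnorm A (\<lambda>a. \<psi> a + \<phi> a) \<le> vnorm A \<psi> + vnorm A \<phi>"
proof -
  have "vnorm A (\<lambda>a. \<psi> a + \<phi> a) \<le> L2_set (\<lambda>a. cmod (\<psi> a) + cmod (\<phi> a)) A"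
    unfolding vnorm_def by (intro L2_set_mono norm_triangle_ineq) auto
  also have "\<dots> \<le> vnorm A \<psi> + vnorm A \<phi>"
    unfolding vnorm_def by (rule L2_set_triangle_ineq)
  finally show ?thesis .
qed

lemma vnorm_scale: "vnorm A (\<lambda>a. c * \<psi> a) = cmod c * vnorm A \<psi>"
  unfolding vnorm_def norm_mult by (subst L2_set_right_distrib) auto

lemma unit_state_vnorm: "unit_state A \<psi> \<longleftrightarrow> vnorm A \<psi> = 1"
  by (metis unit_state_def vnorm_power2 one_power2 power2_eq_imp_eq vnorm_nonneg zero_le_one)

lemma apply_op_diff:
  "apply_op A K (\<lambda>a. \<psi> a - \<phi> a) = (\<lambda>b. apply_op A K \<psi> b - apply_op A K \<phi> b)"
  by (simp add: apply_op_def right_diff_distrib sum_subtractf)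

lemma apply_op_sum:
  "apply_op A K (\<lambda>a. \<Sum>s\<in>S. \<psi> s a) = (\<lambda>b. \<Sum>s\<in>S. apply_op A K (\<psi> s) b)"
  by (auto simp: apply_op_def sum_distrib_left intro!: ext sum.swap)

lemma apply_op_cong:
  "(\<And>a. a \<in> A \<Longrightarrow> \<psi> a = \<phi> a) \<Longrightarrow> apply_op A K \<psi> = apply_op A K \<phi>"
  by (simp add: apply_op_def)

lemma vnorm_isometry:
  assumes "finite A" "is_isometry A B K"
  shows "vnorm B (apply_op A K \<psi>) = vnorm A \<psi>"
proof -
  have "complex_of_real ((vnorm B (apply_op A K \<psi>))\<^sup>2) =
      (\<Sum>b\<in>B. cnj (apply_op A K \<psi> b) * apply_op A K \<psi> b)"
    by (rule of_real_vnorm_power2)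
  also have "\<dots> = (\<Sum>b\<in>B. \<Sum>a\<in>A. \<Sum>a'\<in>A. cnj (\<psi> a) * \<psi> a' * (cnj (K b a) * K b a'))"
    unfolding apply_op_def cnj_sum sum_product by (simp add: mult_ac)
  also have "\<dots> = (\<Sum>a\<in>A. \<Sum>a'\<in>A. cnj (\<psi> a) * \<psi> a' * (\<Sum>b\<in>B. cnj (K b a) * K b a'))"
    unfolding sum_distrib_left by (subst sum.swap) (intro sum.cong refl sum.swap)
  also have "\<dots> = (\<Sum>a\<in>A. \<Sum>a'\<in>A. if a = a' then cnj (\<psi> a) * \<psi> a' else 0)"
    using assms(2) unfolding is_isometry_def by (intro sum.cong) auto
  also have "\<dots> = (\<Sum>a\<in>A. cnj (\<psi> a) * \<psi> a)"
    using assms(1) by simp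
  also have "\<dots> = complex_of_real ((vnorm A \<psi>)\<^sup>2)"
    by (rule of_real_vnorm_power2[symmetric])
  finally have "(vnorm B (apply_op A K \<psi>))\<^sup>2 = (vnorm A \<psi>)\<^sup>2"
    using of_real_eq_iff by blast
  then show ?thesis
    by (simp add: power2_eq_iff_nonneg)
qed

lemma contraction_isometry:
  "finite A \<Longrightarrow> is_isometry A B K \<Longrightarrow> contraction A B K"
  by (simp add: contraction_def vnorm_isometry)

lemma apply_tensor_id:
  assumes "finite A" "finite W"
  shows "apply_op (A \<times> W) (tensor_id K) \<phi> (b, v) =
         (if v \<in> W then apply_op A K (\<lambda>a. \<phi> (a, v)) b else 0)"
proof -
  have "apply_op (A \<times> W) (tensor_id K) \<phi> (b, v) =
      (\<Sum>a\<in>A. \<Sum>w\<in>W. if v = w then K b a * \<phi> (a, v) else 0)"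
    unfolding apply_op_def tensor_id_def sum.cartesian_product by (rule sum.cong) auto
  also have "\<dots> = (if v \<in> W then apply_op A K (\<lambda>a. \<phi> (a, v)) b else 0)"
    using assms by (simp add: apply_op_def)
  finally show ?thesis .
qed

lemma vnorm_Times_power2:
  "(vnorm (A \<times> W) \<phi>)\<^sup>2 = (\<Sum>w\<in>W. (vnorm A (\<lambda>a. \<phi> (a, w)))\<^sup>2)"
  unfolding vnorm_power2 by (subst sum.swap) (simp add: sum.cartesian_product)

lemma contraction_tensor_id:
  assumes "finite A" "finite W" "contraction A B K"
  shows "contraction (A \<times> W) (B \<times> W) (tensor_id K)"
  unfolding contraction_def
proof
  fix \<psi>
  have "(vnorm (B \<times> W) (apply_op (A \<times> W) (tensor_id K) \<psi>))\<^sup>2 =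
      (\<Sum>w\<in>W. (vnorm B (apply_op A K (\<lambda>a. \<psi> (a, w))))\<^sup>2)"
    unfolding vnorm_Times_power2 by (simp add: apply_tensor_id assms)
  also have "\<dots> \<le> (\<Sum>w\<in>W. (vnorm A (\<lambda>a. \<psi> (a, w)))\<^sup>2)"
    using assms(3) unfolding contraction_def by (intro sum_mono power_mono) auto
  also have "\<dots> = (vnorm (A \<times> W) \<psi>)\<^sup>2"
    by (simp add: vnorm_Times_power2)
  finally show "vnorm (B \<times> W) (apply_op (A \<times> W) (tensor_id K) \<psi>) \<le> vnorm (A \<times> W) \<psi>"
    by (rule power2_le_imp_le) simp
qed

lemma vnorm_apply_le: "contraction A B K \<Longrightarrow> vnorm B (apply_op A K \<psi>) \<le> vnorm A \<psi>"
  by (simp add: contraction_def)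

definition expect :: "'a set \<Rightarrow> ('a, 'a) operator \<Rightarrow> 'a state \<Rightarrow> real" where
  "expect A M \<psi> = Re (quad_form A M \<psi>)"

lemma is_effect_expect:
  assumes "is_effect A M"
  shows "0 \<le> expect A M \<psi>" "expect A M \<psi> \<le> (vnorm A \<psi>)\<^sup>2"
  using assms unfolding is_effect_def expect_def vnorm_power2 by blast+

text \<open>This takes the place of Cauchy-Schwarz for the form of \<open>M\<close>: the symmetrised
  cross term between \<open>\<psi> - \<phi>\<close> and \<open>\<psi> + \<phi>\<close> is the wanted
  difference, and the free factors \<open>c\<close> and \<open>d\<close> allow the two vectors to be
  rescaled later.\<close>

lemma expect_parallelogram:
  fixes c d :: real
  shows "expect A M (\<lambda>a. of_real c * (\<psi> a - \<phi> a) + of_real d * (\<psi> a + \<phi> a)) -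
   expect A M (\<lambda>a. of_real d * (\<psi> a + \<phi> a) - of_real c * (\<psi> a - \<phi> a)) =
   4 * c * d * (expect A M \<psi> - expect A M \<phi>)"
proof -
  have alg: "(c * (x - y) + d * (x + y)) * m * (c * (x' - y') + d * (x' + y')) -
      (d * (x + y) - c * (x - y)) * m * (d * (x' + y') - c * (x' - y')) =
      4 * c * d * (x * m * x' - y * m * y')" for c d x y m x' y' :: complex
    by algebra
  have "quad_form A M (\<lambda>a. of_real c * (\<psi> a - \<phi> a) + of_real d * (\<psi> a + \<phi> a)) -
   quad_form A M (\<lambda>a. of_real d * (\<psi> a + \<phi> a) - of_real c * (\<psi> a - \<phi> a)) =
   of_real (4 * c * d) * (quad_form A M \<psi> - quad_form A M \<phi>)"
    by (simp add: quad_form_def alg flip: sum_subtractf sum_distrib_left)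
  then have "Re (quad_form A M (\<lambda>a. of_real c * (\<psi> a - \<phi> a) + of_real d * (\<psi> a + \<phi> a)) -
   quad_form A M (\<lambda>a. of_real d * (\<psi> a + \<phi> a) - of_real c * (\<psi> a - \<phi> a))) =
   Re (of_real (4 * c * d) * (quad_form A M \<psi> - quad_form A M \<phi>))"
    by (rule arg_cong)
  then show ?thesis
    unfolding expect_def by (simp only: minus_complex.simps Re_complex_of_real times_complex.simps
        Im_complex_of_real mult_zero_left diff_zero)
qed

text \<open>An effect is given only through bounds on its quadratic form. After polarisation both
  values lie between 0 and the same squared norm, and the scaling is then optimised.\<close>

lemma expect_lipschitz:
  assumes "is_effect A M"
  shows "\<bar>expect A M \<psi> - expect A M \<phi>\<bar> \<le> vnorm A (\<lambda>a. \<psi> a - \<phi> a) * (vnorm A \<psi> + vnorm A \<phi>)"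
proof -
  define u where "u = vnorm A (\<lambda>a. \<psi> a - \<phi> a)"
  define v where "v = vnorm A (\<lambda>a. \<psi> a + \<phi> a)"
  have main: "4 * t * s * \<bar>expect A M \<psi> - expect A M \<phi>\<bar> \<le> (t * u + s * v)\<^sup>2"
    if "t \<ge> 0" "s \<ge> 0" for t s :: real
  proof -
    let ?p = "\<lambda>a. of_real t * (\<psi> a - \<phi> a) + of_real s * (\<psi> a + \<phi> a)"
    let ?m = "\<lambda>a. of_real s * (\<psi> a + \<phi> a) - of_real t * (\<psi> a - \<phi> a)"
    have id: "expect A M ?p - expect A M ?m = 4 * t * s * (expect A M \<psi> - expect A M \<phi>)"
      by (rule expect_parallelogram)
    have "vnorm A ?p \<le> t * u + s * v"
      using vnorm_add_le[of A "\<lambda>a. of_real t * (\<psi> a - \<phi> a)" "\<lambda>a. of_real s * (\<psi> a + \<phi> a)"]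
        that unfolding vnorm_scale u_def v_def by simp
    then have "expect A M ?p \<le> (t * u + s * v)\<^sup>2"
      using is_effect_expect(2)[OF assms, of ?p] by (smt (verit) power_mono vnorm_nonneg)
    moreover
    have "vnorm A ?m \<le> t * u + s * v"
      using vnorm_add_le[of A "\<lambda>a. of_real s * (\<psi> a + \<phi> a)" "\<lambda>a. (- of_real t) * (\<psi> a - \<phi> a)"]
        that unfolding vnorm_scale u_def v_def by (simp add: algebra_simps)
    then have "expect A M ?m \<le> (t * u + s * v)\<^sup>2"
      using is_effect_expect(2)[OF assms, of ?m] by (smt (verit) power_mono vnorm_nonneg)
    moreover have "0 \<le> expect A M ?p" "0 \<le> expect A M ?m"
      using is_effect_expect(1)[OF assms] by blast+
    ultimately have "\<bar>4 * t * s * (expect A M \<psi> - expect A M \<phi>)\<bar> \<le> (t * u + s * v)\<^sup>2"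
      using id by linarith
    then show ?thesis
      using that by (simp add: abs_mult)
  qed
  have "\<bar>expect A M \<psi> - expect A M \<phi>\<bar> \<le> u * v"
  \<comment> \<open>If one of the norms vanishes, the optimal scaling degenerates. One factor is
    then sent to infinity while the right-hand side stays bounded.\<close>
  proof (cases "u = 0 \<or> v = 0")
    case True
    let ?d = "\<bar>expect A M \<psi> - expect A M \<phi>\<bar>"
    have b: "4 * t * ?d \<le> (u + v)\<^sup>2" if "t > 0" for t :: real
    proof (cases "u = 0")
      case True
      then show ?thesis using main[of t 1] that by simp
    next
      case False
      then show ?thesis using main[of 1 t] \<open>u = 0 \<or> v = 0\<close> that by simp
    qed
    have "?d = 0"
    proof (rule ccontr)
      assume "?d \<noteq> 0"
      then have "?d > 0" by linarith
      \<comment> \<open>This factor makes the left side equal to \<open>(u + v)\<^sup>2 + 1\<close>,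
        which exceeds the right side.\<close>
      with b[of "((u + v)\<^sup>2 + 1) / (4 * ?d)"] show False
        by (auto simp: divide_simps add_nonneg_pos split: if_splits)
    qed
    then show ?thesis
      using True by auto
  next
    case False
    then have "u > 0" "v > 0"
      by (auto simp: u_def v_def order_less_le)
    \<comment> \<open>The choice \<open>t = v\<close>, \<open>s = u\<close> balances the two
      summands: \<open>t * u = s * v\<close>.\<close>
    with main[of v u] show ?thesis
      by (simp add: power2_eq_square algebra_simps)
  qed
  moreover have "v \<le> vnorm A \<psi> + vnorm A \<phi>"
    unfolding v_def by (rule vnorm_add_le)
  ultimately show ?thesis
    using mult_left_mono[of v "vnorm A \<psi> + vnorm A \<phi>" u]
    unfolding u_def by (meson order_trans vnorm_nonneg)
qed

lemma quad_form_complement: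
  assumes "finite A"
  shows "quad_form A (\<lambda>a a'. (if a = a' then 1 else 0) - M a a') \<psi> =
         of_real ((vnorm A \<psi>)\<^sup>2) - quad_form A M \<psi>"
proof -
  have "quad_form A (\<lambda>a a'. (if a = a' then 1 else 0) - M a a') \<psi> =
      (\<Sum>a\<in>A. \<Sum>a'\<in>A. (if a = a' then cnj (\<psi> a) * \<psi> a else 0) - cnj (\<psi> a) * M a a' * \<psi> a')"
    unfolding quad_form_def by (intro sum.cong) (auto simp: algebra_simps)
  also have "\<dots> = (\<Sum>a\<in>A. cnj (\<psi> a) * \<psi> a) - quad_form A M \<psi>"
    using assms by (simp add: sum_subtractf quad_form_def)
  finally show ?thesis
    by (simp only: of_real_vnorm_power2)
qed

lemma is_effect_complement:
  assumes "finite A" "is_effect A M"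
  shows "is_effect A (\<lambda>a a'. (if a = a' then 1 else 0) - M a a')"
  using assms unfolding is_effect_def quad_form_complement[OF assms(1)] vnorm_power2[symmetric]
  by simp

lemma run_alg_cong:
  assumes "\<And>a b. a \<in> A \<Longrightarrow> b \<in> B \<Longrightarrow> Q b a = Q' b a"
  shows "run_alg A B \<A> Q t = run_alg A B \<A> Q' t"
proof (induction t)
  case (Suc t)
  have "apply_op (A \<times> {..<work_dim \<A> t}) (tensor_id Q) \<psi> p =
        apply_op (A \<times> {..<work_dim \<A> t}) (tensor_id Q') \<psi> p"
    if "p \<in> B \<times> {..<work_dim \<A> t}" for \<psi> p
    using that assms unfolding apply_op_def tensor_id_def by (auto intro!: sum.cong)
  then show ?case
    by (auto simp: Suc intro!: apply_op_cong)
qed simp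

lemma is_query_algD:
  assumes "is_query_alg A B T \<A>" "t < T"
  shows "is_isometry {..<sys_dim \<A> t} (A \<times> {..<work_dim \<A> t}) (pre \<A> t)"
    and "is_isometry (B \<times> {..<work_dim \<A> t}) {..<sys_dim \<A> (Suc t)} (post \<A> t)"
  using assms by (auto simp: is_query_alg_def)

lemma vnorm_run_contraction:
  assumes "finite A" "finite B" "is_query_alg A B T \<A>" "contraction A B Q"
  shows "t \<le> T \<Longrightarrow> vnorm {..<sys_dim \<A> t} (run_alg A B \<A> Q t) \<le> 1"
proof (induction t)
  case 0
  then show ?case
    using assms(3) by (simp add: is_query_alg_def unit_state_vnorm)
next
  case (Suc t)
  let ?W = "{..<work_dim \<A> t}" and ?\<phi> = "apply_op {..<sys_dim \<A> t} (pre \<A> t) (run_alg A B \<A> Q t)"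
  from Suc have t: "t < T" by simp
  have "vnorm (B \<times> ?W) (apply_op (A \<times> ?W) (tensor_id Q) ?\<phi>) \<le> vnorm (A \<times> ?W) ?\<phi>"
    using assms by (intro vnorm_apply_le contraction_tensor_id) auto
  moreover have "vnorm (A \<times> ?W) ?\<phi> \<le> 1"
    using Suc t by (simp add: vnorm_isometry[OF _ is_query_algD(1)[OF assms(3)]])
  moreover have "vnorm {..<sys_dim \<A> (Suc t)} (run_alg A B \<A> Q (Suc t)) \<le>
      vnorm (B \<times> ?W) (apply_op (A \<times> ?W) (tensor_id Q) ?\<phi>)"
    using t assms(2) by (simp add: vnorm_isometry[OF _ is_query_algD(2)[OF assms(3)]])
  ultimately show ?case
    by linarith
qed

subsection \<open>Averaging over independent tags\<close>

locale tag_space =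
  fixes X :: "'x set" and Z :: "'z set"
  assumes finite_X [simp]: "finite X" and finite_Z [simp]: "finite Z" and Z_ne [simp]: "Z \<noteq> {}"
begin

definition tables :: "('x \<Rightarrow> 'z) set" where
  "tables = PiE X (\<lambda>_. Z)"

text \<open>Conditional expectation given all tags except that of \<open>x\<close>, for uniform
  tags.\<close>

definition avg :: "'x \<Rightarrow> (('x \<Rightarrow> 'z) \<Rightarrow> complex) \<Rightarrow> ('x \<Rightarrow> 'z) \<Rightarrow> complex" where
  "avg x F r = (\<Sum>z\<in>Z. F (r(x := z))) / of_nat (card Z)"

lemma finite_tables [simp]: "finite tables"
  by (simp add: tables_def finite_PiE)

lemma card_Z_pos: "card Z > 0"
  using Z_ne by (simp add: card_gt_0_iff)

lemma tables_upd: "r \<in> tables \<Longrightarrow> x \<in> X \<Longrightarrow> z \<in> Z \<Longrightarrow> r(x := z) \<in> tables"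
  by (auto simp: tables_def PiE_def extensional_def Pi_def)

lemma tables_ne [simp]: "tables \<noteq> {}"
  using Z_ne by (simp add: tables_def PiE_eq_empty_iff)

lemma tables_in: "r \<in> tables \<Longrightarrow> x \<in> X \<Longrightarrow> r x \<in> Z"
  by (auto simp: tables_def)

lemma sum_tables_upd:
  fixes F :: "('x \<Rightarrow> 'z) \<Rightarrow> 'c::comm_semiring_1"
  assumes "x \<in> X"
  shows "(\<Sum>r\<in>tables. \<Sum>z\<in>Z. F (r(x := z))) = of_nat (card Z) * (\<Sum>r\<in>tables. F r)"
proof -
  have "(\<Sum>r\<in>tables. \<Sum>z\<in>Z. F (r(x := z))) = (\<Sum>(r, z)\<in>tables \<times> Z. F (r(x := z)))"
    by (simp add: sum.cartesian_product)
  also have "\<dots> = (\<Sum>(r, z)\<in>tables \<times> Z. F r)"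
    \<comment> \<open>Exchanging the tag of \<open>x\<close> with the fresh value \<open>z\<close>
      is an involution of \<open>tables \<times> Z\<close>, so resampling one tag preserves the
      uniform distribution.\<close>
    by (rule sum.reindex_bij_witness[of _ "\<lambda>(r, z). (r(x := z), r x)" "\<lambda>(r, z). (r(x := z), r x)"])
      (use assms in \<open>auto simp: tables_upd\<close>, auto simp: tables_def PiE_def Pi_def)
  also have "\<dots> = of_nat (card Z) * (\<Sum>r\<in>tables. F r)"
    by (simp add: sum.cartesian_product[symmetric] sum_distrib_left)
  finally show ?thesis .
qed

lemma avg_upd [simp]: "avg x F (r(x := z)) = avg x F r"
  by (simp add: avg_def)

lemma avg_const: "(\<And>z. z \<in> Z \<Longrightarrow> F (r(x := z)) = F r) \<Longrightarrow> avg x F r = F r"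
  using card_Z_pos Z_ne by (simp add: avg_def)

lemma card_avg: "of_nat (card Z) * avg x F r = (\<Sum>z\<in>Z. F (r(x := z)))"
  using card_Z_pos Z_ne by (simp add: avg_def)

lemma sum_avg_upd: "(\<Sum>z\<in>Z. F (r(x := z)) - avg x F (r(x := z))) = 0"
  by (simp add: sum_subtractf card_avg)

lemma avg_sum: "avg x (\<lambda>r. \<Sum>i\<in>I. F i r) r = (\<Sum>i\<in>I. avg x (F i) r)"
  unfolding avg_def by (subst sum.swap) (simp add: sum_divide_distrib)

text \<open>The norm of the direct sum over all tag tables. It is not divided by their number, hence
  the later factors \<open>sqrt (card tables)\<close>.\<close>

definition tnorm :: "'i set \<Rightarrow> (('x \<Rightarrow> 'z) \<Rightarrow> 'i state) \<Rightarrow> real" where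
  "tnorm I \<Psi> = L2_set (\<lambda>r. vnorm I (\<Psi> r)) tables"

lemma tnorm_nonneg [simp]: "0 \<le> tnorm I \<Psi>"
  by (simp add: tnorm_def)

lemma tnorm_power2: "(tnorm I \<Psi>)\<^sup>2 = (\<Sum>r\<in>tables. \<Sum>i\<in>I. (cmod (\<Psi> r i))\<^sup>2)"
  by (simp add: tnorm_def L2_set_def sum_nonneg vnorm_power2)

lemma tnorm_add_le: "tnorm I (\<lambda>r i. \<Psi> r i + \<Phi> r i) \<le> tnorm I \<Psi> + tnorm I \<Phi>"
proof -
  have "tnorm I (\<lambda>r i. \<Psi> r i + \<Phi> r i) \<le> L2_set (\<lambda>r. vnorm I (\<Psi> r) + vnorm I (\<Phi> r)) tables"
    unfolding tnorm_def by (intro L2_set_mono vnorm_add_le) auto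
  also have "\<dots> \<le> tnorm I \<Psi> + tnorm I \<Phi>"
    unfolding tnorm_def by (rule L2_set_triangle_ineq)
  finally show ?thesis .
qed

lemma tnorm_minus: "tnorm I (\<lambda>r i. - \<Psi> r i) = tnorm I \<Psi>"
  by (simp add: tnorm_def vnorm_def)

lemma tnorm_mono: "(\<And>r. r \<in> tables \<Longrightarrow> vnorm I (\<Psi> r) \<le> vnorm J (\<Phi> r)) \<Longrightarrow> tnorm I \<Psi> \<le> tnorm J \<Phi>"
  unfolding tnorm_def by (intro L2_set_mono) auto

text \<open>\<open>avg x\<close> is the orthogonal projection onto the functions that ignore the tag
  of \<open>x\<close>; the equation \<open>eq\<close> of the proof is this orthogonality.\<close>

lemma avg_pythagoras:
  assumes "x \<in> X"
  shows "(\<Sum>r\<in>tables. (cmod (F r - avg x F r))\<^sup>2) + (\<Sum>r\<in>tables. (cmod (avg x F r))\<^sup>2) =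
         (\<Sum>r\<in>tables. (cmod (F r))\<^sup>2)"
proof -
  let ?a = "avg x F"
  have "of_nat (card Z) * (\<Sum>r\<in>tables. cnj (?a r) * F r) =
      (\<Sum>r\<in>tables. \<Sum>z\<in>Z. cnj (?a (r(x := z))) * F (r(x := z)))"
    using sum_tables_upd[OF assms, of "\<lambda>r. cnj (?a r) * F r"] by simp
  also have "\<dots> = (\<Sum>r\<in>tables. cnj (?a r) * (of_nat (card Z) * ?a r))"
    unfolding card_avg by (simp add: sum_distrib_left)
  also have "\<dots> = of_nat (card Z) * (\<Sum>r\<in>tables. cnj (?a r) * ?a r)"
    by (simp add: sum_distrib_left mult_ac)
  finally have eq: "(\<Sum>r\<in>tables. cnj (?a r) * F r) = (\<Sum>r\<in>tables. cnj (?a r) * ?a r)"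
    using card_Z_pos by simp
  have sq: "(cmod (F r - ?a r))\<^sup>2 + (cmod (?a r))\<^sup>2 =
      (cmod (F r))\<^sup>2 - 2 * Re (cnj (?a r) * F r) + 2 * Re (cnj (?a r) * ?a r)" for r
    unfolding cmod_power2 by (simp add: power2_eq_square algebra_simps)
  show ?thesis
    using arg_cong[OF eq, of Re]
    by (simp add: sum.distrib[symmetric] sq sum_subtractf flip: sum_distrib_left)
      (simp add: sum.distrib sum_subtractf flip: sum_distrib_left)
qed

lemma avg_of_bool:
  assumes "z\<^sub>0 \<in> Z"
  shows "avg x (\<lambda>r. of_bool (r x = z\<^sub>0) * F r) r = F (r(x := z\<^sub>0)) / of_nat (card Z)"
  using assms by (simp add: avg_def of_bool_def if_distrib[of "\<lambda>c. c * _"] cong: if_cong)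

lemma sum_upd_sq_le:
  assumes "x \<in> X" "z\<^sub>0 \<in> Z"
  shows "(\<Sum>r\<in>tables. (cmod (F (r(x := z\<^sub>0))))\<^sup>2) \<le> card Z * (\<Sum>r\<in>tables. (cmod (F r))\<^sup>2)"
proof -
  have "(\<Sum>r\<in>tables. (cmod (F (r(x := z\<^sub>0))))\<^sup>2) \<le> (\<Sum>r\<in>tables. \<Sum>z\<in>Z. (cmod (F (r(x := z))))\<^sup>2)"
    by (intro sum_mono member_le_sum assms) auto
  also have "\<dots> = card Z * (\<Sum>r\<in>tables. (cmod (F r))\<^sup>2)"
    using sum_tables_upd[OF assms(1), of "\<lambda>r. (cmod (F r))\<^sup>2"] by simp
  finally show ?thesis .
qed

text \<open>The event \<open>r x = z\<^sub>0\<close> has probability \<open>1 / card Z\<close> and is independent of \<open>avg x F\<close>.\<close>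

lemma sum_of_bool_avg_sq:
  assumes "x \<in> X" "z\<^sub>0 \<in> Z"
  shows "card Z * (\<Sum>r\<in>tables. (cmod (of_bool (r x = z\<^sub>0) * avg x F r))\<^sup>2) =
         (\<Sum>r\<in>tables. (cmod (avg x F r))\<^sup>2)"
proof -
  have "real (card Z) * (\<Sum>r\<in>tables. (cmod (of_bool (r x = z\<^sub>0) * avg x F r))\<^sup>2) =
      (\<Sum>r\<in>tables. \<Sum>z\<in>Z. of_bool (z = z\<^sub>0) * (cmod (avg x F r))\<^sup>2)"
    using sum_tables_upd[OF assms(1), of "\<lambda>r. (cmod (of_bool (r x = z\<^sub>0) * avg x F r))\<^sup>2"]
    by (simp add: norm_mult power_mult_distrib of_bool_def if_distrib[of cmod]
        if_distrib[of "\<lambda>c. c * _"] if_distrib[of "\<lambda>c. c ^ _"] cong: if_cong)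
  also have "\<dots> = (\<Sum>r\<in>tables. (cmod (avg x F r))\<^sup>2)"
    using assms(2) by (simp add: of_bool_def if_distrib[of "\<lambda>c. c * _"] cong: if_cong)
  finally show ?thesis .
qed

end

subsection \<open>Decomposition by the set of queried points\<close>

context tag_space
begin

definition fluct :: "'x \<Rightarrow> (('x \<Rightarrow> 'z) \<Rightarrow> complex) \<Rightarrow> ('x \<Rightarrow> 'z) \<Rightarrow> complex" where
  "fluct x F r = F r - avg x F r"

lemma fluct_sum: "fluct x (\<lambda>r. \<Sum>i\<in>I. F i r) r = (\<Sum>i\<in>I. fluct x (F i) r)"
  by (simp add: fluct_def avg_sum sum_subtractf)

lemma sum_fluct_upd: "(\<Sum>z\<in>Z. fluct x F (r(x := z))) = 0"
  unfolding fluct_def by (rule sum_avg_upd)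

lemma fluct_indep:
  assumes "x \<noteq> y" "\<And>r. F (r(x := z)) = F r"
  shows "fluct y F (r(x := z)) = fluct y F r"
  using assms by (simp add: fluct_def avg_def fun_upd_twist[of x y])

text \<open>Averages over the tags of two different points commute.\<close>

lemma fluct_mean_zero:
  assumes "x \<noteq> y" "\<And>r. (\<Sum>z\<in>Z. F (r(x := z))) = 0"
  shows "(\<Sum>z\<in>Z. fluct y F (r(x := z))) = 0"
proof -
  have "(\<Sum>z\<in>Z. avg y F (r(x := z))) = (\<Sum>z'\<in>Z. \<Sum>z\<in>Z. F ((r(y := z'))(x := z))) / of_nat (card Z)"
    unfolding avg_def by (subst sum.swap) (simp add: sum_divide_distrib fun_upd_twist[OF assms(1)])
  then show ?thesis
    by (simp add: fluct_def sum_subtractf assms(2))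
qed

text \<open>The two properties are demanded of a given family instead of computing components by
  inclusion-exclusion, so a family built query by query can be checked directly. They are stated for
  every \<open>r\<close>, also outside \<open>tables\<close>, which spares membership arguments
  under updates.\<close>

definition efron_stein :: "('x set \<Rightarrow> ('x \<Rightarrow> 'z) \<Rightarrow> 'i state) \<Rightarrow> bool" where
  "efron_stein \<Phi> \<longleftrightarrow> (\<forall>S\<subseteq>X. \<forall>r i.
     (\<forall>x\<in>X - S. \<forall>z. \<Phi> S (r(x := z)) i = \<Phi> S r i) \<and> (\<forall>x\<in>S. (\<Sum>z\<in>Z. \<Phi> S (r(x := z)) i) = 0))"

lemma efron_steinD:
  assumes "efron_stein \<Phi>" "S \<subseteq> X"
  shows "x \<in> X \<Longrightarrow> x \<notin> S \<Longrightarrow> \<Phi> S (r(x := z)) i = \<Phi> S r i"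
    and "x \<in> S \<Longrightarrow> (\<Sum>z\<in>Z. \<Phi> S (r(x := z)) i) = 0"
  using assms unfolding efron_stein_def by blast+

lemma efron_stein_apply_op:
  assumes "efron_stein \<Phi>"
  shows "efron_stein (\<lambda>S r. apply_op A K (\<Phi> S r))"
  unfolding efron_stein_def
proof (intro allI impI conjI ballI)
  fix S r i x assume S: "S \<subseteq> X" and x: "x \<in> S"
  have "(\<Sum>z\<in>Z. apply_op A K (\<Phi> S (r(x := z))) i) =
      apply_op A K (\<lambda>a. \<Sum>z\<in>Z. \<Phi> S (r(x := z)) a) i"
    by (simp add: apply_op_sum)
  also have "\<dots> = 0"
    by (simp add: efron_steinD(2)[OF assms S x] apply_op_def)
  finally show "(\<Sum>z\<in>Z. apply_op A K (\<Phi> S (r(x := z))) i) = 0" .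
qed (simp add: efron_steinD(1)[OF assms] apply_op_def)

text \<open>A point in exactly one of the two sets separates them: when its tag is resampled, one
  factor sums to zero while the other stays constant.\<close>

lemma efron_stein_orthogonal:
  assumes "efron_stein \<Phi>" "S \<subseteq> X" "S' \<subseteq> X" "S \<noteq> S'"
  shows "(\<Sum>r\<in>tables. cnj (\<Phi> S r i) * \<Phi> S' r j) = 0"
proof -
  have main: "(\<Sum>r\<in>tables. cnj (\<Phi> S r i) * \<Phi> S' r j) = 0"
    if S: "S \<subseteq> X" and S': "S' \<subseteq> X" and x: "x \<in> S" "x \<notin> S'" for S S' x i j
  proof -
    have "(\<Sum>z\<in>Z. cnj (\<Phi> S (r(x := z)) i) * \<Phi> S' (r(x := z)) j) =
        cnj (\<Sum>z\<in>Z. \<Phi> S (r(x := z)) i) * \<Phi> S' r j" for r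
      using efron_steinD(1)[OF assms(1) S'] x S by (auto simp: sum_distrib_right)
    then have "(\<Sum>r\<in>tables. \<Sum>z\<in>Z. cnj (\<Phi> S (r(x := z)) i) * \<Phi> S' (r(x := z)) j) = 0"
      using efron_steinD(2)[OF assms(1) S] x by (simp del: cnj_sum)
    then show ?thesis
      using sum_tables_upd[of x "\<lambda>r. cnj (\<Phi> S r i) * \<Phi> S' r j"] x S card_Z_pos by auto
  qed
  consider x where "x \<in> S" "x \<notin> S'" | x where "x \<in> S'" "x \<notin> S"
    using assms(4) by blast
  then show ?thesis
  proof cases
    case 1
    then show ?thesis using main assms by blast
  next
    case 2
    then have "cnj (\<Sum>r\<in>tables. cnj (\<Phi> S' r j) * \<Phi> S r i) = 0"
      using main[of S' S x j i] assms by simp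
    then show ?thesis
      by (simp add: mult.commute)
  qed
qed

definition total :: "('x set \<Rightarrow> ('x \<Rightarrow> 'z) \<Rightarrow> 'i state) \<Rightarrow> ('x \<Rightarrow> 'z) \<Rightarrow> 'i state" where
  "total \<Phi> r i = (\<Sum>S\<in>Pow X. \<Phi> S r i)"

lemma sum_Pow_split:
  fixes F :: "'x set \<Rightarrow> complex"
  assumes "x \<in> X"
  shows "(\<Sum>S\<in>Pow X. F S) = (\<Sum>S\<in>{S\<in>Pow X. x \<in> S}. F S) + (\<Sum>S\<in>{S\<in>Pow X. x \<notin> S}. F S)"
  by (subst sum.union_disjoint[symmetric]) (auto intro: sum.cong)

text \<open>\<open>avg x\<close> annihilates the components whose set contains \<open>x\<close> and
  fixes all others. Thus conditioning on the other tags selects components by membership of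
  \<open>x\<close>.\<close>

lemma avg_total:
  assumes "efron_stein \<Phi>" "x \<in> X"
  shows "avg x (\<lambda>r. total \<Phi> r i) r = (\<Sum>S\<in>{S\<in>Pow X. x \<notin> S}. \<Phi> S r i)"
proof -
  have "avg x (\<lambda>r. total \<Phi> r i) r = (\<Sum>S\<in>Pow X. avg x (\<lambda>r. \<Phi> S r i) r)"
    unfolding total_def by (rule avg_sum)
  also have "\<dots> = (\<Sum>S\<in>{S\<in>Pow X. x \<in> S}. avg x (\<lambda>r. \<Phi> S r i) r) +
      (\<Sum>S\<in>{S\<in>Pow X. x \<notin> S}. avg x (\<lambda>r. \<Phi> S r i) r)"
    by (rule sum_Pow_split[OF assms(2)])
  also have "(\<Sum>S\<in>{S\<in>Pow X. x \<in> S}. avg x (\<lambda>r. \<Phi> S r i) r) = 0"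
    by (rule sum.neutral) (auto simp: avg_def efron_steinD(2)[OF assms(1)])
  also have "(\<Sum>S\<in>{S\<in>Pow X. x \<notin> S}. avg x (\<lambda>r. \<Phi> S r i) r) = (\<Sum>S\<in>{S\<in>Pow X. x \<notin> S}. \<Phi> S r i)"
    by (rule sum.cong) (auto intro!: avg_const efron_steinD(1)[OF assms(1)] simp: assms(2))
  finally show ?thesis
    by simp
qed

lemma fluct_total:
  assumes "efron_stein \<Phi>" "x \<in> X"
  shows "fluct x (\<lambda>r. total \<Phi> r i) r = (\<Sum>S\<in>{S\<in>Pow X. x \<in> S}. \<Phi> S r i)"
  unfolding fluct_def avg_total[OF assms] using sum_Pow_split[OF assms(2), of "\<lambda>S. \<Phi> S r i"]
  by (simp add: total_def)

text \<open>Every set occurs exactly once as \<open>S\<close> or as \<open>S - {x}\<close> with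
  \<open>x \<in> S\<close>. This reassembles the two sources from which a query of \<open>x\<close>
  feeds a component.\<close>

lemma sum_remove_eq_total:
  assumes "x \<in> X"
  shows "(\<Sum>S\<in>{S\<in>Pow X. x \<in> S}. \<Phi> S r i + \<Phi> (S - {x}) r i) = total \<Phi> r i"
proof -
  have "(\<Sum>S\<in>{S\<in>Pow X. x \<in> S}. \<Phi> (S - {x}) r i) = (\<Sum>S\<in>{S\<in>Pow X. x \<notin> S}. \<Phi> S r i)"
    by (rule sum.reindex_bij_witness[of _ "insert x" "\<lambda>S. S - {x}"]) (use assms in auto)
  then show ?thesis
    unfolding total_def by (simp add: sum.distrib sum_Pow_split[OF assms])
qed

lemma sum_Pow_swap:
  fixes G :: "'x \<Rightarrow> 'x set \<Rightarrow> complex"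
  shows "(\<Sum>S\<in>Pow X. \<Sum>x\<in>S. G x S) = (\<Sum>x\<in>X. \<Sum>S\<in>{S\<in>Pow X. x \<in> S}. G x S)"
proof -
  have "(\<Sum>S\<in>Pow X. \<Sum>x\<in>S. G x S) = (\<Sum>S\<in>Pow X. \<Sum>x\<in>{x\<in>X. x \<in> S}. G x S)"
    by (intro sum.cong) auto
  also have "\<dots> = (\<Sum>x\<in>X. \<Sum>S\<in>{S\<in>Pow X. x \<in> S}. G x S)"
    by (rule sum.swap_restrict) auto
  finally show ?thesis .
qed

text \<open>\<open>M\<close> acts on the register of the algorithm and not on the tags, so
  orthogonality removes every term with two different sets. A measurement therefore sees a classical
  mixture of components.\<close>

lemma sum_quad_total:
  assumes "efron_stein \<Phi>"
  shows "(\<Sum>r\<in>tables. quad_form I M (total \<Phi> r)) = (\<Sum>S\<in>Pow X. \<Sum>r\<in>tables. quad_form I M (\<Phi> S r))"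
proof -
  have "(\<Sum>r\<in>tables. quad_form I M (total \<Phi> r)) =
     (\<Sum>r\<in>tables. \<Sum>i\<in>I. \<Sum>j\<in>I. \<Sum>S\<in>Pow X. \<Sum>S'\<in>Pow X. M i j * (cnj (\<Phi> S r i) * \<Phi> S' r j))"
    unfolding quad_form_def total_def cnj_sum
    by (simp add: sum_product mult_ac sum_distrib_left)
  also have "\<dots> =
     (\<Sum>i\<in>I. \<Sum>j\<in>I. \<Sum>S\<in>Pow X. \<Sum>S'\<in>Pow X. M i j * (\<Sum>r\<in>tables. cnj (\<Phi> S r i) * \<Phi> S' r j))"
    unfolding sum_distrib_left
    by (subst sum.swap, intro sum.cong refl, subst sum.swap, intro sum.cong refl,
        subst sum.swap, intro sum.cong refl, rule sum.swap)
  also have "\<dots> =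
     (\<Sum>i\<in>I. \<Sum>j\<in>I. \<Sum>S\<in>Pow X. M i j * (\<Sum>r\<in>tables. cnj (\<Phi> S r i) * \<Phi> S r j))"
  proof (intro sum.cong refl)
    fix i j S assume S: "S \<in> Pow X"
    have "(\<Sum>S'\<in>Pow X. M i j * (\<Sum>r\<in>tables. cnj (\<Phi> S r i) * \<Phi> S' r j)) =
        (\<Sum>S'\<in>Pow X. if S' = S then M i j * (\<Sum>r\<in>tables. cnj (\<Phi> S r i) * \<Phi> S' r j) else 0)"
      using S by (intro sum.cong) (auto simp: efron_stein_orthogonal[OF assms])
    then show "(\<Sum>S'\<in>Pow X. M i j * (\<Sum>r\<in>tables. cnj (\<Phi> S r i) * \<Phi> S' r j)) =
        M i j * (\<Sum>r\<in>tables. cnj (\<Phi> S r i) * \<Phi> S r j)"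
      using S by simp
  qed
  also have "\<dots> = (\<Sum>S\<in>Pow X. \<Sum>r\<in>tables. \<Sum>i\<in>I. \<Sum>j\<in>I. M i j * (cnj (\<Phi> S r i) * \<Phi> S r j))"
    unfolding sum_distrib_left
    by (subst (2) sum.swap, subst sum.swap, intro sum.cong refl,
        subst (2) sum.swap, subst sum.swap, intro sum.cong refl)
  finally show ?thesis
    unfolding quad_form_def by (simp add: mult_ac)
qed

lemma sum_expect_total:
  assumes "efron_stein \<Phi>"
  shows "(\<Sum>r\<in>tables. expect I M (total \<Phi> r)) = (\<Sum>S\<in>Pow X. \<Sum>r\<in>tables. expect I M (\<Phi> S r))"
  using arg_cong[OF sum_quad_total[OF assms, of I M], of Re] by (simp add: expect_def)

lemma vnorm_power2_expect:
  assumes "finite I"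
  shows "(vnorm I \<psi>)\<^sup>2 = expect I (\<lambda>i j. if i = j then 1 else 0) \<psi>"
proof -
  have "quad_form I (\<lambda>i j. if i = j then 1 else 0) \<psi> =
      (\<Sum>i\<in>I. \<Sum>j\<in>I. if i = j then cnj (\<psi> i) * \<psi> i else 0)"
    unfolding quad_form_def by (intro sum.cong) auto
  also have "\<dots> = complex_of_real ((vnorm I \<psi>)\<^sup>2)"
    using assms by (simp add: of_real_vnorm_power2 del: of_real_power)
  finally show ?thesis
    by (simp add: expect_def)
qed

lemma sum_vnorm_total:
  assumes "efron_stein \<Phi>" "finite I"
  shows "(\<Sum>S\<in>Pow X. \<Sum>r\<in>tables. (vnorm I (\<Phi> S r))\<^sup>2) = (tnorm I (total \<Phi>))\<^sup>2"
  using sum_expect_total[OF assms(1)] assms(2)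
  by (simp add: vnorm_power2_expect[OF assms(2)] tnorm_def L2_set_def sum_nonneg
      flip: vnorm_power2_expect[OF assms(2)]) (simp add: vnorm_power2_expect[OF assms(2)])

end

subsection \<open>The recorded process\<close>

text \<open>\<open>K0\<close> is the part of the oracle that depends neither on \<open>h\<close> nor
  on the tags. \<open>\<omega> x\<close> is the input label of the point \<open>x\<close>, and
  \<open>\<nu> x y z\<close> its output label for function value \<open>y\<close> and tag
  \<open>z\<close>. \<open>\<delta> a\<close> is the output to which \<open>K0\<close> sends the
  label \<open>a\<close>, recorded where it could coincide with such a label.\<close>

locale recorded_process = tag_space X Z
  for X :: "'x set" and Z :: "'z set" +
  fixes A :: "'a set" and B :: "'b set" and alg :: "('a, 'b) query_alg" and T :: nat
    and K0 :: "('a, 'b) operator" and \<omega> :: "'x \<Rightarrow> 'a"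
    and \<nu> :: "'x \<Rightarrow> 'l \<Rightarrow> 'z \<Rightarrow> 'b" and \<delta> :: "'a \<Rightarrow> 'b option"
  assumes finite_A [simp]: "finite A" and finite_B [simp]: "finite B"
    and alg: "is_query_alg A B T alg"
    and K0: "contraction A B K0"
    and \<omega>: "inj_on \<omega> X" "\<omega> ` X \<subseteq> A"
begin

definition hit :: "('x \<Rightarrow> 'l) \<Rightarrow> 'x \<Rightarrow> ('x \<Rightarrow> 'z) \<Rightarrow> 'a \<Rightarrow> complex" where
  "hit h x r a = of_bool (\<delta> a = Some (\<nu> x (h x) (r x)))"

definition out :: "('x \<Rightarrow> 'l) \<Rightarrow> 'x \<Rightarrow> ('x \<Rightarrow> 'z) \<Rightarrow> 'b \<Rightarrow> complex" where
  "out h x r b = of_bool (b = \<nu> x (h x) (r x))"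

text \<open>If the values \<open>\<nu> x (h x) (r x)\<close> are distinct, the sum of the hits at
  \<open>a\<close> is 0 or 1. The last factor thus deletes the column of \<open>K0\<close> whose
  target is already the value at some point.\<close>

definition ideal :: "('x \<Rightarrow> 'l) \<Rightarrow> ('x \<Rightarrow> 'z) \<Rightarrow> ('a, 'b) operator" where
  "ideal h r b a = (\<Sum>x\<in>X. of_bool (a = \<omega> x) * out h x r b) + K0 b a * (1 - (\<Sum>x\<in>X. hit h x r a))"

text \<open>The new component \<open>S\<close> is assembled from the old components \<open>S\<close>
  and \<open>S - {x}\<close> alone, and \<open>fluct x\<close> restores mean zero in the tag of
  \<open>x\<close>. Terms that would lead to a smaller set, or that would read \<open>h\<close>
  outside \<open>S\<close>, are left out.\<close>

definition qstep :: "('x \<Rightarrow> 'l) \<Rightarrow> ('x set \<Rightarrow> ('x \<Rightarrow> 'z) \<Rightarrow> 'a state) \<Rightarrow>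
    'x set \<Rightarrow> ('x \<Rightarrow> 'z) \<Rightarrow> 'b state" where
  "qstep h \<Phi> S r b =
     (\<Sum>a\<in>A. K0 b a * (\<Phi> S r a - (\<Sum>x\<in>S. fluct x (\<lambda>r. hit h x r a * \<Phi> S r a) r))) +
     (\<Sum>x\<in>S. fluct x (\<lambda>r. out h x r b * (\<Phi> S r (\<omega> x) + \<Phi> (S - {x}) r (\<omega> x))) r)"

primrec component :: "('x \<Rightarrow> 'l) \<Rightarrow> nat \<Rightarrow> 'x set \<Rightarrow> ('x \<Rightarrow> 'z) \<Rightarrow> nat state" where
  "component h 0 S r = (if S = {} then init alg else (\<lambda>_. 0))"
| "component h (Suc t) S r = apply_op (B \<times> {..<work_dim alg t}) (post alg t)
     (\<lambda>(b, v). qstep h (\<lambda>S r a. apply_op {..<sys_dim alg t} (pre alg t) (component h t S r) (a, v)) S r b)"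

text \<open>The effect of \<open>qstep\<close> on the sum of all components. The inner
  \<open>fluct\<close> appears because only components with \<open>x \<in> S\<close> take part in a
  hit at \<open>x\<close>.\<close>

definition trunc :: "('x \<Rightarrow> 'l) \<Rightarrow> (('x \<Rightarrow> 'z) \<Rightarrow> 'a state) \<Rightarrow> ('x \<Rightarrow> 'z) \<Rightarrow> 'b state" where
  "trunc h F r b =
     (\<Sum>a\<in>A. K0 b a * (F r a - (\<Sum>x\<in>X. fluct x (\<lambda>r. hit h x r a * fluct x (\<lambda>r. F r a) r) r))) +
     (\<Sum>x\<in>X. fluct x (\<lambda>r. out h x r b * F r (\<omega> x)) r)"

lemma hit_upd: "x \<noteq> y \<Longrightarrow> hit h y (r(x := z)) a = hit h y r a"
  by (simp add: hit_def)

lemma out_upd: "x \<noteq> y \<Longrightarrow> out h y (r(x := z)) a = out h y r a"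
  by (simp add: out_def)

text \<open>In the tag of the projected point the mean vanishes because of \<open>fluct\<close>. In
  the tag of any other point of \<open>S\<close> it vanishes by inheritance, since
  \<open>hit\<close> and \<open>out\<close> do not read that tag.\<close>

lemma efron_stein_qstep:
  assumes es: "efron_stein \<Phi>"
  shows "efron_stein (qstep h \<Phi>)"
  unfolding efron_stein_def
proof (intro allI impI conjI ballI)
  fix S r b x z assume S: "S \<subseteq> X" and x: "x \<in> X - S"
  have ind: "\<Phi> S (r(x := z)) a = \<Phi> S r a" "\<Phi> (S - {y}) (r(x := z)) a = \<Phi> (S - {y}) r a" for r a y
    using efron_steinD(1)[OF es S, of x] efron_steinD(1)[OF es subset_trans[OF Diff_subset S], of x] x
    by auto
  have "fluct y (\<lambda>r. hit h y r a * \<Phi> S r a) (r(x := z)) = fluct y (\<lambda>r. hit h y r a * \<Phi> S r a) r"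
      "fluct y (\<lambda>r. out h y r b * (\<Phi> S r (\<omega> y) + \<Phi> (S - {y}) r (\<omega> y))) (r(x := z)) =
       fluct y (\<lambda>r. out h y r b * (\<Phi> S r (\<omega> y) + \<Phi> (S - {y}) r (\<omega> y))) r" if "y \<in> S" for y a
  proof -
    have "x \<noteq> y"
      using that x by auto
    then show "fluct y (\<lambda>r. hit h y r a * \<Phi> S r a) (r(x := z)) = fluct y (\<lambda>r. hit h y r a * \<Phi> S r a) r"
      "fluct y (\<lambda>r. out h y r b * (\<Phi> S r (\<omega> y) + \<Phi> (S - {y}) r (\<omega> y))) (r(x := z)) =
       fluct y (\<lambda>r. out h y r b * (\<Phi> S r (\<omega> y) + \<Phi> (S - {y}) r (\<omega> y))) r"
      by (auto intro!: fluct_indep simp: hit_upd out_upd ind)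
  qed
  then show "qstep h \<Phi> S (r(x := z)) b = qstep h \<Phi> S r b"
    by (simp add: qstep_def ind)
next
  fix S r b x assume S: "S \<subseteq> X" and x: "x \<in> S"
  have z: "(\<Sum>z\<in>Z. \<Phi> S (r(x := z)) a) = 0" for r a
    by (rule efron_steinD(2)[OF es S x])
  have z': "(\<Sum>z\<in>Z. \<Phi> (S - {y}) (r(x := z)) a) = 0" if "x \<noteq> y" for r a y
    by (rule efron_steinD(2)[OF es]) (use S x that in auto)
  have f1: "(\<Sum>z\<in>Z. fluct y (\<lambda>r. hit h y r a * \<Phi> S r a) (r(x := z))) = 0" for y a
  proof (cases "x = y")
    case False
    then show ?thesis
      by (rule fluct_mean_zero) (simp add: hit_upd[OF False] z flip: sum_distrib_left)
  qed (simp add: sum_fluct_upd)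
  have f2: "(\<Sum>z\<in>Z. fluct y (\<lambda>r. out h y r b * (\<Phi> S r (\<omega> y) + \<Phi> (S - {y}) r (\<omega> y))) (r(x := z))) = 0"
    for y
  proof (cases "x = y")
    case False
    then show ?thesis
      by (rule fluct_mean_zero)
        (simp add: out_upd[OF False] z z'[OF False] sum.distrib flip: sum_distrib_left)
  qed (simp add: sum_fluct_upd)
  have "(\<Sum>z\<in>Z. qstep h \<Phi> S (r(x := z)) b) =
      (\<Sum>a\<in>A. K0 b a * ((\<Sum>z\<in>Z. \<Phi> S (r(x := z)) a) -
         (\<Sum>y\<in>S. \<Sum>z\<in>Z. fluct y (\<lambda>r. hit h y r a * \<Phi> S r a) (r(x := z))))) +
      (\<Sum>y\<in>S. \<Sum>z\<in>Z. fluct y (\<lambda>r. out h y r b * (\<Phi> S r (\<omega> y) + \<Phi> (S - {y}) r (\<omega> y))) (r(x := z)))"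
    unfolding qstep_def sum.distrib
    by (rule arg_cong2[where f="(+)"], subst sum.swap)
      (simp_all add: sum_subtractf sum.swap[of _ S Z] flip: sum_distrib_left)
  then show "(\<Sum>z\<in>Z. qstep h \<Phi> S (r(x := z)) b) = 0"
    by (simp only: f1 f2 z sum.neutral_const diff_zero mult_zero_right add_0)
qed

lemma efron_stein_slice:
  "efron_stein \<Phi> \<longleftrightarrow> (\<forall>v. efron_stein (\<lambda>S r a. \<Phi> S r (a, v)))"
  unfolding efron_stein_def by auto

lemma efron_stein_component: "efron_stein (component h t)"
proof (induction t)
  case 0
  then show ?case
    by (auto simp: efron_stein_def)
next
  case (Suc t)
  have "efron_stein (\<lambda>S r. (\<lambda>(b, v). qstep h (\<lambda>S r a.
      apply_op {..<sys_dim alg t} (pre alg t) (component h t S r) (a, v)) S r b))"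
    using iffD1[OF efron_stein_slice efron_stein_apply_op[OF Suc, of "{..<sys_dim alg t}" "pre alg t"]]
    by (intro iffD2[OF efron_stein_slice]) (simp add: efron_stein_qstep)
  then show ?case
    by (simp add: efron_stein_apply_op)
qed

text \<open>A query feeds \<open>S\<close> only from \<open>S\<close> and from sets with one point
  less, so the recorded set grows by at most one point per query.\<close>

lemma component_card:
  "S \<subseteq> X \<Longrightarrow> t < card S \<Longrightarrow> component h t S r = (\<lambda>_. 0)"
proof (induction t arbitrary: S r)
  case (Suc t)
  have fin: "finite S"
    using Suc.prems(1) finite_X finite_subset by blast
  have "component h t S r = (\<lambda>_. 0)" for r
    using Suc by simp
  moreover have "component h t (S - {x}) r = (\<lambda>_. 0)" if "x \<in> S" for x r
    using Suc fin that by (intro Suc.IH) auto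
  ultimately show ?case
    by (simp add: apply_op_def qstep_def fluct_def avg_def)
qed auto

text \<open>The recursion for \<open>S\<close> calls only subsets of \<open>S\<close> and reads
  \<open>h\<close> only at points of \<open>S\<close>. Securing this is the purpose of the
  truncation.\<close>

lemma component_local:
  "S \<subseteq> X \<Longrightarrow> (\<And>x. x \<in> S \<Longrightarrow> h x = h' x) \<Longrightarrow> component h t S r = component h' t S r"
proof (induction t arbitrary: S r)
  case (Suc t)
  have "component h t S r = component h' t S r" for r
    using Suc by blast
  moreover have "component h t (S - {x}) r = component h' t (S - {x}) r" for x r
    using Suc by blast
  ultimately have "qstep h (\<lambda>S r a. apply_op {..<sys_dim alg t} (pre alg t) (component h t S r) (a, v)) S r b =
      qstep h' (\<lambda>S r a. apply_op {..<sys_dim alg t} (pre alg t) (component h' t S r) (a, v)) S r b" for b v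
    using Suc.prems(2) by (simp add: qstep_def hit_def out_def)
  then show ?case
    by (simp only: component.simps)
qed auto

text \<open>Summation over \<open>S\<close> with fixed \<open>x\<close> turns the hit terms into an
  inner \<open>fluct\<close> by \<open>fluct_total\<close>, and merges the two sources of the output
  terms into the full state.\<close>

lemma total_qstep:
  assumes es: "efron_stein \<Phi>"
  shows "total (qstep h \<Phi>) r b = trunc h (total \<Phi>) r b"
proof -
  have 1: "(\<Sum>S\<in>Pow X. \<Sum>x\<in>S. fluct x (\<lambda>r. hit h x r a * \<Phi> S r a) r) =
      (\<Sum>x\<in>X. fluct x (\<lambda>r. hit h x r a * fluct x (\<lambda>r. total \<Phi> r a) r) r)" for a
    unfolding sum_Pow_swap
    by (intro sum.cong refl) (simp add: fluct_total[OF es] sum_distrib_left flip: fluct_sum)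
  have 2: "(\<Sum>S\<in>Pow X. \<Sum>x\<in>S. fluct x (\<lambda>r. out h x r b * (\<Phi> S r (\<omega> x) + \<Phi> (S - {x}) r (\<omega> x))) r) =
      (\<Sum>x\<in>X. fluct x (\<lambda>r. out h x r b * total \<Phi> r (\<omega> x)) r)"
    unfolding sum_Pow_swap
    by (intro sum.cong refl)
      (simp only: fluct_sum[symmetric] sum_distrib_left[symmetric] sum_remove_eq_total)
  have "total (qstep h \<Phi>) r b =
     (\<Sum>a\<in>A. K0 b a * (total \<Phi> r a - (\<Sum>S\<in>Pow X. \<Sum>x\<in>S. fluct x (\<lambda>r. hit h x r a * \<Phi> S r a) r))) +
     (\<Sum>S\<in>Pow X. \<Sum>x\<in>S. fluct x (\<lambda>r. out h x r b * (\<Phi> S r (\<omega> x) + \<Phi> (S - {x}) r (\<omega> x))) r)"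
    unfolding total_def qstep_def sum.distrib
    by (subst sum.swap) (simp add: sum_subtractf flip: sum_distrib_left)
  then show ?thesis
    by (simp only: 1 2 trunc_def)
qed

lemma apply_ideal:
  "apply_op A (ideal h r) \<psi> b =
     (\<Sum>x\<in>X. out h x r b * \<psi> (\<omega> x)) + (\<Sum>a\<in>A. K0 b a * (\<psi> a - (\<Sum>x\<in>X. hit h x r a) * \<psi> a))"
proof -
  have "(\<Sum>a\<in>A. (\<Sum>x\<in>X. of_bool (a = \<omega> x) * out h x r b) * \<psi> a) =
      (\<Sum>x\<in>X. \<Sum>a\<in>A. if a = \<omega> x then out h x r b * \<psi> a else 0)"
    unfolding sum_distrib_right by (subst sum.swap) (auto intro!: sum.cong)
  also have "\<dots> = (\<Sum>x\<in>X. out h x r b * \<psi> (\<omega> x))"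
    using \<omega>(2) by (intro sum.cong) (auto simp: image_subset_iff)
  finally have "apply_op A (ideal h r) \<psi> b =
      (\<Sum>x\<in>X. out h x r b * \<psi> (\<omega> x)) + (\<Sum>a\<in>A. K0 b a * (1 - (\<Sum>x\<in>X. hit h x r a)) * \<psi> a)"
    by (simp only: apply_op_def ideal_def distrib_right sum.distrib)
  then show ?thesis
    by (simp add: left_diff_distrib mult.assoc)
qed

section \<open>Truncation error of a single query\<close>

definition defect :: "('x \<Rightarrow> 'l) \<Rightarrow> (('x \<Rightarrow> 'z) \<Rightarrow> 'a state) \<Rightarrow> ('x \<Rightarrow> 'z) \<Rightarrow> 'a state" where
  "defect h F r a = (\<Sum>x\<in>X. fluct x (\<lambda>r. hit h x r a * fluct x (\<lambda>r. F r a) r) r - hit h x r a * F r a)"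

definition collapse :: "('x \<Rightarrow> 'l) \<Rightarrow> (('x \<Rightarrow> 'z) \<Rightarrow> 'a state) \<Rightarrow> ('x \<Rightarrow> 'z) \<Rightarrow> 'b state" where
  "collapse h F r b = (\<Sum>x\<in>X. avg x (\<lambda>r. out h x r b * F r (\<omega> x)) r)"

text \<open>The truncation loses two things: the input-side hits that are not attributed to a
  recorded point (\<open>defect\<close>, still to be sent through \<open>K0\<close>), and the part
  of each answer that does not depend on the fresh tag (\<open>collapse\<close>).\<close>

lemma ideal_minus_trunc:
  "apply_op A (ideal h r) (F r) b - trunc h F r b =
     apply_op A K0 (defect h F r) b + collapse h F r b"
proof -
  have "(\<Sum>a\<in>A. K0 b a * (F r a - (\<Sum>x\<in>X. hit h x r a) * F r a)) -
      (\<Sum>a\<in>A. K0 b a * (F r a - (\<Sum>x\<in>X. fluct x (\<lambda>r. hit h x r a * fluct x (\<lambda>r. F r a) r) r))) =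
      apply_op A K0 (defect h F r) b"
    unfolding apply_op_def defect_def sum_subtractf[symmetric]
    by (intro sum.cong refl) (simp add: algebra_simps sum_subtractf sum_distrib_left)
  moreover have "(\<Sum>x\<in>X. out h x r b * F r (\<omega> x)) - (\<Sum>x\<in>X. fluct x (\<lambda>r. out h x r b * F r (\<omega> x)) r) =
      collapse h F r b"
    by (simp add: collapse_def fluct_def sum_subtractf)
  ultimately show ?thesis
    unfolding apply_ideal trunc_def by (simp add: algebra_simps)
qed

text \<open>Only a contraction is demanded, because deleting columns destroys isometry.\<close>

definition good :: "('x \<Rightarrow> 'l) \<Rightarrow> bool" where
  "good h \<longleftrightarrow> inj_on (\<lambda>(x, z). \<nu> x (h x) z) (X \<times> Z) \<and> (\<forall>x\<in>X. \<forall>z\<in>Z. \<nu> x (h x) z \<in> B) \<and>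
     (\<forall>r\<in>tables. contraction A B (ideal h r))"

lemma good_inj:
  "good h \<Longrightarrow> x \<in> X \<Longrightarrow> x' \<in> X \<Longrightarrow> z \<in> Z \<Longrightarrow> z' \<in> Z \<Longrightarrow>
    \<nu> x (h x) z = \<nu> x' (h x') z' \<longleftrightarrow> x = x' \<and> z = z'"
  unfolding good_def inj_on_def by fastforce

lemma sum_avg_cong: "(\<And>z. z \<in> Z \<Longrightarrow> F (r(x := z)) = G (r(x := z))) \<Longrightarrow> avg x F r = avg x G r"
  by (simp add: avg_def)

lemma hit_eq:
  assumes "good h" "x\<^sub>0 \<in> X" "z\<^sub>0 \<in> Z" "\<delta> a = Some (\<nu> x\<^sub>0 (h x\<^sub>0) z\<^sub>0)" "x \<in> X" "r \<in> tables"
  shows "hit h x r a = of_bool (x = x\<^sub>0 \<and> r x = z\<^sub>0)"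
  using good_inj[OF assms(1,5,2) tables_in[OF assms(6,5)] assms(3)] assms(4)
  by (auto simp: hit_def)

text \<open>Only \<open>x\<^sub>0\<close> can hit \<open>a\<close>, and it does so exactly if its
  tag is \<open>z\<^sub>0\<close>. The first summand restricts the \<open>avg\<close> part to this
  event; the second is the average of the \<open>fluct\<close> part restricted to it.\<close>

lemma defect_eq:
  assumes "good h" "x\<^sub>0 \<in> X" "z\<^sub>0 \<in> Z" "\<delta> a = Some (\<nu> x\<^sub>0 (h x\<^sub>0) z\<^sub>0)" "r \<in> tables"
  shows "defect h F r a = - (of_bool (r x\<^sub>0 = z\<^sub>0) * avg x\<^sub>0 (\<lambda>r. F r a) r +
           fluct x\<^sub>0 (\<lambda>r. F r a) (r(x\<^sub>0 := z\<^sub>0)) / of_nat (card Z))"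
proof -
  let ?t = "\<lambda>x. fluct x (\<lambda>r. hit h x r a * fluct x (\<lambda>r. F r a) r) r - hit h x r a * F r a"
  have avg: "avg x (\<lambda>r. hit h x r a * fluct x (\<lambda>r. F r a) r) r =
      avg x (\<lambda>r. of_bool (r x = z\<^sub>0) * (of_bool (x = x\<^sub>0) * fluct x (\<lambda>r. F r a) r)) r" if "x \<in> X" for x
    using that assms by (intro sum_avg_cong) (subst hit_eq[OF assms(1-4)], auto simp: tables_upd)
  have "?t x = 0" if "x \<in> X" "x \<noteq> x\<^sub>0" for x
    unfolding fluct_def[of x "\<lambda>r. hit h x r a * fluct x (\<lambda>r. F r a) r"] avg[OF that(1)]
      hit_eq[OF assms(1-4) that(1) assms(5)] using that(2) by (simp add: avg_def)
  then have t: "?t x = (if x = x\<^sub>0 then ?t x\<^sub>0 else 0)" if "x \<in> X" for x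
    using that by auto
  have "defect h F r a = (\<Sum>x\<in>X. if x = x\<^sub>0 then ?t x\<^sub>0 else 0)"
    unfolding defect_def by (intro sum.cong refl t)
  then have "defect h F r a = ?t x\<^sub>0"
    using assms(2) by (simp only: sum.delta finite_X if_True)
  also have "\<dots> = - (of_bool (r x\<^sub>0 = z\<^sub>0) * avg x\<^sub>0 (\<lambda>r. F r a) r +
           fluct x\<^sub>0 (\<lambda>r. F r a) (r(x\<^sub>0 := z\<^sub>0)) / of_nat (card Z))"
    unfolding fluct_def[of x\<^sub>0 "\<lambda>r. hit h x\<^sub>0 r a * fluct x\<^sub>0 (\<lambda>r. F r a) r"] avg[OF assms(2)]
      hit_eq[OF assms(1-4,2,5)] avg_of_bool[OF assms(3)]
    by (simp add: fluct_def algebra_simps)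
  finally show ?thesis .
qed

lemma cmod_add_sq_le: "(cmod (u + v))\<^sup>2 \<le> 2 * (cmod u)\<^sup>2 + 2 * (cmod v)\<^sup>2"
proof -
  have "(cmod (u + v))\<^sup>2 \<le> (cmod u + cmod v)\<^sup>2"
    by (intro power_mono norm_triangle_ineq) auto
  also have "\<dots> \<le> 2 * (cmod u)\<^sup>2 + 2 * (cmod v)\<^sup>2"
    using sum_squares_bound[of "cmod u" "cmod v"] by (simp add: power2_sum)
  finally show ?thesis .
qed

text \<open>Each summand of \<open>defect_eq\<close> retains at most the fraction
  \<open>1 / card Z\<close> of its squared norm. The \<open>avg\<close> and \<open>fluct\<close>
  parts add up by \<open>avg_pythagoras\<close>; the factor 2 is the price of squaring a
  sum.\<close>

lemma sum_defect_le:
  assumes "good h"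
  shows "card Z * (\<Sum>r\<in>tables. (cmod (defect h F r a))\<^sup>2) \<le> 2 * (\<Sum>r\<in>tables. (cmod (F r a))\<^sup>2)"
proof (cases "\<exists>x\<in>X. \<exists>z\<in>Z. \<delta> a = Some (\<nu> x (h x) z)")
  case True
  then obtain x z where x: "x \<in> X" and z: "z \<in> Z" and d: "\<delta> a = Some (\<nu> x (h x) z)"
    by blast
  let ?F = "\<lambda>r. F r a" and ?N = "real (card Z)"
  let ?u = "\<lambda>r. of_bool (r x = z) * avg x ?F r" and ?g = "fluct x ?F"
  have N: "?N > 0"
    using card_Z_pos by simp
  have "(\<Sum>r\<in>tables. (cmod (defect h F r a))\<^sup>2) \<le>
      (\<Sum>r\<in>tables. 2 * (cmod (?u r))\<^sup>2 + 2 * (cmod (?g (r(x := z)) / of_nat (card Z)))\<^sup>2)"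
    unfolding defect_eq[OF assms x z d] norm_minus_cancel
    by (intro sum_mono) (subst defect_eq[OF assms x z d], assumption, unfold norm_minus_cancel,
        rule cmod_add_sq_le)
  also have "\<dots> = 2 * (\<Sum>r\<in>tables. (cmod (?u r))\<^sup>2) +
      2 * (\<Sum>r\<in>tables. (cmod (?g (r(x := z))))\<^sup>2) / ?N\<^sup>2"
    by (simp add: sum.distrib norm_divide power_divide sum_distrib_left sum_divide_distrib)
  finally have "?N * (\<Sum>r\<in>tables. (cmod (defect h F r a))\<^sup>2) \<le>
      2 * (?N * (\<Sum>r\<in>tables. (cmod (?u r))\<^sup>2)) + 2 * (\<Sum>r\<in>tables. (cmod (?g (r(x := z))))\<^sup>2) / ?N"
    using N by (simp add: field_simps power2_eq_square)
  also have "\<dots> \<le> 2 * (\<Sum>r\<in>tables. (cmod (avg x ?F r))\<^sup>2) + 2 * (\<Sum>r\<in>tables. (cmod (?g r))\<^sup>2)"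
  proof -
    \<comment> \<open>Fixing a tag costs a factor \<open>card Z\<close>, which cancels one of the
      two powers in the denominator; the other was cancelled by the factor on the left.\<close>
    have "2 * (\<Sum>r\<in>tables. (cmod (?g (r(x := z))))\<^sup>2) / ?N \<le> 2 * (\<Sum>r\<in>tables. (cmod (?g r))\<^sup>2)"
      using sum_upd_sq_le[OF x z, of ?g] N by (simp add: divide_simps mult_ac)
    then show ?thesis
      using sum_of_bool_avg_sq[OF x z, of ?F] by linarith
  qed
  also have "\<dots> = 2 * (\<Sum>r\<in>tables. (cmod (?F r))\<^sup>2)"
    using avg_pythagoras[OF x, of ?F] by (simp add: fluct_def)
  finally show ?thesis .
next
  case False
  have h0: "hit h x r a = 0" if "x \<in> X" "r \<in> tables" for x r
    using False that tables_in[OF that(2,1)] by (auto simp: hit_def)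
  have "defect h F r a = 0" if r: "r \<in> tables" for r
  proof -
    have "fluct x (\<lambda>r. hit h x r a * fluct x (\<lambda>r. F r a) r) r = 0" if "x \<in> X" for x
      using that r h0
      by (simp add: fluct_def[of x "\<lambda>r. hit h x r a * fluct x (\<lambda>r. F r a) r"] avg_def tables_upd)
    then show ?thesis
      using r h0 by (simp add: defect_def)
  qed
  then show ?thesis
    by (simp add: sum_nonneg)
qed

lemma tnorm_defect_le:
  assumes "good h"
  shows "tnorm A (defect h F) \<le> sqrt 2 / sqrt (card Z) * tnorm A F"
proof (rule power2_le_imp_le)
  have "card Z * (tnorm A (defect h F))\<^sup>2 = (\<Sum>a\<in>A. card Z * (\<Sum>r\<in>tables. (cmod (defect h F r a))\<^sup>2))"
    unfolding tnorm_power2 by (subst sum.swap) (simp add: sum_distrib_left)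
  also have "\<dots> \<le> (\<Sum>a\<in>A. 2 * (\<Sum>r\<in>tables. (cmod (F r a))\<^sup>2))"
    by (intro sum_mono sum_defect_le assms)
  also have "\<dots> = 2 * (tnorm A F)\<^sup>2"
    unfolding tnorm_power2 by (subst sum.swap) (simp add: sum_distrib_left)
  finally show "(tnorm A (defect h F))\<^sup>2 \<le> (sqrt 2 / sqrt (card Z) * tnorm A F)\<^sup>2"
    using card_Z_pos by (simp add: power_mult_distrib power_divide field_simps)
qed simp

lemma collapse_eq:
  assumes "good h" "r \<in> tables" "x \<in> X" "z \<in> Z"
  shows "collapse h F r (\<nu> x (h x) z) = F (r(x := z)) (\<omega> x) / of_nat (card Z)"
proof -
  have "avg y (\<lambda>r. out h y r (\<nu> x (h x) z) * F r (\<omega> y)) r =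
      avg y (\<lambda>r. of_bool (r y = z) * (of_bool (y = x) * F r (\<omega> y))) r" if "y \<in> X" for y
    using that good_inj[OF assms(1,3) that assms(4)] by (intro sum_avg_cong) (auto simp: out_def)
  then have "collapse h F r (\<nu> x (h x) z) =
      (\<Sum>y\<in>X. if y = x then F (r(x := z)) (\<omega> x) / of_nat (card Z) else 0)"
    unfolding collapse_def by (intro sum.cong) (auto simp: avg_of_bool[OF assms(4)])
  then show ?thesis
    using assms(3) by simp
qed

lemma collapse_eq_0:
  assumes "r \<in> tables" "\<And>x z. x \<in> X \<Longrightarrow> z \<in> Z \<Longrightarrow> b \<noteq> \<nu> x (h x) z"
  shows "collapse h F r b = 0"
  unfolding collapse_def avg_def using assms by (auto simp: out_def intro!: sum.neutral)

text \<open>An output label reveals both \<open>x\<close> and its tag, so it receives a single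
  summand of the average, with weight \<open>1 / card Z\<close>. Squaring gives two such factors,
  and summing over the tag values returns one.\<close>

lemma tnorm_collapse_le:
  assumes "good h"
  shows "tnorm B (collapse h F) \<le> 1 / sqrt (card Z) * tnorm A F"
proof (rule power2_le_imp_le)
  let ?N = "real (card Z)" and ?\<nu> = "\<lambda>(x, z). \<nu> x (h x) z"
  have N: "?N > 0"
    using card_Z_pos by simp
  have inj: "inj_on ?\<nu> (X \<times> Z)" and sub: "?\<nu> ` (X \<times> Z) \<subseteq> B"
    using assms by (auto simp: good_def)
  have "(\<Sum>b\<in>B. (cmod (collapse h F r b))\<^sup>2) = (\<Sum>x\<in>X. \<Sum>z\<in>Z. (cmod (F (r(x := z)) (\<omega> x)))\<^sup>2 / ?N\<^sup>2)"
    if r: "r \<in> tables" for r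
  proof -
    have "(\<Sum>b\<in>B. (cmod (collapse h F r b))\<^sup>2) = (\<Sum>b\<in>?\<nu> ` (X \<times> Z). (cmod (collapse h F r b))\<^sup>2)"
      using sub by (intro sum.mono_neutral_right) (auto intro!: collapse_eq_0[OF r])
    also have "\<dots> = (\<Sum>(x, z)\<in>X \<times> Z. (cmod (F (r(x := z)) (\<omega> x)))\<^sup>2 / ?N\<^sup>2)"
      unfolding sum.reindex[OF inj] using collapse_eq[OF assms r]
      by (intro sum.cong) (auto simp: norm_divide power_divide)
    finally show ?thesis
      by (simp add: sum.cartesian_product)
  qed
  then have "(tnorm B (collapse h F))\<^sup>2 =
      (\<Sum>r\<in>tables. \<Sum>x\<in>X. \<Sum>z\<in>Z. (cmod (F (r(x := z)) (\<omega> x)))\<^sup>2 / ?N\<^sup>2)"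
    by (simp add: tnorm_power2)
  also have "\<dots> = (\<Sum>x\<in>X. (\<Sum>r\<in>tables. \<Sum>z\<in>Z. (cmod (F (r(x := z)) (\<omega> x)))\<^sup>2) / ?N\<^sup>2)"
    by (subst sum.swap) (simp add: sum_divide_distrib)
  also have "\<dots> = (\<Sum>x\<in>X. \<Sum>r\<in>tables. (cmod (F r (\<omega> x)))\<^sup>2) / ?N"
    using sum_tables_upd[of _ "\<lambda>r. (cmod (F r (\<omega> _)))\<^sup>2"] N
    by (simp add: sum_divide_distrib power2_eq_square)
  also have "\<dots> = (\<Sum>r\<in>tables. \<Sum>a\<in>\<omega> ` X. (cmod (F r a))\<^sup>2) / ?N"
    by (subst sum.swap) (simp add: sum.reindex[OF \<omega>(1)])
  also have "\<dots> \<le> (tnorm A F)\<^sup>2 / ?N"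
    unfolding tnorm_power2 using N \<omega>(2) by (intro divide_right_mono sum_mono sum_mono2) auto
  finally show "(tnorm B (collapse h F))\<^sup>2 \<le> (1 / sqrt (card Z) * tnorm A F)\<^sup>2"
    using N by (simp add: power_mult_distrib power_divide)
qed simp

text \<open>The numerator rounds up \<open>sqrt 2 + 1\<close>, with \<open>sqrt 2\<close> coming
  from \<open>defect\<close> and 1 from \<open>collapse\<close>.\<close>

definition eps :: real where "eps = 3 / sqrt (card Z)"

lemma eps_nonneg [simp]: "0 \<le> eps"
  by (simp add: eps_def)

lemma tnorm_ideal_minus_trunc_le:
  assumes "good h"
  shows "tnorm B (\<lambda>r b. apply_op A (ideal h r) (F r) b - trunc h F r b) \<le> eps * tnorm A F"
proof -
  have "tnorm B (\<lambda>r b. apply_op A (ideal h r) (F r) b - trunc h F r b) \<le>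
      tnorm B (\<lambda>r. apply_op A K0 (defect h F r)) + tnorm B (collapse h F)"
    unfolding ideal_minus_trunc by (rule tnorm_add_le)
  also have "\<dots> \<le> tnorm A (defect h F) + tnorm B (collapse h F)"
    by (intro add_right_mono tnorm_mono vnorm_apply_le K0)
  also have "\<dots> \<le> (sqrt 2 + 1) / sqrt (card Z) * tnorm A F"
    using tnorm_defect_le[OF assms, of F] tnorm_collapse_le[OF assms, of F]
    by (simp add: add_divide_distrib distrib_right)
  also have "\<dots> \<le> eps * tnorm A F"
    using sqrt2_less_2 unfolding eps_def by (intro mult_right_mono divide_right_mono) auto
  finally show ?thesis .
qed

end

section \<open>Accumulation of the error over all queries\<close>

context tag_space
begin

lemma tnorm_Times_power2:
  assumes "finite W"
  shows "(tnorm (A \<times> W) F)\<^sup>2 = (\<Sum>w\<in>W. (tnorm A (\<lambda>r a. F r (a, w)))\<^sup>2)"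
  unfolding tnorm_def L2_set_def
  by (simp add: sum_nonneg vnorm_Times_power2 sum.swap[of _ W])

lemma tnorm_le_const:
  assumes "\<And>r. r \<in> tables \<Longrightarrow> vnorm I (\<Psi> r) \<le> c" "0 \<le> c"
  shows "tnorm I \<Psi> \<le> c * sqrt (card tables)"
proof -
  have "tnorm I \<Psi> \<le> L2_set (\<lambda>r. c) tables"
    unfolding tnorm_def using assms by (intro L2_set_mono) auto
  then show ?thesis
    using assms(2) by (simp add: L2_set_constant mult.commute)
qed

lemma card_tables_pos: "card tables > 0"
  using tables_ne by (simp add: card_gt_0_iff)

end

context recorded_process
begin

abbreviation "run h r t \<equiv> run_alg A B alg (ideal h r) t"
abbreviation "sys t \<equiv> {..<sys_dim alg t}"

definition blowup :: real where "blowup = (1 + eps) ^ T - 1"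

lemma pre_isometry: "t < T \<Longrightarrow> is_isometry (sys t) (A \<times> {..<work_dim alg t}) (pre alg t)"
  and post_isometry: "t < T \<Longrightarrow> is_isometry (B \<times> {..<work_dim alg t}) (sys (Suc t)) (post alg t)"
  using is_query_algD[OF alg] by auto

lemma vnorm_run_le:
  assumes "good h" "r \<in> tables"
  shows "t \<le> T \<Longrightarrow> vnorm (sys t) (run h r t) \<le> 1"
  using vnorm_run_contraction[OF finite_A finite_B alg] assms by (simp add: good_def)

lemma total_component_Suc:
  "total (component h (Suc t)) r = apply_op (B \<times> {..<work_dim alg t}) (post alg t)
     (\<lambda>(b, v). trunc h (\<lambda>r a. apply_op (sys t) (pre alg t) (total (component h t) r) (a, v)) r b)"
proof -
  have tot: "total (\<lambda>S r a. apply_op (sys t) (pre alg t) (component h t S r) (a, v)) =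
      (\<lambda>r a. apply_op (sys t) (pre alg t) (total (component h t) r) (a, v))" for v
    by (intro ext) (simp add: total_def[abs_def] apply_op_sum)
  have es: "efron_stein (\<lambda>S r a. apply_op (sys t) (pre alg t) (component h t S r) (a, v))" for v
    by (rule spec[OF iffD1[OF efron_stein_slice efron_stein_apply_op[OF efron_stein_component]]])
  have "total (component h (Suc t)) r = apply_op (B \<times> {..<work_dim alg t}) (post alg t)
     (\<lambda>p. \<Sum>S\<in>Pow X. (\<lambda>(b, v). qstep h (\<lambda>S r a.
        apply_op (sys t) (pre alg t) (component h t S r) (a, v)) S r b) p)"
    unfolding apply_op_sum by (simp add: total_def[abs_def])
  also have "(\<lambda>p. \<Sum>S\<in>Pow X. (\<lambda>(b, v). qstep h (\<lambda>S r a.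
        apply_op (sys t) (pre alg t) (component h t S r) (a, v)) S r b) p) =
     (\<lambda>(b, v). trunc h (\<lambda>r a. apply_op (sys t) (pre alg t) (total (component h t) r) (a, v)) r b)"
    using total_qstep[OF es, of h] unfolding tot by (auto simp: total_def)
  finally show ?thesis .
qed

text \<open>With \<open>d\<close> the error so far in units of \<open>sqrt (card tables)\<close>, a
  further query gives at most \<open>d + eps * (1 + d)\<close>. The old error passes through a
  contraction, while the new error is proportional to the norm of the truncated state, which is at
  most \<open>1 + d\<close>.\<close>

lemma tnorm_run_minus_total_aux:
  assumes good: "good h"
  shows "t \<le> T \<Longrightarrow> tnorm (sys t) (\<lambda>r i. run h r t i - total (component h t) r i) \<le>
           ((1 + eps) ^ t - 1) * sqrt (card tables)"
proof (induction t)
  case 0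
  have "total (component h 0) r i = init alg i" for r i
    unfolding total_def by (simp add: if_distrib[of "\<lambda>f. f i"] cong: if_cong)
  then show ?case
    by (simp add: tnorm_def vnorm_def L2_set_def del: component.simps)
next
  case (Suc t)
  then have t: "t < T" by simp
  let ?W = "{..<work_dim alg t}" and ?c = "component h t" and ?\<rho> = "sqrt (card tables)"
  let ?p = "apply_op (sys t) (pre alg t)"
  let ?D = "\<lambda>r i. run h r t i - total ?c r i"
  let ?F = "\<lambda>r. ?p (total ?c r)"
  let ?E = "\<lambda>r (b, v). apply_op A (ideal h r) (\<lambda>a. ?F r (a, v)) b - trunc h (\<lambda>r a. ?F r (a, v)) r b"
  let ?G = "\<lambda>r. apply_op (A \<times> ?W) (tensor_id (ideal h r)) (?p (?D r))"
  have D: "tnorm (sys t) ?D \<le> ((1 + eps) ^ t - 1) * ?\<rho>"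
    using Suc by simp
  have "run h r (Suc t) i - total (component h (Suc t)) r i =
      apply_op (B \<times> ?W) (post alg t) (\<lambda>p. ?G r p + ?E r p) i" for r i
  proof -
    have "apply_op (A \<times> ?W) (tensor_id (ideal h r)) (?p (run h r t)) p -
        (\<lambda>(b, v). trunc h (\<lambda>r a. ?F r (a, v)) r b) p = ?G r p + ?E r p" if "p \<in> B \<times> ?W" for p
      using that by (auto simp: apply_tensor_id apply_op_diff)
    then have "apply_op (B \<times> ?W) (post alg t) (\<lambda>p. apply_op (A \<times> ?W) (tensor_id (ideal h r)) (?p (run h r t)) p -
        (\<lambda>(b, v). trunc h (\<lambda>r a. ?F r (a, v)) r b) p) =
        apply_op (B \<times> ?W) (post alg t) (\<lambda>p. ?G r p + ?E r p)"
      by (rule apply_op_cong)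
    then show ?thesis
      unfolding apply_op_diff run_alg.simps total_component_Suc by metis
  qed
  then have "tnorm (sys (Suc t)) (\<lambda>r i. run h r (Suc t) i - total (component h (Suc t)) r i) =
      tnorm (B \<times> ?W) (\<lambda>r p. ?G r p + ?E r p)"
    using t by (simp add: tnorm_def vnorm_isometry post_isometry del: run_alg.simps component.simps)
  also have "\<dots> \<le> tnorm (B \<times> ?W) ?G + tnorm (B \<times> ?W) ?E"
    by (rule tnorm_add_le)
  finally have 1: "tnorm (sys (Suc t)) (\<lambda>r i. run h r (Suc t) i - total (component h (Suc t)) r i) \<le>
      tnorm (B \<times> ?W) ?G + tnorm (B \<times> ?W) ?E" .
  have 2: "tnorm (B \<times> ?W) ?G \<le> tnorm (sys t) ?D"
  proof (rule tnorm_mono)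
    fix r assume r: "r \<in> tables"
    have "vnorm (B \<times> ?W) (?G r) \<le> vnorm (A \<times> ?W) (?p (?D r))"
      using good r by (intro vnorm_apply_le contraction_tensor_id) (auto simp: good_def)
    also have "\<dots> = vnorm (sys t) (?D r)"
      using t by (simp add: vnorm_isometry pre_isometry)
    finally show "vnorm (B \<times> ?W) (?G r) \<le> vnorm (sys t) (?D r)" .
  qed
  have 3: "tnorm (B \<times> ?W) ?E \<le> eps * tnorm (A \<times> ?W) ?F"
  proof (rule power2_le_imp_le)
    have "(tnorm (B \<times> ?W) ?E)\<^sup>2 = (\<Sum>v\<in>?W. (tnorm B (\<lambda>r b. ?E r (b, v)))\<^sup>2)"
      by (simp add: tnorm_Times_power2)
    also have "\<dots> \<le> (\<Sum>v\<in>?W. (eps * tnorm A (\<lambda>r a. ?F r (a, v)))\<^sup>2)"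
      using tnorm_ideal_minus_trunc_le[OF good, of "\<lambda>r a. ?F r (a, _)"]
      by (intro sum_mono power_mono) auto
    also have "\<dots> = (eps * tnorm (A \<times> ?W) ?F)\<^sup>2"
      by (simp add: tnorm_Times_power2 power_mult_distrib sum_distrib_left)
    finally show "(tnorm (B \<times> ?W) ?E)\<^sup>2 \<le> (eps * tnorm (A \<times> ?W) ?F)\<^sup>2" .
  qed simp
  \<comment> \<open>The truncated state is estimated through its distance to the run, because no
    direct norm bound is available for it.\<close>
  have "tnorm (A \<times> ?W) ?F = tnorm (sys t) (\<lambda>r i. run h r t i + - ?D r i)"
    using t by (simp add: tnorm_def vnorm_isometry pre_isometry)
  also have "\<dots> \<le> tnorm (sys t) (\<lambda>r. run h r t) + tnorm (sys t) ?D"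
    by (rule order_trans[OF tnorm_add_le]) (simp only: tnorm_minus order_refl)
  finally have "tnorm (A \<times> ?W) ?F \<le> tnorm (sys t) (\<lambda>r. run h r t) + tnorm (sys t) ?D" .
  moreover have "tnorm (sys t) (\<lambda>r. run h r t) \<le> 1 * ?\<rho>"
    using vnorm_run_le[OF good] t by (intro tnorm_le_const) auto
  ultimately have "eps * tnorm (A \<times> ?W) ?F \<le> eps * (1 * ?\<rho> + tnorm (sys t) ?D)"
    by (intro mult_left_mono) auto
  with 1 2 3 have "tnorm (sys (Suc t)) (\<lambda>r i. run h r (Suc t) i - total (component h (Suc t)) r i) \<le>
      tnorm (sys t) ?D + eps * (1 * ?\<rho> + tnorm (sys t) ?D)"
    by linarith
  also have "\<dots> \<le> ((1 + eps) ^ t - 1) * ?\<rho> + eps * (1 * ?\<rho> + ((1 + eps) ^ t - 1) * ?\<rho>)"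
    using D by (intro add_mono mult_left_mono) auto
  also have "\<dots> = ((1 + eps) ^ Suc t - 1) * ?\<rho>"
    by (simp add: algebra_simps)
  finally show ?case .
qed

lemma blowup_nonneg: "0 \<le> blowup"
  by (simp add: blowup_def)

lemma tnorm_run_minus_total:
  assumes "good h"
  shows "tnorm (sys T) (\<lambda>r i. run h r T i - total (component h T) r i) \<le> blowup * sqrt (card tables)"
  using tnorm_run_minus_total_aux[OF assms order_refl] by (simp add: blowup_def)

lemma tnorm_run: "good h \<Longrightarrow> tnorm (sys T) (\<lambda>r. run h r T) \<le> sqrt (card tables)"
  using tnorm_le_const[of "sys T" "\<lambda>r. run h r T" 1] vnorm_run_le by simp

lemma tnorm_total:
  assumes "good h"
  shows "tnorm (sys T) (total (component h T)) \<le> (1 + blowup) * sqrt (card tables)"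
proof -
  let ?D = "\<lambda>r i. run h r T i - total (component h T) r i"
  have "tnorm (sys T) (total (component h T)) = tnorm (sys T) (\<lambda>r i. run h r T i + - ?D r i)"
    by simp
  also have "\<dots> \<le> tnorm (sys T) (\<lambda>r. run h r T) + tnorm (sys T) ?D"
    by (rule order_trans[OF tnorm_add_le]) (simp only: tnorm_minus order_refl)
  finally show ?thesis
    using tnorm_run[OF assms] tnorm_run_minus_total[OF assms] by (simp add: algebra_simps)
qed

section \<open>Acceptance probabilities in terms of components\<close>

definition mean :: "(nat, nat) operator \<Rightarrow> ('x \<Rightarrow> 'l) \<Rightarrow> real" where
  "mean M h = (\<Sum>r\<in>tables. expect (sys T) M (run h r T)) / card tables"

text \<open>The contribution of the recorded set \<open>S\<close> to the averaged outcome;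
  \<open>mass\<close> bounds it from above by the squared norm of the same component.\<close>

definition weight :: "(nat, nat) operator \<Rightarrow> ('x \<Rightarrow> 'l) \<Rightarrow> 'x set \<Rightarrow> real" where
  "weight M h S = (\<Sum>r\<in>tables. expect (sys T) M (component h T S r)) / card tables"

definition mass :: "('x \<Rightarrow> 'l) \<Rightarrow> 'x set \<Rightarrow> real" where
  "mass h S = (\<Sum>r\<in>tables. (vnorm (sys T) (component h T S r))\<^sup>2) / card tables"

lemma weight_bounds:
  assumes "is_effect (sys T) M"
  shows "0 \<le> weight M h S" "weight M h S \<le> mass h S"
  unfolding weight_def mass_def using is_effect_expect[OF assms]
  by (auto intro!: sum_nonneg divide_nonneg_nonneg divide_right_mono sum_mono)

lemma weight_local:
  "S \<subseteq> X \<Longrightarrow> (\<And>x. x \<in> S \<Longrightarrow> h x = h' x) \<Longrightarrow> weight M h S = weight M h' S"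
  unfolding weight_def using component_local[of S h h'] by simp

lemma mass_eq_0: "S \<subseteq> X \<Longrightarrow> T < card S \<Longrightarrow> mass h S = 0"
  by (simp add: mass_def component_card vnorm_def L2_set_def)

lemma mass_nonneg: "0 \<le> mass h S"
  by (simp add: mass_def sum_nonneg)

lemma sum_mass_le:
  assumes "good h"
  shows "(\<Sum>S\<in>Pow X. mass h S) \<le> (1 + blowup)\<^sup>2"
proof -
  have "(\<Sum>S\<in>Pow X. mass h S) = (tnorm (sys T) (total (component h T)))\<^sup>2 / card tables"
    unfolding mass_def using sum_vnorm_total[OF efron_stein_component, of "sys T" h T]
    by (simp add: sum_divide_distrib[symmetric])
  also have "\<dots> \<le> ((1 + blowup) * sqrt (card tables))\<^sup>2 / card tables"
    using tnorm_total[OF assms] by (intro divide_right_mono power_mono) auto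
  finally show ?thesis
    using card_tables_pos by (simp add: power_mult_distrib)
qed

text \<open>\<open>expect_lipschitz\<close> is applied at each table, followed by Cauchy-Schwarz
  over the tables. The second factor adds the norm bound 1 of the run to the norm bound
  \<open>1 + blowup\<close> of the truncated state.\<close>

lemma mean_close:
  assumes "good h" "is_effect (sys T) M"
  shows "\<bar>mean M h - (\<Sum>S\<in>Pow X. weight M h S)\<bar> \<le> blowup * (2 + blowup)"
proof -
  let ?\<Psi> = "\<lambda>r. run h r T" and ?\<Phi> = "total (component h T)" and ?I = "sys T"
  let ?D = "\<lambda>r i. ?\<Psi> r i - ?\<Phi> r i" and ?\<rho> = "sqrt (card tables)"
  have "(\<Sum>S\<in>Pow X. weight M h S) = (\<Sum>r\<in>tables. expect ?I M (?\<Phi> r)) / card tables"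
    unfolding weight_def sum_expect_total[OF efron_stein_component]
    by (simp add: sum_divide_distrib)
  then have "\<bar>mean M h - (\<Sum>S\<in>Pow X. weight M h S)\<bar> =
      \<bar>\<Sum>r\<in>tables. expect ?I M (?\<Psi> r) - expect ?I M (?\<Phi> r)\<bar> / card tables"
    by (simp add: mean_def sum_subtractf flip: diff_divide_distrib)
  also have "\<dots> \<le> (\<Sum>r\<in>tables. \<bar>vnorm ?I (?D r)\<bar> * \<bar>vnorm ?I (?\<Psi> r) + vnorm ?I (?\<Phi> r)\<bar>) / card tables"
    using expect_lipschitz[OF assms(2)]
    by (intro divide_right_mono order_trans[OF sum_abs] sum_mono) auto
  also have "\<dots> \<le> tnorm ?I ?D * L2_set (\<lambda>r. vnorm ?I (?\<Psi> r) + vnorm ?I (?\<Phi> r)) tables / card tables"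
    unfolding tnorm_def by (intro divide_right_mono L2_set_mult_ineq) auto
  also have "\<dots> \<le> (blowup * ?\<rho>) * ((2 + blowup) * ?\<rho>) / card tables"
  proof (intro divide_right_mono mult_mono)
    have "L2_set (\<lambda>r. vnorm ?I (?\<Psi> r) + vnorm ?I (?\<Phi> r)) tables \<le> tnorm ?I ?\<Psi> + tnorm ?I ?\<Phi>"
      unfolding tnorm_def by (rule L2_set_triangle_ineq)
    also have "\<dots> \<le> (2 + blowup) * ?\<rho>"
      using tnorm_run[OF assms(1)] tnorm_total[OF assms(1)] by (simp add: algebra_simps)
    finally show "L2_set (\<lambda>r. vnorm ?I (?\<Psi> r) + vnorm ?I (?\<Phi> r)) tables \<le> (2 + blowup) * ?\<rho>" .
  qed (use tnorm_run_minus_total[OF assms(1)] blowup_nonneg in auto)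
  also have "\<dots> = blowup * (2 + blowup)"
    using card_tables_pos by (simp add: field_simps)
  finally show ?thesis .
qed

end

subsection \<open>Bit strings and Simon functions\<close>

lemma bits_eq: "bits n = {x. set x \<subseteq> UNIV \<and> length x = n}"
  by (simp add: bits_def)

lemma finite_bits [simp]: "finite (bits n)"
  unfolding bits_eq by (rule finite_lists_length_eq) simp

lemma card_bits [simp]: "card (bits n) = 2 ^ n"
  unfolding bits_eq by (subst card_lists_length_eq) simp_all

lemma bits_iff [simp]: "x \<in> bits n \<longleftrightarrow> length x = n"
  by (simp add: bits_def)

lemma bits_ne [simp]: "bits n \<noteq> {}"
  by (metis card.empty card_bits power_eq_0_iff zero_neq_numeral)

lemma length_zeros [simp]: "length (zeros n) = n"
  by (simp add: zeros_def)

lemma nth_zeros [simp]: "i < n \<Longrightarrow> zeros n ! i = False"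
  by (simp add: zeros_def)

lemma length_bxor [simp]: "length (bxor x y) = min (length x) (length y)"
  by (simp add: bxor_def)

lemma nth_bxor [simp]: "i < length x \<Longrightarrow> i < length y \<Longrightarrow> bxor x y ! i = (x ! i \<noteq> y ! i)"
  by (simp add: bxor_def)

lemma bxor_bxor: "length x = length y \<Longrightarrow> bxor x (bxor x y) = y"
  by (rule nth_equalityI) auto

lemma bxor_bxor_right: "length x = length y \<Longrightarrow> bxor (bxor x y) y = x"
  by (rule nth_equalityI) auto

lemma hd_bxor: "length x = length y \<Longrightarrow> x \<noteq> [] \<Longrightarrow> hd (bxor x y) = (hd x \<noteq> hd y)"
  by (cases x; cases y) (auto simp: bxor_def)

text \<open>Only shifts \<open>s\<close> whose first bit is set are used: then the first bit separates the two points of a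
  coset of \<open>{0, s}\<close>, and it can serve as the bit table of the compressed problem.\<close>

definition coset_rep :: "bool list \<Rightarrow> bool list \<Rightarrow> bool list" where
  "coset_rep s x = (if hd x then bxor x s else x)"

lemma length_coset_rep: "length s = n \<Longrightarrow> length x = n \<Longrightarrow> length (coset_rep s x) = n"
  by (simp add: coset_rep_def)

text \<open>As \<open>s\<close> starts with a set bit, \<open>coset_rep s\<close> selects the
  element of \<open>{x, bxor x s}\<close> whose first bit is clear.\<close>

lemma coset_rep_eq_iff:
  assumes "n \<ge> 1" "length s = n" "hd s" "length x = n" "length y = n"
  shows "coset_rep s x = coset_rep s y \<longleftrightarrow> y \<in> {x, bxor x s}"
proof -
  have ne: "x \<noteq> []" "y \<noteq> []" "s \<noteq> []"
    using assms by auto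
  have hd: "hd (bxor x s) = (\<not> hd x)" "hd (bxor y s) = (\<not> hd y)"
    using assms ne by (auto simp: hd_bxor)
  have inv: "bxor (bxor x s) s = x" "bxor (bxor y s) s = y"
    using assms by (simp_all add: bxor_bxor_right)
  show ?thesis
  proof (cases "hd x = hd y")
    case True
    then have "y \<noteq> bxor x s"
      using hd by auto
    moreover have "bxor x s = bxor y s \<longleftrightarrow> x = y"
      using inv by metis
    ultimately show ?thesis
      using True by (auto simp: coset_rep_def)
  next
    case False
    then have "x \<noteq> y"
      by auto
    moreover have "x = bxor y s \<longleftrightarrow> y = bxor x s"
      using inv by metis
    ultimately show ?thesis
      using False by (cases "hd x") (simp_all add: coset_rep_def eq_commute[of y])
  qed
qed

lemma simon_function_coset_rep:
  assumes "n \<ge> 1" "length s = n" "hd s" "\<pi> permutes bits n"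
  shows "simon_function n s (\<pi> \<circ> coset_rep s)"
proof -
  have "s \<noteq> zeros n"
    using assms by (cases n) (auto simp: zeros_def)
  moreover have "inj \<pi>"
    using assms(4) by (rule permutes_inj)
  moreover have "\<pi> \<circ> coset_rep s \<in> bits n \<rightarrow> bits n"
    using permutes_in_image[OF assms(4)] assms(2) by (simp add: length_coset_rep Pi_def)
  ultimately show ?thesis
    using assms coset_rep_eq_iff[OF assms(1-3)] unfolding simon_function_def
    by (auto simp: inj_eq)
qed

lemma card_shifts:
  assumes "n \<ge> 1"
  shows "2 * card {s \<in> bits n. hd s} = 2 ^ n"
proof -
  obtain m where n: "n = Suc m"
    using assms by (cases n) auto
  have "{s \<in> bits n. hd s} = (#) True ` bits m"
    unfolding n by (auto simp: bits_def length_Suc_conv image_iff)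
  then show ?thesis
    by (simp add: card_image n)
qed

text \<open>Two colliding points determine the shift as their sum, so there are no more such shifts
  than pairs.\<close>

lemma card_colliding_shifts:
  assumes "n \<ge> 1" "S \<subseteq> bits n"
  shows "card {s \<in> bits n. hd s \<and> \<not> inj_on (coset_rep s) S} \<le> (card S)\<^sup>2"
proof -
  have fin: "finite S"
    using assms finite_bits finite_subset by blast
  have "{s \<in> bits n. hd s \<and> \<not> inj_on (coset_rep s) S} \<subseteq> (\<lambda>(x, y). bxor x y) ` (S \<times> S)"
  proof
    fix s assume "s \<in> {s \<in> bits n. hd s \<and> \<not> inj_on (coset_rep s) S}"
    then obtain x y where s: "length s = n" "hd s" and xy: "x \<in> S" "y \<in> S" "x \<noteq> y"
        "coset_rep s x = coset_rep s y"
      by (auto simp: inj_on_def)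
    have len: "length x = n" "length y = n"
      using xy assms(2) by auto
    then have "y = bxor x s"
      using coset_rep_eq_iff[OF assms(1) s len] xy by auto
    then have "s = bxor x y"
      using s len by (simp add: bxor_bxor)
    then show "s \<in> (\<lambda>(x, y). bxor x y) ` (S \<times> S)"
      using xy by auto
  qed
  then have "card {s \<in> bits n. hd s \<and> \<not> inj_on (coset_rep s) S} \<le> card ((\<lambda>(x, y). bxor x y) ` (S \<times> S))"
    using fin by (intro card_mono) auto
  also have "\<dots> \<le> card (S \<times> S)"
    using fin by (intro card_image_le) auto
  finally show ?thesis
    by (simp add: card_cartesian_product power2_eq_square)
qed

lemma inj_on_extends_to_permutes:
  assumes "finite A" "S \<subseteq> A" "inj_on f S" "f ` S \<subseteq> A"
  obtains \<theta> where "\<theta> permutes A" "\<And>x. x \<in> S \<Longrightarrow> \<theta> x = f x"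
proof -
  have "card (A - S) = card (A - f ` S)"
    using assms by (simp add: card_Diff_subset finite_subset[OF assms(2)] card_image)
  then obtain g where g: "bij_betw g (A - S) (A - f ` S)"
    using assms(1) finite_same_card_bij by blast
  define \<theta> where "\<theta> x = (if x \<in> S then f x else if x \<in> A then g x else x)" for x
  have "bij_betw \<theta> S (f ` S)"
    using assms(3) by (auto simp: bij_betw_def \<theta>_def inj_on_def)
  moreover have "bij_betw \<theta> (A - S) (A - f ` S)"
    using g by (subst bij_betw_cong[of _ _ g]) (auto simp: \<theta>_def)
  ultimately have "bij_betw \<theta> (S \<union> (A - S)) (f ` S \<union> (A - f ` S))"
    by (rule bij_betw_combine) auto
  moreover have "S \<union> (A - S) = A" "f ` S \<union> (A - f ` S) = A"
    using assms by auto
  ultimately have "bij_betw \<theta> A A"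
    by simp
  then have "\<theta> permutes A"
    by (rule bij_imp_permutes) (use assms(2) in \<open>auto simp: \<theta>_def\<close>)
  then show ?thesis
    using that by (simp add: \<theta>_def)
qed

subsection \<open>Permutations against Simon functions\<close>

locale simon_process = recorded_process "bits n" "bits n" A B alg T K0 \<omega> \<nu> \<delta>
  for n :: nat and A :: "'a set" and B :: "'b set" and alg :: "('a, 'b) query_alg" and T :: nat
    and K0 :: "('a, 'b) operator" and \<omega> :: "bool list \<Rightarrow> 'a"
    and \<nu> :: "bool list \<Rightarrow> bool list \<Rightarrow> bool list \<Rightarrow> 'b" and \<delta> :: "'a \<Rightarrow> 'b option" +
  assumes n_pos: "n \<ge> 1"
begin

abbreviation "perms \<equiv> {\<pi>. \<pi> permutes bits n}"
abbreviation "shifts \<equiv> {s \<in> bits n. hd s}"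

lemma finite_perms: "finite perms"
  by (simp add: finite_permutations)

text \<open>Where \<open>coset_rep s\<close> is injective on \<open>S\<close>, it extends from there
  to a permutation \<open>\<theta>\<close>. Composition with \<open>\<theta>\<close> merely reorders
  the sum over \<open>\<pi>\<close>, and \<open>weight\<close> does not look outside
  \<open>S\<close>.\<close>

lemma sum_weight_coset_rep:
  assumes "s \<in> bits n" "S \<subseteq> bits n" "inj_on (coset_rep s) S"
  shows "(\<Sum>\<pi>\<in>perms. weight M (\<pi> \<circ> coset_rep s) S) = (\<Sum>\<pi>\<in>perms. weight M \<pi> S)"
proof -
  have "coset_rep s ` S \<subseteq> bits n"
    using assms by (auto simp: length_coset_rep)
  then obtain \<theta> where \<theta>: "\<theta> permutes bits n" "\<And>x. x \<in> S \<Longrightarrow> \<theta> x = coset_rep s x"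
    using inj_on_extends_to_permutes[OF finite_bits assms(2,3)] by blast
  have "(\<Sum>\<pi>\<in>perms. weight M (\<pi> \<circ> coset_rep s) S) = (\<Sum>\<pi>\<in>perms. weight M (\<pi> \<circ> \<theta>) S)"
    by (intro sum.cong refl weight_local assms(2)) (simp add: \<theta>(2))
  also have "\<dots> = (\<Sum>\<pi>\<in>perms. weight M \<pi> S)"
    by (rule sum_permutations_compose_right[OF \<theta>(1), symmetric])
  finally show ?thesis .
qed

text \<open>One direction suffices. At a set with a collision, the weight of the Simon function is
  dropped because it is nonnegative, and that of the permutation is bounded by its mass.\<close>

lemma sum_weight_le:
  assumes M: "is_effect (sys T) M" and s: "s \<in> bits n"
  shows "(\<Sum>\<pi>\<in>perms. \<Sum>S\<in>Pow (bits n). weight M \<pi> S) \<le>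
     (\<Sum>\<pi>\<in>perms. \<Sum>S\<in>Pow (bits n). weight M (\<pi> \<circ> coset_rep s) S) +
     (\<Sum>\<pi>\<in>perms. \<Sum>S\<in>Pow (bits n). of_bool (\<not> inj_on (coset_rep s) S) * mass \<pi> S)"
proof -
  have "(\<Sum>\<pi>\<in>perms. weight M \<pi> S) \<le> (\<Sum>\<pi>\<in>perms. weight M (\<pi> \<circ> coset_rep s) S) +
      (\<Sum>\<pi>\<in>perms. of_bool (\<not> inj_on (coset_rep s) S) * mass \<pi> S)" if S: "S \<in> Pow (bits n)" for S
  proof (cases "inj_on (coset_rep s) S")
    case True
    then show ?thesis
      using sum_weight_coset_rep[OF s _ True] S by simp
  next
    case False
    have "0 \<le> (\<Sum>\<pi>\<in>perms. weight M (\<pi> \<circ> coset_rep s) S)"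
      by (intro sum_nonneg weight_bounds M)
    moreover have "(\<Sum>\<pi>\<in>perms. weight M \<pi> S) \<le> (\<Sum>\<pi>\<in>perms. mass \<pi> S)"
      by (intro sum_mono weight_bounds M)
    ultimately show ?thesis
      using False by simp
  qed
  then have "(\<Sum>S\<in>Pow (bits n). \<Sum>\<pi>\<in>perms. weight M \<pi> S) \<le>
     (\<Sum>S\<in>Pow (bits n). (\<Sum>\<pi>\<in>perms. weight M (\<pi> \<circ> coset_rep s) S) +
      (\<Sum>\<pi>\<in>perms. of_bool (\<not> inj_on (coset_rep s) S) * mass \<pi> S))"
    by (rule sum_mono)
  then show ?thesis
    unfolding sum.distrib sum.swap[of _ perms "Pow (bits n)"] .
qed

text \<open>After exchanging the sums, each set counts once per shift that collides on it, at most
  \<open>T\<^sup>2\<close> times, since larger sets carry no mass.\<close>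

lemma sum_collision_mass_le:
  assumes "good \<pi>"
  shows "(\<Sum>s\<in>shifts. \<Sum>S\<in>Pow (bits n). of_bool (\<not> inj_on (coset_rep s) S) * mass \<pi> S) \<le>
     (real T)\<^sup>2 * (1 + blowup)\<^sup>2"
proof -
  have count: "(\<Sum>s\<in>shifts. of_bool (P s)) = real (card {s \<in> bits n. hd s \<and> P s})" for P
  proof -
    have "(\<Sum>s\<in>shifts. of_bool (P s)) = (\<Sum>s\<in>{s \<in> bits n. hd s \<and> P s}. 1 :: real)"
      by (rule sum.mono_neutral_cong_right) (auto simp: bits_def finite_bits[unfolded bits_def])
    then show ?thesis
      by simp
  qed
  have "(\<Sum>s\<in>shifts. \<Sum>S\<in>Pow (bits n). of_bool (\<not> inj_on (coset_rep s) S) * mass \<pi> S) =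
      (\<Sum>S\<in>Pow (bits n). card {s \<in> bits n. hd s \<and> \<not> inj_on (coset_rep s) S} * mass \<pi> S)"
    unfolding count[symmetric] sum_distrib_right by (rule sum.swap)
  also have "\<dots> \<le> (\<Sum>S\<in>Pow (bits n). (real T)\<^sup>2 * mass \<pi> S)"
  proof (rule sum_mono)
    fix S assume S: "S \<in> Pow (bits n)"
    show "card {s \<in> bits n. hd s \<and> \<not> inj_on (coset_rep s) S} * mass \<pi> S \<le> (real T)\<^sup>2 * mass \<pi> S"
    proof (cases "card S \<le> T")
      case True
      have "card {s \<in> bits n. hd s \<and> \<not> inj_on (coset_rep s) S} \<le> (card S)\<^sup>2"
        using card_colliding_shifts[OF n_pos] S by blast
      also have "\<dots> \<le> T\<^sup>2"
        using True by (simp add: power_mono)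
      finally show ?thesis
        by (intro mult_right_mono mass_nonneg) (metis of_nat_le_iff of_nat_power)
    next
      case False
      then show ?thesis
        using mass_eq_0 S by simp
    qed
  qed
  also have "\<dots> \<le> (real T)\<^sup>2 * (1 + blowup)\<^sup>2"
    using sum_mass_le[OF assms] by (simp add: mult_left_mono flip: sum_distrib_left)
  finally show ?thesis .
qed

lemma sum_mean_le:
  assumes M: "is_effect (sys T) M"
    and good: "\<And>\<pi>. \<pi> \<in> perms \<Longrightarrow> good \<pi>" "\<And>\<pi> s. \<pi> \<in> perms \<Longrightarrow> s \<in> shifts \<Longrightarrow> good (\<pi> \<circ> coset_rep s)"
  shows "(\<Sum>s\<in>shifts. \<Sum>\<pi>\<in>perms. mean M \<pi> - mean M (\<pi> \<circ> coset_rep s)) \<le>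
     card shifts * card perms * (2 * blowup * (2 + blowup)) + card perms * ((real T)\<^sup>2 * (1 + blowup)\<^sup>2)"
proof -
  let ?\<gamma> = "blowup * (2 + blowup)"
  let ?C = "\<lambda>s \<pi>. \<Sum>S\<in>Pow (bits n). of_bool (\<not> inj_on (coset_rep s) S) * mass \<pi> S"
  have "(\<Sum>\<pi>\<in>perms. mean M \<pi> - mean M (\<pi> \<circ> coset_rep s)) \<le> card perms * (2 * ?\<gamma>) + (\<Sum>\<pi>\<in>perms. ?C s \<pi>)"
    if s: "s \<in> shifts" for s
  proof -
    let ?W = "\<lambda>h. \<Sum>S\<in>Pow (bits n). weight M h S"
    have "(\<Sum>\<pi>\<in>perms. mean M \<pi> - mean M (\<pi> \<circ> coset_rep s)) \<le>
        (\<Sum>\<pi>\<in>perms. (?W \<pi> - ?W (\<pi> \<circ> coset_rep s)) + 2 * ?\<gamma>)"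
    proof (rule sum_mono)
      fix \<pi> assume "\<pi> \<in> perms"
      then show "mean M \<pi> - mean M (\<pi> \<circ> coset_rep s) \<le> (?W \<pi> - ?W (\<pi> \<circ> coset_rep s)) + 2 * ?\<gamma>"
        using mean_close[OF good(1) M, of \<pi>] mean_close[OF good(2) M, of \<pi> s] s
        by (simp add: abs_le_iff)
    qed
    also have "\<dots> = (\<Sum>\<pi>\<in>perms. ?W \<pi>) - (\<Sum>\<pi>\<in>perms. ?W (\<pi> \<circ> coset_rep s)) + card perms * (2 * ?\<gamma>)"
      by (simp add: sum.distrib sum_subtractf)
    also have "\<dots> \<le> card perms * (2 * ?\<gamma>) + (\<Sum>\<pi>\<in>perms. ?C s \<pi>)"
      using sum_weight_le[OF M, of s] s by simp
    finally show ?thesis .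
  qed
  then have "(\<Sum>s\<in>shifts. \<Sum>\<pi>\<in>perms. mean M \<pi> - mean M (\<pi> \<circ> coset_rep s)) \<le>
      (\<Sum>s\<in>shifts. card perms * (2 * ?\<gamma>) + (\<Sum>\<pi>\<in>perms. ?C s \<pi>))"
    by (rule sum_mono)
  also have "\<dots> = card shifts * card perms * (2 * ?\<gamma>) + (\<Sum>\<pi>\<in>perms. \<Sum>s\<in>shifts. ?C s \<pi>)"
    unfolding sum.distrib by (subst sum.swap) simp
  also have "(\<Sum>\<pi>\<in>perms. \<Sum>s\<in>shifts. ?C s \<pi>) \<le> (\<Sum>\<pi>\<in>perms. (real T)\<^sup>2 * (1 + blowup)\<^sup>2)"
    by (intro sum_mono sum_collision_mass_le good)
  finally show ?thesis
    by (simp add: mult_ac)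
qed

end

subsection \<open>Oracles with an optional bypass\<close>

lemma contraction_cong:
  assumes "contraction A B K" "\<And>a b. a \<in> A \<Longrightarrow> b \<in> B \<Longrightarrow> K' b a = K b a"
  shows "contraction A B K'"
proof -
  have "apply_op A K' \<psi> b = apply_op A K \<psi> b" if "b \<in> B" for \<psi> b
    using that assms(2) by (simp add: apply_op_def)
  then have "vnorm B (apply_op A K' \<psi>) = vnorm B (apply_op A K \<psi>)" for \<psi>
    by (rule vnorm_cong)
  then show ?thesis
    using assms(1) by (simp add: contraction_def)
qed

section \<open>Deleted oracle columns and the hybrid argument\<close>

definition drop_columns :: "'a set \<Rightarrow> ('a, 'b) operator \<Rightarrow> ('a, 'b) operator" where
  "drop_columns U K b a = (if a \<in> U then 0 else K b a)"

lemma contraction_drop_columns: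
  assumes "contraction A B K"
  shows "contraction A B (drop_columns U K)"
  unfolding contraction_def
proof
  fix \<psi>
  have "apply_op A (drop_columns U K) \<psi> = apply_op A K (\<lambda>a. if a \<in> U then 0 else \<psi> a)"
    unfolding apply_op_def drop_columns_def by (intro ext sum.cong) auto
  then have "vnorm B (apply_op A (drop_columns U K) \<psi>) \<le> vnorm A (\<lambda>a. if a \<in> U then 0 else \<psi> a)"
    using vnorm_apply_le[OF assms] by simp
  also have "\<dots> \<le> vnorm A \<psi>"
    unfolding vnorm_def by (intro L2_set_mono) auto
  finally show "vnorm B (apply_op A (drop_columns U K) \<psi>) \<le> vnorm A \<psi>" .
qed

lemma is_isometry_tensor_id:
  assumes "finite A" "finite B" "finite W" "is_isometry A B K"
  shows "is_isometry (A \<times> W) (B \<times> W) (tensor_id K)"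
  unfolding is_isometry_def
proof (intro ballI)
  fix p p' assume "p \<in> A \<times> W" "p' \<in> A \<times> W"
  then obtain a w a' w' where p: "p = (a, w)" "p' = (a', w')" "a \<in> A" "a' \<in> A" "w \<in> W" "w' \<in> W"
    by auto
  have "(\<Sum>q\<in>B \<times> W. cnj (tensor_id K q p) * tensor_id K q p') =
      (\<Sum>b\<in>B. \<Sum>v\<in>W. if v = w then (if w = w' then cnj (K b a) * K b a' else 0) else 0)"
    unfolding p tensor_id_def sum.cartesian_product by (intro sum.cong) auto
  also have "\<dots> = (if w = w' then (\<Sum>b\<in>B. cnj (K b a) * K b a') else 0)"
    using assms p by simp
  finally show "(\<Sum>q\<in>B \<times> W. cnj (tensor_id K q p) * tensor_id K q p') = (if p = p' then 1 else 0)"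
    using assms(4) p by (auto simp: is_isometry_def)
qed

lemma vnorm_run_isometry:
  assumes "finite A" "finite B" "is_query_alg A B T \<A>" "is_isometry A B Q"
  shows "t \<le> T \<Longrightarrow> vnorm {..<sys_dim \<A> t} (run_alg A B \<A> Q t) = 1"
proof (induction t)
  case 0
  then show ?case
    using assms(3) by (simp add: is_query_alg_def unit_state_vnorm)
next
  case (Suc t)
  then have "t < T" by simp
  then show ?case
    using Suc assms by (simp add: vnorm_isometry[OF _ is_query_algD(2)[OF assms(3)]]
        vnorm_isometry[OF _ is_query_algD(1)[OF assms(3)]] vnorm_isometry[OF _ is_isometry_tensor_id])
qed

lemma expect_complement_run:
  assumes "finite A" "finite B" "is_query_alg A B T \<A>" "is_isometry A B Q"
  shows "expect {..<sys_dim \<A> T} (\<lambda>i j. (if i = j then 1 else 0) - accept \<A> i j) (run_alg A B \<A> Q T) =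
         1 - accept_prob A B T \<A> Q"
  using vnorm_run_isometry[OF assms order_refl]
  by (simp add: expect_def quad_form_complement accept_prob_def)

text \<open>A hybrid argument. The bound uses the amplitudes of the run with the full oracle, which
  do not depend on \<open>U\<close>, so it can later be summed over many candidates for
  \<open>U\<close>.\<close>

lemma vnorm_run_drop_columns:
  assumes "finite A" "finite B" "is_query_alg A B T \<A>" "is_isometry A B Q" "U \<subseteq> A"
  shows "t \<le> T \<Longrightarrow>
    vnorm {..<sys_dim \<A> t} (\<lambda>i. run_alg A B \<A> Q t i - run_alg A B \<A> (drop_columns U Q) t i) \<le>
    (\<Sum>t'<t. vnorm (U \<times> {..<work_dim \<A> t'}) (apply_op {..<sys_dim \<A> t'} (pre \<A> t') (run_alg A B \<A> Q t')))"
proof (induction t)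
  case 0
  then show ?case
    by (simp add: vnorm_def L2_set_def)
next
  case (Suc t)
  then have t: "t < T" by simp
  let ?W = "{..<work_dim \<A> t}" and ?Q' = "drop_columns U Q" and ?I = "{..<sys_dim \<A> t}"
  let ?p = "apply_op ?I (pre \<A> t)"
  let ?R = "\<lambda>Q. run_alg A B \<A> Q t"
  let ?D = "\<lambda>i. ?R Q i - ?R ?Q' i"
  let ?\<phi> = "\<lambda>q. if fst q \<in> U then ?p (?R Q) q else 0"
  have c: "contraction A B ?Q'"
    by (intro contraction_drop_columns contraction_isometry assms)
  \<comment> \<open>The old difference passes through the contraction with deleted columns; the
    fresh error is the isometry applied to the amplitude on \<open>U\<close>.\<close>
  have split: "tensor_id Q q p * \<psi> p - tensor_id ?Q' q p * \<phi> p =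
      tensor_id ?Q' q p * (\<psi> p - \<phi> p) + tensor_id Q q p * (if fst p \<in> U then \<psi> p else 0)"
    for \<psi> \<phi> q p
    by (cases q; cases p) (simp add: tensor_id_def drop_columns_def algebra_simps)
  have "apply_op (A \<times> ?W) (tensor_id Q) \<psi> q - apply_op (A \<times> ?W) (tensor_id ?Q') \<phi> q =
      apply_op (A \<times> ?W) (tensor_id ?Q') (\<lambda>p. \<psi> p - \<phi> p) q +
      apply_op (A \<times> ?W) (tensor_id Q) (\<lambda>p. if fst p \<in> U then \<psi> p else 0) q" for \<psi> \<phi> q
  proof -
    have "(\<Sum>p\<in>A \<times> ?W. tensor_id Q q p * \<psi> p - tensor_id ?Q' q p * \<phi> p) =
        (\<Sum>p\<in>A \<times> ?W. tensor_id ?Q' q p * (\<psi> p - \<phi> p) + tensor_id Q q p * (if fst p \<in> U then \<psi> p else 0))"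
      by (rule sum.cong[OF refl split])
    then show ?thesis
      by (simp only: apply_op_def sum_subtractf sum.distrib)
  qed
  then have "vnorm {..<sys_dim \<A> (Suc t)} (\<lambda>i. run_alg A B \<A> Q (Suc t) i - run_alg A B \<A> ?Q' (Suc t) i) =
      vnorm (B \<times> ?W) (\<lambda>q. apply_op (A \<times> ?W) (tensor_id ?Q') (?p ?D) q + apply_op (A \<times> ?W) (tensor_id Q) ?\<phi> q)"
    using assms(2) t
    by (simp add: apply_op_diff[symmetric] vnorm_isometry[OF _ is_query_algD(2)[OF assms(3)]])
  also have "\<dots> \<le> vnorm (B \<times> ?W) (apply_op (A \<times> ?W) (tensor_id ?Q') (?p ?D)) +
      vnorm (B \<times> ?W) (apply_op (A \<times> ?W) (tensor_id Q) ?\<phi>)"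
    by (rule vnorm_add_le)
  also have "\<dots> \<le> vnorm (A \<times> ?W) (?p ?D) + vnorm (A \<times> ?W) ?\<phi>"
    using assms
    by (intro add_mono vnorm_apply_le contraction_tensor_id[OF _ _ c]
        contraction_tensor_id[OF _ _ contraction_isometry]) auto
  also have "vnorm (A \<times> ?W) (?p ?D) = vnorm ?I ?D"
    using t by (simp add: vnorm_isometry[OF _ is_query_algD(1)[OF assms(3)]])
  also have "vnorm (A \<times> ?W) ?\<phi> = vnorm (U \<times> ?W) (?p (?R Q))"
    unfolding vnorm_def L2_set_def using assms(1,5)
    by (intro arg_cong[of _ _ sqrt] sum.mono_neutral_cong_right) auto
  finally show ?case
    using Suc by simp
qed

text \<open>Squared norms over disjoint sets add up to at most the whole; Cauchy-Schwarz against the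
  constant 1 gives the square root.\<close>

lemma sum_vnorm_disjoint_le:
  assumes "finite A" "finite W" "finite G" "\<And>g. g \<in> G \<Longrightarrow> U g \<subseteq> A" "disjoint_family_on U G"
  shows "(\<Sum>g\<in>G. vnorm (U g \<times> W) \<phi>) \<le> sqrt (card G) * vnorm (A \<times> W) \<phi>"
proof -
  have "(\<Sum>g\<in>G. \<bar>1\<bar> * \<bar>vnorm (U g \<times> W) \<phi>\<bar>) \<le> L2_set (\<lambda>_. 1) G * L2_set (\<lambda>g. vnorm (U g \<times> W) \<phi>) G"
    by (rule L2_set_mult_ineq)
  also have "L2_set (\<lambda>g. vnorm (U g \<times> W) \<phi>) G \<le> vnorm (A \<times> W) \<phi>"
  proof (rule power2_le_imp_le)
    have "(L2_set (\<lambda>g. vnorm (U g \<times> W) \<phi>) G)\<^sup>2 = (\<Sum>g\<in>G. \<Sum>p\<in>U g \<times> W. (cmod (\<phi> p))\<^sup>2)"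
      by (simp add: L2_set_def sum_nonneg vnorm_power2)
    also have "\<dots> = (\<Sum>p\<in>(\<Union>g\<in>G. U g \<times> W). (cmod (\<phi> p))\<^sup>2)"
    proof (intro sum.UNION_disjoint[symmetric] ballI impI)
      show "(U i \<times> W) \<inter> (U j \<times> W) = {}" if "i \<in> G" "j \<in> G" "i \<noteq> j" for i j
        using assms(5) that unfolding disjoint_family_on_def by blast
    qed (use assms in \<open>auto intro: finite_subset\<close>)
    also have "\<dots> \<le> (vnorm (A \<times> W) \<phi>)\<^sup>2"
      unfolding vnorm_power2 using assms by (intro sum_mono2) auto
    finally show "(L2_set (\<lambda>g. vnorm (U g \<times> W) \<phi>) G)\<^sup>2 \<le> (vnorm (A \<times> W) \<phi>)\<^sup>2" .
  qed simp
  finally show ?thesis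
    by (simp add: L2_set_constant mult_left_mono)
qed

lemma sum_expect_drop_columns:
  assumes "finite A" "finite B" "is_query_alg A B T \<A>" "is_isometry A B Q"
    and "finite G" "\<And>g. g \<in> G \<Longrightarrow> U g \<subseteq> A" "disjoint_family_on U G"
    and M: "is_effect {..<sys_dim \<A> T} M"
  shows "(\<Sum>g\<in>G. \<bar>expect {..<sys_dim \<A> T} M (run_alg A B \<A> Q T) -
      expect {..<sys_dim \<A> T} M (run_alg A B \<A> (drop_columns (U g) Q) T)\<bar>) \<le> 2 * T * sqrt (card G)"
proof -
  let ?I = "{..<sys_dim \<A> T}"
  let ?\<phi> = "\<lambda>t. apply_op {..<sys_dim \<A> t} (pre \<A> t) (run_alg A B \<A> Q t)"
  let ?W = "\<lambda>t. {..<work_dim \<A> t}"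
  let ?d = "\<lambda>g. vnorm ?I (\<lambda>i. run_alg A B \<A> Q T i - run_alg A B \<A> (drop_columns (U g) Q) T i)"
  have one: "vnorm ?I (run_alg A B \<A> Q T) = 1"
    using vnorm_run_isometry[OF assms(1-4)] by simp
  have le1: "vnorm ?I (run_alg A B \<A> (drop_columns U' Q) T) \<le> 1" for U'
    using assms by (intro vnorm_run_contraction contraction_drop_columns contraction_isometry) auto
  have "(\<Sum>g\<in>G. \<bar>expect ?I M (run_alg A B \<A> Q T) - expect ?I M (run_alg A B \<A> (drop_columns (U g) Q) T)\<bar>) \<le>
      (\<Sum>g\<in>G. 2 * (\<Sum>t<T. vnorm (U g \<times> ?W t) (?\<phi> t)))"
  proof (rule sum_mono)
    fix g assume g: "g \<in> G"
    have "\<bar>expect ?I M (run_alg A B \<A> Q T) - expect ?I M (run_alg A B \<A> (drop_columns (U g) Q) T)\<bar> \<le>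
        ?d g * (vnorm ?I (run_alg A B \<A> Q T) + vnorm ?I (run_alg A B \<A> (drop_columns (U g) Q) T))"
      by (rule expect_lipschitz[OF M])
    also have "\<dots> \<le> ?d g * 2"
      using one le1[of "U g"] by (intro mult_left_mono) auto
    also have "\<dots> \<le> 2 * (\<Sum>t<T. vnorm (U g \<times> ?W t) (?\<phi> t))"
      using vnorm_run_drop_columns[OF assms(1-4) assms(6)[OF g] order_refl] by simp
    finally show "\<bar>expect ?I M (run_alg A B \<A> Q T) - expect ?I M (run_alg A B \<A> (drop_columns (U g) Q) T)\<bar> \<le>
        2 * (\<Sum>t<T. vnorm (U g \<times> ?W t) (?\<phi> t))" .
  qed
  also have "\<dots> = 2 * (\<Sum>t<T. \<Sum>g\<in>G. vnorm (U g \<times> ?W t) (?\<phi> t))"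
    by (subst sum.swap) (simp add: sum_distrib_left)
  also have "\<dots> \<le> 2 * (\<Sum>t<T. sqrt (card G))"
  proof (intro mult_left_mono sum_mono)
    fix t assume "t \<in> {..<T}"
    then have "vnorm (A \<times> ?W t) (?\<phi> t) = 1"
      using vnorm_run_isometry[OF assms(1-4), of t]
      by (simp add: vnorm_isometry[OF _ is_query_algD(1)[OF assms(3)]])
    then show "(\<Sum>g\<in>G. vnorm (U g \<times> ?W t) (?\<phi> t)) \<le> sqrt (card G)"
      using sum_vnorm_disjoint_le[OF assms(1) _ assms(5-7), of "?W t" "?\<phi> t"] by simp
  qed simp
  finally show ?thesis
    by (simp add: mult_ac)
qed

section \<open>Numerical balance of the errors\<close>

context simon_process
begin

text \<open>With \<open>u = T / sqrt (2 ^ n) < 1 / 150\<close>, the exponential estimate gives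
  \<open>blowup \<le> 6 * u \<le> 1 / 25\<close>. The three terms come from truncation on both
  sides, from collisions inside recorded sets, and from masking on both sides.\<close>

lemma small_errors:
  assumes "real T < sqrt (2 ^ n) / 150"
  shows "2 * blowup * (2 + blowup) + 2 * (real T)\<^sup>2 / 2 ^ n * (1 + blowup)\<^sup>2 + 4 * real T / sqrt (2 ^ n) < 1 / 3"
proof -
  let ?u = "real T / sqrt (2 ^ n)"
  have u: "0 \<le> ?u" "?u < 1 / 150"
    using assms by (simp_all add: field_simps)
  have "(1 + eps) ^ T \<le> exp eps ^ T"
    by (intro power_mono) auto
  also have "\<dots> = exp (3 * ?u)"
    by (simp add: eps_def exp_of_nat_mult[symmetric])
  also have "\<dots> \<le> 1 + 3 * ?u + (3 * ?u)\<^sup>2"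
    using u by (intro exp_bound) auto
  also have "(3 * ?u)\<^sup>2 \<le> 3 * ?u"
    using u by (simp only: power2_eq_square) (intro mult_left_le, auto)
  finally have bl: "blowup \<le> 1 / 25"
    using u unfolding blowup_def by linarith
  have "2 * blowup * (2 + blowup) \<le> 2 * (1 / 25) * (2 + 1 / 25)"
    using bl blowup_nonneg by (intro mult_mono) auto
  moreover have "2 * (real T)\<^sup>2 / 2 ^ n * (1 + blowup)\<^sup>2 \<le> 2 * (1 / 150)\<^sup>2 * (1 + 1 / 25)\<^sup>2"
  proof (intro mult_mono power_mono)
    have "2 * (real T)\<^sup>2 / 2 ^ n = 2 * ?u\<^sup>2"
      by (simp add: power_divide)
    moreover have "?u\<^sup>2 \<le> (1 / 150)\<^sup>2"
      using u by (intro power_mono) auto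
    ultimately show "2 * (real T)\<^sup>2 / 2 ^ n \<le> 2 * (1 / 150)\<^sup>2"
      by linarith
  qed (use bl blowup_nonneg in auto)
  moreover have "4 * real T / sqrt (2 ^ n) = 4 * ?u"
    by simp
  then have "4 * real T / sqrt (2 ^ n) \<le> 4 / 150"
    using u by linarith
  ultimately show ?thesis
    by (simp add: power2_eq_square)
qed

lemma real_card_shifts: "real (card shifts) = 2 ^ n / 2"
proof -
  have "real (2 * card shifts) = real (2 ^ n)"
    by (simp only: card_shifts[OF n_pos])
  then show ?thesis
    by simp
qed

lemma query_bound:
  assumes "card shifts * card perms * (1 / 3 - 4 * real T / sqrt (2 ^ n)) \<le>
    card shifts * card perms * (2 * blowup * (2 + blowup)) + card perms * ((real T)\<^sup>2 * (1 + blowup)\<^sup>2)"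
  shows "sqrt (2 ^ n) / 150 \<le> real T"
proof -
  \<comment> \<open>The number of permutations cancels, and the number of shifts is
    \<open>2 ^ n / 2\<close>, whence the factor 2 of the collision term.\<close>
  have cp: "real (card perms) > 0"
    using finite_perms by (auto simp: card_gt_0_iff intro: permutes_id)
  have "card perms * (card shifts * (1 / 3 - 4 * real T / sqrt (2 ^ n))) \<le>
      card perms * (card shifts * (2 * blowup * (2 + blowup)) + (real T)\<^sup>2 * (1 + blowup)\<^sup>2)"
    using assms by (simp add: algebra_simps)
  then have "card shifts * (1 / 3 - 4 * real T / sqrt (2 ^ n)) \<le>
      card shifts * (2 * blowup * (2 + blowup)) + (real T)\<^sup>2 * (1 + blowup)\<^sup>2"
    using cp by (simp only: mult_le_cancel_left_pos)
  then have "1 / 3 - 4 * real T / sqrt (2 ^ n) \<le>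
      2 * blowup * (2 + blowup) + 2 * (real T)\<^sup>2 / 2 ^ n * (1 + blowup)\<^sup>2"
    unfolding real_card_shifts by (simp add: field_simps)
  then show ?thesis
    using small_errors by linarith
qed

end

text \<open>An injection \<open>f\<close> between sets of bit strings acts on those basis labels of \<open>A\<close> that \<open>dec\<close>
  decodes to a bit string; on the other labels (the bypass) the fixed operator \<open>J\<close> is applied.\<close>

locale wrapped_oracle =
  fixes A :: "'a set" and B :: "'b set" and dec :: "'a \<Rightarrow> bool list option"
    and lab :: "bool list \<Rightarrow> 'a" and emb :: "bool list \<Rightarrow> 'b" and J :: "('a, 'b) operator"
    and k l :: nat
  assumes fin [simp]: "finite A" "finite B"
    and dec: "a \<in> A \<Longrightarrow> dec a = Some w \<Longrightarrow> w \<in> bits k \<and> a = lab w"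
    and lab: "w \<in> bits k \<Longrightarrow> lab w \<in> A \<and> dec (lab w) = Some w"
    and emb: "inj emb" "w \<in> bits l \<Longrightarrow> emb w \<in> B"
    and iso: "f \<in> bits k \<rightarrow> bits l \<Longrightarrow> inj_on f (bits k) \<Longrightarrow>
      is_isometry A B (\<lambda>b a. case dec a of Some w \<Rightarrow> of_bool (b = emb (f w)) | None \<Rightarrow> J b a)"
begin

definition wrap :: "(bool list \<Rightarrow> bool list) \<Rightarrow> ('a, 'b) operator" where
  "wrap f b a = (case dec a of Some w \<Rightarrow> of_bool (b = emb (f w)) | None \<Rightarrow> J b a)"

lemma wrap_isometry: "f \<in> bits k \<rightarrow> bits l \<Longrightarrow> inj_on f (bits k) \<Longrightarrow> is_isometry A B (wrap f)"
  using iso[of f] by (simp add: wrap_def[abs_def])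

lemma lab_eq_iff: "w \<in> bits k \<Longrightarrow> w' \<in> bits k \<Longrightarrow> lab w = lab w' \<longleftrightarrow> w = w'"
  using lab by (metis option.inject)

lemma dec_None: "a \<in> A \<Longrightarrow> dec a = None \<Longrightarrow> w \<in> bits k \<Longrightarrow> a \<noteq> lab w"
  using lab by force

end

lemma is_isometry_bypass:
  assumes "is_isometry A B J" "is_isometry A B Q" "finite B"
  shows "is_isometry (UNIV \<times> A) (UNIV \<times> B) (bypass J Q)"
  unfolding is_isometry_def
proof (intro ballI)
  fix p p' :: "bool \<times> 'a" assume "p \<in> UNIV \<times> A" "p' \<in> UNIV \<times> A"
  then obtain c a c' a' where p: "p = (c, a)" "p' = (c', a')" "a \<in> A" "a' \<in> A"
    by auto
  let ?K = "\<lambda>c. if c then Q else J"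
  have "(\<Sum>q\<in>UNIV \<times> B. cnj (bypass J Q q p) * bypass J Q q p') =
      (\<Sum>d\<in>UNIV. \<Sum>b\<in>B. if d = c then (if c = c' then cnj (?K c b a) * ?K c b a' else 0) else 0)"
    unfolding p bypass_def sum.cartesian_product by (intro sum.cong) auto
  also have "\<dots> = (if c = c' then (\<Sum>b\<in>B. cnj (?K c b a) * ?K c b a') else 0)"
    by (cases c) (simp_all add: UNIV_bool)
  also have "\<dots> = (if p = p' then 1 else 0)"
    using assms(1,2) p unfolding is_isometry_def by (cases c) auto
  finally show "(\<Sum>q\<in>UNIV \<times> B. cnj (bypass J Q q p) * bypass J Q q p') = (if p = p' then 1 else 0)" .
qed

lemma wrapped_oracle_plain: "wrapped_oracle (bits k) (bits l) Some id id J k l"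
proof (unfold_locales, goal_cases)
  case (7 f)
  have "(\<lambda>b a. case Some a of Some w \<Rightarrow> of_bool (b = id (f w)) | None \<Rightarrow> J b a) =
      (basis_op f :: (_, _) operator)"
    by (auto simp: basis_op_def fun_eq_iff)
  then show ?case
    using is_isometry_basis_op[of "bits l" f "bits k"] 7 by simp
qed (auto simp: inj_def)

lemma wrap_plain: "wrapped_oracle.wrap Some id J f = basis_op f"
proof -
  interpret wrapped_oracle "bits k" "bits l" Some id id J k l for k l
    by (rule wrapped_oracle_plain)
  show ?thesis
    by (auto simp: wrap_def basis_op_def fun_eq_iff)
qed

definition bypass_dec :: "bool \<times> bool list \<Rightarrow> bool list option" where
  "bypass_dec = (\<lambda>(c, w). if c then Some w else None)"

text \<open>Control \<open>True\<close> decodes to a genuine query. For control \<open>False\<close>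
  the fixed operator is \<open>J\<close>, extended by zero to the rows with control
  \<open>True\<close>.\<close>

lemma bypass_eq:
  "bypass J (basis_op f) = (\<lambda>b a. case bypass_dec a of Some w \<Rightarrow> of_bool (b = (True, f w)) | None \<Rightarrow>
     (\<lambda>(c', b) (c, a). if c' then 0 else J b a) b a)"
  by (auto simp: bypass_def basis_op_def bypass_dec_def fun_eq_iff)

lemma wrapped_oracle_bypass:
  assumes "is_isometry (bits k) (bits l) J"
  shows "wrapped_oracle (UNIV \<times> bits k) (UNIV \<times> bits l) bypass_dec (Pair True) (Pair True)
    (\<lambda>(c', b) (c, a). if c' then 0 else J b a) k l"
proof (unfold_locales, goal_cases)
  case (7 f)
  show ?case
    unfolding bypass_eq[symmetric] using 7
    by (intro is_isometry_bypass assms is_isometry_basis_op) auto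
qed (auto simp: inj_def bypass_dec_def split: if_splits)

lemma wrap_bypass:
  assumes "is_isometry (bits k) (bits l) J"
  shows "wrapped_oracle.wrap bypass_dec (Pair True) (\<lambda>(c', b) (c, a). if c' then 0 else J b a) f =
    bypass J (basis_op f)"
proof -
  interpret wrapped_oracle "UNIV \<times> bits k" "UNIV \<times> bits l" bypass_dec "Pair True" "Pair True"
      "\<lambda>(c', b) (c, a). if c' then 0 else J b a" k l
    by (rule wrapped_oracle_bypass[OF assms])
  show ?thesis
    unfolding bypass_eq by (simp add: wrap_def fun_eq_iff)
qed

subsection \<open>Lower bound for garbage Simon\<close>

lemma no_fun_permutes: "\<pi> permutes bits n \<Longrightarrow> no_fun n \<pi>"
  by (simp add: no_fun_def permutes_imp_bij)

lemma yes_fun_coset_rep: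
  "n \<ge> 1 \<Longrightarrow> length s = n \<Longrightarrow> hd s \<Longrightarrow> \<pi> permutes bits n \<Longrightarrow> yes_fun n (\<pi> \<circ> coset_rep s)"
  unfolding yes_fun_def using simon_function_coset_rep by blast

lemma permutes_bits_length: "\<pi> permutes bits n \<Longrightarrow> length x = n \<Longrightarrow> length (\<pi> x) = n"
  using permutes_in_image[of \<pi> "bits n" x] by simp

lemma garbage_simonI:
  "yes_fun n h \<Longrightarrow> r \<in> bits n \<rightarrow> bits n \<Longrightarrow> garbage_fun h r \<in> fst (garbage_simon n)"
  "no_fun n h \<Longrightarrow> r \<in> bits n \<rightarrow> bits n \<Longrightarrow> garbage_fun h r \<in> snd (garbage_simon n)"
  unfolding garbage_simon_def fst_conv snd_conv by blast+

context wrapped_oracle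
begin

lemma erase_lower_bound:
  assumes n: "n \<ge> 1" and k: "k = n" and l: "l = 3 * n"
    and solves: "solves A B wrap (garbage_simon n) T \<A>"
  shows "sqrt (2 ^ n) / 150 \<le> real T"
proof -
  \<comment> \<open>Any admissible injection would do here: all columns that carry a genuine query
    are deleted, and what remains is the bypass, the same for every instance.\<close>
  define K0 where "K0 = drop_columns {a. dec a \<noteq> None} (wrap (\<lambda>x. x @ x @ x))"
  define \<nu> where "\<nu> x y z = emb (y @ x @ z)" for x y z :: "bool list"
  have alg: "is_query_alg A B T \<A>"
    using solves by (simp add: solves_def)
  have K0: "contraction A B K0"
    unfolding K0_def using k l
    by (intro contraction_drop_columns contraction_isometry wrap_isometry) (auto simp: inj_on_def)
  interpret simon_process n A B \<A> T K0 lab \<nu> "\<lambda>_. None"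
    by unfold_locales (use alg K0 n k lab lab_eq_iff in \<open>auto simp: inj_on_def\<close>)
  have valid: "garbage_fun h r \<in> bits k \<rightarrow> bits l" "inj_on (garbage_fun h r) (bits k)"
    if "\<And>x. length x = n \<Longrightarrow> length (h x) = n" "r \<in> tables" for h r
    using that k l by (auto simp: garbage_fun_def tables_def inj_on_def)
  have ideal_eq: "ideal h r b a = wrap (garbage_fun h r) b a" if a: "a \<in> A" for h r b a
  proof (cases "dec a")
    case None
    then show ?thesis
      using dec_None[OF a None] k unfolding ideal_def hit_def
      by (simp add: wrap_def K0_def drop_columns_def)
  next
    case (Some w)
    then have w: "length w = n" "a = lab w"
      using dec[OF a Some] k by auto
    then have "(\<Sum>x\<in>bits n. of_bool (a = lab x) * out h x r b) = (\<Sum>x\<in>bits n. if x = w then out h w r b else 0)"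
      using lab_eq_iff k by (intro sum.cong) auto
    then show ?thesis
      using Some w unfolding ideal_def out_def
      by (simp add: wrap_def K0_def drop_columns_def \<nu>_def garbage_fun_def)
  qed
  have run_eq: "run h r T = run_alg A B \<A> (wrap (garbage_fun h r)) T" for h r
    by (rule run_alg_cong) (rule ideal_eq)
  have goodI: "good h" if h: "\<And>x. length x = n \<Longrightarrow> length (h x) = n" for h
    unfolding good_def
  proof (intro conjI ballI)
    show "inj_on (\<lambda>(x, z). \<nu> x (h x) z) (bits n \<times> bits n)"
      using h by (auto simp: \<nu>_def inj_on_def inj_eq[OF emb(1)])
    show "\<nu> x (h x) z \<in> B" if "x \<in> bits n" "z \<in> bits n" for x z
      using that h l by (auto simp: \<nu>_def intro!: emb(2))
    show "contraction A B (ideal h r)" if r: "r \<in> tables" for r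
      by (rule contraction_cong[OF contraction_isometry[OF _ wrap_isometry[OF valid[OF h r]]]])
        (auto simp: ideal_eq)
  qed
  \<comment> \<open>The rejecting outcome is measured: \<open>sum_mean_le\<close> bounds
    permutations against Simon functions in this direction, and permutations are the inputs to be
    rejected.\<close>
  define M where "M = (\<lambda>i j. (if i = j then 1 else 0) - accept \<A> i j :: complex)"
  have M: "is_effect (sys T) M"
    unfolding M_def using alg by (intro is_effect_complement) (auto simp: is_query_alg_def)
  have mean: "mean M h = (\<Sum>r\<in>tables. 1 - accept_prob A B T \<A> (wrap (garbage_fun h r))) / card tables"
    if h: "\<And>x. length x = n \<Longrightarrow> length (h x) = n" for h
    unfolding mean_def run_eq M_def
    using expect_complement_run[OF _ _ alg wrap_isometry[OF valid[OF h]]] by simp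
  have tab: "r \<in> tables \<Longrightarrow> r \<in> bits n \<rightarrow> bits n" for r
    by (auto simp: tables_def)
  have len: "length (\<pi> x) = n" "length ((\<pi> \<circ> coset_rep s) x) = n"
    if "\<pi> \<in> perms" "s \<in> shifts" "length x = n" for \<pi> s x
    using that permutes_bits_length[of \<pi> n] by (auto simp: length_coset_rep)
  have NO: "2 / 3 \<le> mean M \<pi>" if \<pi>: "\<pi> \<in> perms" for \<pi>
  proof -
    have h: "length (\<pi> x) = n" if "length x = n" for x
      using permutes_bits_length[of \<pi> n] \<pi> that by auto
    have "(\<Sum>r\<in>tables. 2 / 3) \<le> (\<Sum>r\<in>tables. 1 - accept_prob A B T \<A> (wrap (garbage_fun \<pi> r)))"
    proof (rule sum_mono)
      fix r assume "r \<in> tables"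
      then have "garbage_fun \<pi> r \<in> snd (garbage_simon n)"
        using \<pi> tab no_fun_permutes by (intro garbage_simonI) auto
      then show "2 / 3 \<le> 1 - accept_prob A B T \<A> (wrap (garbage_fun \<pi> r))"
        using solves by (simp add: solves_def)
    qed
    moreover have "mean M \<pi> = (\<Sum>r\<in>tables. 1 - accept_prob A B T \<A> (wrap (garbage_fun \<pi> r))) / card tables"
      by (rule mean) (rule h)
    ultimately show ?thesis
      using card_tables_pos by (simp add: pos_le_divide_eq pos_divide_le_eq)
  qed
  have YES: "mean M (\<pi> \<circ> coset_rep s) \<le> 1 / 3" if \<pi>: "\<pi> \<in> perms" and s: "s \<in> shifts" for \<pi> s
  proof -
    have h: "length ((\<pi> \<circ> coset_rep s) x) = n" if "length x = n" for x
      using len(2)[OF \<pi> s that] .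
    have "(\<Sum>r\<in>tables. 1 - accept_prob A B T \<A> (wrap (garbage_fun (\<pi> \<circ> coset_rep s) r))) \<le> (\<Sum>r\<in>tables. 1 / 3)"
    proof (rule sum_mono)
      fix r assume "r \<in> tables"
      then have "garbage_fun (\<pi> \<circ> coset_rep s) r \<in> fst (garbage_simon n)"
        using \<pi> s tab yes_fun_coset_rep[OF n, of s \<pi>] by (intro garbage_simonI) auto
      then show "1 - accept_prob A B T \<A> (wrap (garbage_fun (\<pi> \<circ> coset_rep s) r)) \<le> 1 / 3"
        using solves by (fastforce simp: solves_def)
    qed
    moreover have "mean M (\<pi> \<circ> coset_rep s) =
        (\<Sum>r\<in>tables. 1 - accept_prob A B T \<A> (wrap (garbage_fun (\<pi> \<circ> coset_rep s) r))) / card tables"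
      by (rule mean) (rule h)
    ultimately show ?thesis
      using card_tables_pos by (simp add: pos_le_divide_eq pos_divide_le_eq)
  qed
  have "(\<Sum>s\<in>shifts. \<Sum>\<pi>\<in>perms. 1 / 3) \<le> (\<Sum>s\<in>shifts. \<Sum>\<pi>\<in>perms. mean M \<pi> - mean M (\<pi> \<circ> coset_rep s))"
    using NO YES by (intro sum_mono) fastforce
  also have "\<dots> \<le> card shifts * card perms * (2 * blowup * (2 + blowup)) +
      card perms * ((real T)\<^sup>2 * (1 + blowup)\<^sup>2)"
    by (rule sum_mean_le[OF M goodI goodI]) (use len permutes_bits_length in auto)
  finally have bound: "card shifts * card perms * (1 / 3) \<le>
      card shifts * card perms * (2 * blowup * (2 + blowup)) + card perms * ((real T)\<^sup>2 * (1 + blowup)\<^sup>2)"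
    by simp
  \<comment> \<open>There is no masking loss in this problem; the bound is weakened to the common
    form of \<open>query_bound\<close>.\<close>
  have "card shifts * card perms * (1 / 3 - 4 * real T / sqrt (2 ^ n)) \<le> card shifts * card perms * (1 / 3)"
    by (intro mult_left_mono) auto
  then show ?thesis
    using bound by (intro query_bound) linarith
qed

end

subsection \<open>Lower bound for the permutation problems\<close>

text \<open>For injective families with disjoint ranges this is the involution that swaps
  \<open>\<alpha> x\<close> with \<open>\<beta> x\<close> for every \<open>x\<close>.\<close>

definition exchange :: "'x set \<Rightarrow> ('x \<Rightarrow> 'y) \<Rightarrow> ('x \<Rightarrow> 'y) \<Rightarrow> 'y \<Rightarrow> 'y" where
  "exchange X \<alpha> \<beta> y = (if y \<in> \<alpha> ` X then \<beta> (inv_into X \<alpha> y)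
     else if y \<in> \<beta> ` X then \<alpha> (inv_into X \<beta> y) else y)"

context
  fixes X :: "'x set" and \<alpha> \<beta> :: "'x \<Rightarrow> 'y"
  assumes inj: "inj_on \<alpha> X" "inj_on \<beta> X" and disj: "\<And>x x'. x \<in> X \<Longrightarrow> x' \<in> X \<Longrightarrow> \<alpha> x \<noteq> \<beta> x'"
begin

lemma exchange_left: "x \<in> X \<Longrightarrow> exchange X \<alpha> \<beta> (\<alpha> x) = \<beta> x"
  using inj by (simp add: exchange_def)

lemma exchange_right: "x \<in> X \<Longrightarrow> exchange X \<alpha> \<beta> (\<beta> x) = \<alpha> x"
proof -
  assume x: "x \<in> X"
  then have "\<beta> x \<notin> \<alpha> ` X"
    using disj by (metis imageE)
  then show ?thesis
    using inj x by (simp add: exchange_def)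
qed

lemma exchange_other: "y \<notin> \<alpha> ` X \<Longrightarrow> y \<notin> \<beta> ` X \<Longrightarrow> exchange X \<alpha> \<beta> y = y"
  by (simp add: exchange_def)

lemma exchange_exchange: "exchange X \<alpha> \<beta> (exchange X \<alpha> \<beta> y) = y"
proof -
  consider x where "x \<in> X" "y = \<alpha> x" | x where "x \<in> X" "y = \<beta> x" | "y \<notin> \<alpha> ` X" "y \<notin> \<beta> ` X"
    by blast
  then show ?thesis
    by cases (auto simp: exchange_left exchange_right exchange_other)
qed

lemma exchange_permutes:
  assumes "\<alpha> ` X \<subseteq> D" "\<beta> ` X \<subseteq> D"
  shows "exchange X \<alpha> \<beta> permutes D"
proof -
  have "y \<in> D \<Longrightarrow> exchange X \<alpha> \<beta> y \<in> D" for y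
    using assms inv_into_into[of y \<alpha> X] inv_into_into[of y \<beta> X] by (auto simp: exchange_def)
  then have "bij_betw (exchange X \<alpha> \<beta>) D D"
    by (intro bij_betw_byWitness[where f' = "exchange X \<alpha> \<beta>"]) (auto simp: exchange_exchange)
  then show ?thesis
    by (rule bij_imp_permutes) (use assms in \<open>auto intro!: exchange_other\<close>)
qed

end

definition hard_funs :: "nat \<Rightarrow> (bool list \<Rightarrow> bool list) set" where
  "hard_funs n = {\<pi>. \<pi> permutes bits n} \<union>
     {\<pi> \<circ> coset_rep s | \<pi> s. \<pi> permutes bits n \<and> s \<in> bits n \<and> hd s}"

lemma hard_funs_length: "h \<in> hard_funs n \<Longrightarrow> length x = n \<Longrightarrow> length (h x) = n"
  by (auto simp: hard_funs_def permutes_bits_length length_coset_rep)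

text \<open>Every \<open>P\<close> with \<open>P (w x) = v x (h x) (r x)\<close> is an instance. Exchanging, for an unknown \<open>g\<close>,
  the values \<open>v x (h x) (r x)\<close> and \<open>e g x\<close> turns a uniformly random such \<open>P\<close> into a uniformly random
  \<open>G\<close> with \<open>G (w x) = e g x\<close>, which is independent of \<open>h\<close> and \<open>r\<close>; for known \<open>P\<close> the points where
  \<open>G\<close> and \<open>P\<close> differ away from the range of \<open>w\<close> are hidden by \<open>g\<close>.\<close>

locale permutation_family = wrapped_oracle A B dec lab emb J k k
  for A :: "'a set" and B :: "'b set" and dec lab emb J k +
  fixes n :: nat and w :: "bool list \<Rightarrow> bool list"
    and v :: "bool list \<Rightarrow> bool list \<Rightarrow> bool list \<Rightarrow> bool list"
    and e :: "bool list \<Rightarrow> bool list \<Rightarrow> bool list"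
    and T :: nat and alg :: "('a, 'b) query_alg"
  assumes n: "n \<ge> 1"
    and w: "\<And>x. length x = n \<Longrightarrow> length (w x) = k" "inj_on w (bits n)"
    and v: "\<And>x y z. length x = n \<Longrightarrow> length y = n \<Longrightarrow> length z = n \<Longrightarrow> length (v x y z) = k"
    and v_inj: "\<And>h. h \<in> hard_funs n \<Longrightarrow> inj_on (\<lambda>(x, z). v x (h x) z) (bits n \<times> bits n)"
    and e: "\<And>g x. length g = n \<Longrightarrow> length x = n \<Longrightarrow> length (e g x) = k"
    and e_inj: "\<And>g x g' x'. length g = n \<Longrightarrow> length x = n \<Longrightarrow> length g' = n \<Longrightarrow> length x' = n \<Longrightarrow>
      e g x = e g' x' \<Longrightarrow> g = g' \<and> x = x'"
    and e_v: "\<And>g x x' y z. e g x \<noteq> v x' y z"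
    and e_zeros: "\<And>x. e (zeros n) x = w x"
    and alg: "is_query_alg A B T alg"
begin

definition K0 :: "input \<Rightarrow> ('a, 'b) operator" where
  "K0 G = drop_columns (lab ` w ` bits n) (wrap G)"

text \<open>The known target of a column of \<open>K0 G\<close>. Columns in the range of
  \<open>w\<close> are already deleted, and bypass columns need no correction because they agree in
  all instances.\<close>

definition \<delta> :: "input \<Rightarrow> 'a \<Rightarrow> 'b option" where
  "\<delta> G a = (case dec a of Some y \<Rightarrow> if y \<in> w ` bits n then None else Some (emb (G y)) | None \<Rightarrow> None)"

definition \<nu> :: "bool list \<Rightarrow> bool list \<Rightarrow> bool list \<Rightarrow> 'b" where
  "\<nu> x y z = emb (v x y z)"

definition \<omega> :: "bool list \<Rightarrow> 'a" where
  "\<omega> x = lab (w x)"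

definition instances :: "input \<Rightarrow> input \<Rightarrow> input set" where
  "instances h r = {P. P permutes bits k \<and> (\<forall>x\<in>bits n. P (w x) = v x (h x) (r x))}"

definition masks :: "bool list \<Rightarrow> input set" where
  "masks g = {G. G permutes bits k \<and> (\<forall>x\<in>bits n. G (w x) = e g x)}"

text \<open>Away from the range of \<open>w\<close>, an instance and the mask obtained from it by
  the exchange differ exactly at these inputs.\<close>

definition hidden :: "bool list \<Rightarrow> input \<Rightarrow> 'a set" where
  "hidden g P = {lab y | y. y \<in> bits k \<and> P y \<in> e g ` bits n}"

lemma wrap_permutes: "P permutes bits k \<Longrightarrow> is_isometry A B (wrap P)"
  using permutes_bits_length permutes_inj_on by (intro wrap_isometry) (auto simp: Pi_def)

lemma process: "G permutes bits k \<Longrightarrow> simon_process n A B alg T (K0 G) \<omega>"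
proof unfold_locales
  assume "G permutes bits k"
  then show "contraction A B (K0 G)"
    unfolding K0_def by (intro contraction_drop_columns contraction_isometry wrap_permutes) auto
  show "inj_on \<omega> (bits n)"
    using w lab_eq_iff by (auto simp: \<omega>_def inj_on_def)
  show "\<omega> ` bits n \<subseteq> A"
    using w lab by (auto simp: \<omega>_def)
qed (use alg n in auto)

abbreviation "ideal_of G h r \<equiv> recorded_process.ideal (bits n) (K0 G) \<omega> \<nu> (\<delta> G) h r"

abbreviation "tags \<equiv> tag_space.tables (bits n) (bits n)"

context
  fixes h r :: input and g :: "bool list"
  assumes h: "h \<in> hard_funs n" and r: "r \<in> tags" and g: "length g = n"
begin

lemma tag_length: "length x = n \<Longrightarrow> length (r x) = n"
proof -
  interpret tag_space "bits n" "bits n"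
    by unfold_locales auto
  show "length x = n \<Longrightarrow> length (r x) = n"
    using tables_in[OF r, of x] by simp
qed

definition swap :: "bool list \<Rightarrow> bool list" where
  "swap = exchange (bits n) (e g) (\<lambda>x. v x (h x) (r x))"

lemma value_inj: "length x = n \<Longrightarrow> length x' = n \<Longrightarrow> length z = n \<Longrightarrow> length z' = n \<Longrightarrow>
    v x (h x) z = v x' (h x') z' \<Longrightarrow> x = x' \<and> z = z'"
  using inj_onD[OF v_inj[OF h], of "(x, z)" "(x', z')"] by simp

lemma swap_facts:
  "length x = n \<Longrightarrow> swap (e g x) = v x (h x) (r x)"
  "length x = n \<Longrightarrow> swap (v x (h x) (r x)) = e g x"
  "y \<notin> e g ` bits n \<Longrightarrow> y \<notin> (\<lambda>x. v x (h x) (r x)) ` bits n \<Longrightarrow> swap y = y"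
  "swap (swap y) = y"
  "swap permutes bits k"
proof -
  have 1: "inj_on (e g) (bits n)"
    using e_inj g by (auto simp: inj_on_def)
  have 2: "inj_on (\<lambda>x. v x (h x) (r x)) (bits n)"
  proof (rule inj_onI)
    fix x y assume "x \<in> bits n" "y \<in> bits n" "v x (h x) (r x) = v y (h y) (r y)"
    then show "x = y"
      using value_inj[of x y "r x" "r y"] tag_length by simp
  qed
  show "length x = n \<Longrightarrow> swap (e g x) = v x (h x) (r x)"
    "length x = n \<Longrightarrow> swap (v x (h x) (r x)) = e g x"
    "y \<notin> e g ` bits n \<Longrightarrow> y \<notin> (\<lambda>x. v x (h x) (r x)) ` bits n \<Longrightarrow> swap y = y"
    "swap (swap y) = y"
    unfolding swap_def using e_v
    by (simp_all add: exchange_left[OF 1 2] exchange_right[OF 1 2, of x] exchange_other[OF 1 2]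
        exchange_exchange[OF 1 2])
  show "swap permutes bits k"
    unfolding swap_def using e_v e g v hard_funs_length[OF h] tag_length
    by (intro exchange_permutes[OF 1 2]) auto
qed

lemma swap_comp: "swap \<circ> P \<in> instances h r" if "P \<in> masks g"
  using that swap_facts(1) permutes_compose[OF _ swap_facts(5)] by (auto simp: masks_def instances_def)

lemma swap_comp': "swap \<circ> P \<in> masks g" if "P \<in> instances h r"
  using that swap_facts(2) permutes_compose[OF _ swap_facts(5)] by (auto simp: masks_def instances_def)

text \<open>Composition with the involution \<open>swap\<close> is a bijection between masks and
  instances, so a uniform mask yields a uniform instance.\<close>

lemma sum_masks: "(\<Sum>G\<in>masks g. F (swap \<circ> G)) = (\<Sum>P\<in>instances h r. F P :: real)"
  by (rule sum.reindex_bij_witness[of _ "\<lambda>P. swap \<circ> P" "\<lambda>P. swap \<circ> P"])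
    (simp_all add: swap_comp swap_comp' fun_eq_iff swap_facts(4))

lemma card_masks: "card (masks g) = card (instances h r)"
  using sum_masks[of "\<lambda>_. 1"] by simp

text \<open>This ties the recorded process to a genuine instance. Bypass labels behave equally on
  both sides. At \<open>w x\<close> the exchange turns \<open>e g x\<close> into the value of the
  instance. Where \<open>G\<close> takes such a value, there is a hit on the left and a hidden point
  on the right, so both columns vanish. Every other value of \<open>G\<close> is fixed by the
  exchange.\<close>

lemma ideal_of_mask:
  assumes G: "G \<in> masks g" and a: "a \<in> A"
  shows "ideal_of G h r b a = drop_columns (hidden g (swap \<circ> G)) (wrap (swap \<circ> G)) b a"
proof -
  have Gp: "G permutes bits k" and Gw: "\<And>x. length x = n \<Longrightarrow> G (w x) = e g x"
    using G by (auto simp: masks_def)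
  interpret simon_process n A B alg T "K0 G" \<omega> \<nu> "\<delta> G"
    by (rule process[OF Gp])
  show ?thesis
  proof (cases "dec a")
    case None
    then have ne: "a \<noteq> lab y" if "length y = k" for y
      using dec_None[OF a None] that by auto
    have ne_w: "a \<noteq> lab (w x)" if "length x = n" for x
      by (rule ne[OF w(1)[OF that]])
    then have "(\<Sum>x\<in>bits n. of_bool (a = \<omega> x) * out h x r b) = 0"
      by (intro sum.neutral) (auto simp: \<omega>_def)
    moreover have "a \<notin> lab ` w ` bits n"
      using ne_w unfolding bits_def by blast
    moreover have "a \<notin> hidden g (swap \<circ> G)"
      using ne unfolding hidden_def bits_def by blast
    ultimately show ?thesis
      using None unfolding ideal_def hit_def
      by (simp add: K0_def drop_columns_def wrap_def \<delta>_def)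
  next
    case (Some y)
    then have y: "length y = k" "a = lab y"
      using dec[OF a] by auto
    have hid: "a \<in> hidden g (swap \<circ> G) \<longleftrightarrow> swap (G y) \<in> e g ` bits n"
      using y lab_eq_iff by (auto simp: hidden_def)
    have a_\<omega>: "a = \<omega> x \<longleftrightarrow> y = w x" if "length x = n" for x
      using y lab_eq_iff w(1) that by (auto simp: \<omega>_def)
    show ?thesis
    proof (cases "y \<in> w ` bits n")
      case True
      then obtain x where x: "length x = n" "y = w x"
        by auto
      have "(\<Sum>x'\<in>bits n. of_bool (a = \<omega> x') * out h x' r b) = (\<Sum>x'\<in>bits n. if x' = x then out h x r b else 0)"
        using a_\<omega> x w(2) by (intro sum.cong) (auto simp: inj_on_def)
      moreover have "K0 G b a = 0"
        using True y by (auto simp: K0_def drop_columns_def)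
      moreover have "a \<notin> hidden g (swap \<circ> G)"
        unfolding hid using x Gw swap_facts(1) e_v[THEN not_sym] by auto
      ultimately show ?thesis
        using x Some Gw swap_facts(1) unfolding ideal_def out_def
        by (simp add: drop_columns_def wrap_def \<nu>_def)
    next
      case False
      then have s0: "(\<Sum>x'\<in>bits n. of_bool (a = \<omega> x') * out h x' r b) = 0"
        using a_\<omega> by (intro sum.neutral) auto
      have K: "K0 G b a = of_bool (b = emb (G y))"
      proof -
        have "a \<notin> lab ` w ` bits n"
        proof
          assume "a \<in> lab ` w ` bits n"
          then obtain x where x: "length x = n" "lab y = lab (w x)"
            using y by auto
          then have "y = w x"
            using lab_eq_iff[of y "w x"] y w(1) by simp
          then show False
            using False x by simp
        qed
        then show ?thesis
          using Some by (simp add: K0_def drop_columns_def wrap_def)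
      qed
      have hit: "hit h x r a = of_bool (G y = v x (h x) (r x))" for x
        using False Some by (simp add: hit_def \<delta>_def \<nu>_def inj_eq[OF emb(1)])
      \<comment> \<open>\<open>G\<close> is injective and takes all values of \<open>e g\<close>
        already on the range of \<open>w\<close>.\<close>
      have Ge: "G y \<notin> e g ` bits n"
      proof
        assume "G y \<in> e g ` bits n"
        then obtain x where "length x = n" "G y = G (w x)"
          using Gw by auto
        then show False
          using False permutes_inj[OF Gp] by (auto simp: inj_eq)
      qed
      show ?thesis
      proof (cases "\<exists>x. length x = n \<and> G y = v x (h x) (r x)")
        case True
        then obtain x where x: "length x = n" "G y = v x (h x) (r x)"
          by auto
        have "(\<Sum>x'\<in>bits n. hit h x' r a) = (\<Sum>x'\<in>bits n. if x' = x then 1 else 0)"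
        proof (intro sum.cong refl)
          fix x' assume "x' \<in> bits n"
          then have "G y = v x' (h x') (r x') \<longleftrightarrow> x' = x"
            using value_inj[of x x' "r x" "r x'"] tag_length x by auto
          then show "hit h x' r a = (if x' = x then 1 else 0)"
            by (simp add: hit)
        qed
        moreover have "a \<in> hidden g (swap \<circ> G)"
          unfolding hid using x swap_facts(2) by auto
        ultimately show ?thesis
          using x unfolding ideal_def s0 by (simp add: drop_columns_def)
      next
        case no: False
        then have "(\<Sum>x'\<in>bits n. hit h x' r a) = 0"
          unfolding hit by (intro sum.neutral) auto
        moreover have "swap (G y) = G y"
          using no Ge by (intro swap_facts(3)) auto
        ultimately show ?thesis
          using Ge Some unfolding ideal_def s0 K by (simp add: drop_columns_def wrap_def hid)
      qed
    qed
  qed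
qed

end

lemma good_mask:
  assumes "G \<in> masks g" "length g = n" "h \<in> hard_funs n"
  shows "recorded_process.good (bits n) (bits n) A B (K0 G) \<omega> \<nu> (\<delta> G) h"
proof -
  have Gp: "G permutes bits k"
    using assms(1) by (simp add: masks_def)
  interpret simon_process n A B alg T "K0 G" \<omega> \<nu> "\<delta> G"
    by (rule process[OF Gp])
  show ?thesis
    unfolding good_def
  proof (intro conjI ballI)
    show "inj_on (\<lambda>(x, z). \<nu> x (h x) z) (bits n \<times> bits n)"
      using v_inj[OF assms(3)] by (auto simp: \<nu>_def inj_on_def inj_eq[OF emb(1)])
    show "\<nu> x (h x) z \<in> B" if "x \<in> bits n" "z \<in> bits n" for x z
      using that v hard_funs_length[OF assms(3)] by (auto simp: \<nu>_def intro!: emb(2))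
    show "contraction A B (ideal h r)" if r: "r \<in> tables" for r
    proof -
      have "swap h r g \<circ> G \<in> instances h r"
        by (rule swap_comp[OF assms(3) r assms(2,1)])
      then have "contraction A B (drop_columns (hidden g (swap h r g \<circ> G)) (wrap (swap h r g \<circ> G)))"
        by (intro contraction_drop_columns contraction_isometry wrap_permutes) (auto simp: instances_def)
      then show ?thesis
        by (rule contraction_cong) (rule ideal_of_mask[OF assms(3) r assms(2,1)])
    qed
  qed
qed

section \<open>Averaging over the masks\<close>

lemma finite_instances: "finite (instances h r)" "finite (masks g)"
  unfolding instances_def masks_def
  by (rule finite_subset[OF _ finite_permutations[OF finite_bits[of k]]], blast)+

lemma zeros_tags: "(\<lambda>x\<in>bits n. zeros n) \<in> tags"
proof -
  interpret tag_space "bits n" "bits n"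
    by unfold_locales auto
  show ?thesis
    by (simp add: tables_def)
qed

definition num_masks :: nat where "num_masks = card (masks (zeros n))"

lemma id_hard: "id \<in> hard_funs n"
  by (simp add: hard_funs_def permutes_id)

lemma card_instances: "h \<in> hard_funs n \<Longrightarrow> r \<in> tags \<Longrightarrow> card (instances h r) = num_masks"
  unfolding num_masks_def by (rule card_masks[symmetric]) auto

text \<open>A single pair of \<open>h\<close> and \<open>r\<close> serves as a pivot: its instances
  are in bijection with \<open>masks g\<close> for every \<open>g\<close>.\<close>

lemma card_masks_eq: "length g = n \<Longrightarrow> card (masks g) = num_masks"
  using card_masks[OF id_hard zeros_tags] card_instances[OF id_hard zeros_tags] by simp

text \<open>This is the purpose of the requirement that \<open>e (zeros n)\<close> equals
  \<open>w\<close>: it shows that masks, and hence instances, exist.\<close>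

lemma id_masks: "id \<in> masks (zeros n)"
  by (simp add: masks_def permutes_id e_zeros)

lemma num_masks_pos: "num_masks > 0"
  using id_masks finite_instances unfolding num_masks_def by (auto simp: card_gt_0_iff)

lemma hidden_disjoint: "disjoint_family_on (\<lambda>g. hidden g P) (bits n)"
  unfolding disjoint_family_on_def
proof (intro ballI impI equals0I)
  fix g g' a assume g: "g \<in> bits n" "g' \<in> bits n" "g \<noteq> g'" and "a \<in> hidden g P \<inter> hidden g' P"
  then obtain y x y' x' where "y \<in> bits k" "y' \<in> bits k" "lab y = lab y'" "x \<in> bits n" "x' \<in> bits n"
      "P y = e g x" "P y' = e g' x'"
    by (auto simp: hidden_def simp del: bits_iff)
  then show False
    using e_inj[of g x g' x'] lab_eq_iff[of y y'] g by simp
qed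

abbreviation "last_sys \<equiv> {..<sys_dim alg T}"

definition value_of :: "(nat, nat) operator \<Rightarrow> ('a, 'b) operator \<Rightarrow> real" where
  "value_of M Q = expect last_sys M (run_alg A B alg Q T)"

text \<open>The sums are rearranged so that the instance \<open>P\<close> is fixed and
  \<open>g\<close> varies. The hidden sets of one \<open>P\<close> are disjoint for different
  \<open>g\<close>, so the hybrid bound costs \<open>sqrt (2 ^ n)\<close> in total for
  \<open>2 ^ n\<close> values of \<open>g\<close>.\<close>

lemma sum_masks_close:
  assumes h: "h \<in> hard_funs n" and r: "r \<in> tags" and M: "is_effect last_sys M"
  shows "\<bar>(\<Sum>g\<in>bits n. \<Sum>G\<in>masks g. value_of M (ideal_of G h r)) -
      2 ^ n * (\<Sum>P\<in>instances h r. value_of M (wrap P))\<bar> \<le> num_masks * (2 * T * sqrt (2 ^ n))"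
proof -
  let ?D = "\<lambda>g P. value_of M (drop_columns (hidden g P) (wrap P))"
  have "(\<Sum>G\<in>masks g. value_of M (ideal_of G h r)) = (\<Sum>P\<in>instances h r. ?D g P)" if g: "length g = n" for g
  proof -
    have "(\<Sum>G\<in>masks g. value_of M (ideal_of G h r)) = (\<Sum>G\<in>masks g. ?D g (swap h r g \<circ> G))"
      unfolding value_of_def using ideal_of_mask[OF h r g]
      by (intro sum.cong refl arg_cong[where f="expect last_sys M"] run_alg_cong) auto
    then show ?thesis
      by (simp only: sum_masks[OF h r g, of "?D g"])
  qed
  then have "(\<Sum>g\<in>bits n. \<Sum>G\<in>masks g. value_of M (ideal_of G h r)) = (\<Sum>g\<in>bits n. \<Sum>P\<in>instances h r. ?D g P)"
    by (intro sum.cong[OF refl]) simp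
  also have "\<dots> = (\<Sum>P\<in>instances h r. \<Sum>g\<in>bits n. ?D g P)"
    by (rule sum.swap)
  finally have "\<bar>(\<Sum>g\<in>bits n. \<Sum>G\<in>masks g. value_of M (ideal_of G h r)) -
      2 ^ n * (\<Sum>P\<in>instances h r. value_of M (wrap P))\<bar> =
      \<bar>\<Sum>P\<in>instances h r. \<Sum>g\<in>bits n. ?D g P - value_of M (wrap P)\<bar>"
    by (simp add: sum_subtractf sum_distrib_left)
  also have "\<dots> \<le> (\<Sum>P\<in>instances h r. \<Sum>g\<in>bits n. \<bar>value_of M (wrap P) - ?D g P\<bar>)"
    by (intro order_trans[OF sum_abs] sum_mono) (simp add: abs_minus_commute)
  also have "\<dots> \<le> (\<Sum>P\<in>instances h r. 2 * T * sqrt (2 ^ n))"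
  proof (rule sum_mono)
    fix P assume "P \<in> instances h r"
    then have P: "P permutes bits k"
      by (simp add: instances_def)
    have sub: "hidden g P \<subseteq> A" for g
      using lab by (auto simp: hidden_def)
    show "(\<Sum>g\<in>bits n. \<bar>value_of M (wrap P) - ?D g P\<bar>) \<le> 2 * T * sqrt (2 ^ n)"
      using sum_expect_drop_columns[OF fin alg wrap_permutes[OF P] finite_bits sub hidden_disjoint M]
      unfolding value_of_def by simp
  qed
  finally show ?thesis
    by (simp add: card_instances[OF h r])
qed

definition mask_pairs :: "(bool list \<times> input) set" where
  "mask_pairs = Sigma (bits n) masks"

lemma card_mask_pairs: "card mask_pairs = 2 ^ n * num_masks"
proof -
  have "card mask_pairs = (\<Sum>g\<in>bits n. card (masks g))"
    unfolding mask_pairs_def by (intro card_SigmaI) (auto simp: finite_instances)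
  also have "\<dots> = (\<Sum>g\<in>bits n. num_masks)"
    by (intro sum.cong) (auto simp: card_masks_eq)
  finally show ?thesis
    by simp
qed

definition mean_of :: "(nat, nat) operator \<Rightarrow> input \<Rightarrow> input \<Rightarrow> real" where
  "mean_of M G h = (\<Sum>r\<in>tags. value_of M (ideal_of G h r)) / card tags"

lemma card_tags_pos: "card tags > 0"
proof -
  interpret tag_space "bits n" "bits n"
    by unfold_locales auto
  show ?thesis
    by (rule card_tables_pos)
qed

lemma sum_mean_of:
  "(\<Sum>(g, G)\<in>mask_pairs. mean_of M G h) =
    (\<Sum>r\<in>tags. \<Sum>g\<in>bits n. \<Sum>G\<in>masks g. value_of M (ideal_of G h r)) / card tags"
proof -
  have "(\<Sum>(g, G)\<in>mask_pairs. mean_of M G h) =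
      (\<Sum>p\<in>mask_pairs. \<Sum>r\<in>tags. value_of M (ideal_of (snd p) h r)) / card tags"
    by (simp add: mean_of_def sum_divide_distrib case_prod_beta)
  also have "(\<Sum>p\<in>mask_pairs. \<Sum>r\<in>tags. value_of M (ideal_of (snd p) h r)) =
      (\<Sum>r\<in>tags. \<Sum>p\<in>mask_pairs. value_of M (ideal_of (snd p) h r))"
    by (rule sum.swap)
  also have "\<dots> = (\<Sum>r\<in>tags. \<Sum>g\<in>bits n. \<Sum>G\<in>masks g. value_of M (ideal_of G h r))"
    unfolding mask_pairs_def
    by (subst sum.Sigma) (auto simp: finite_instances case_prod_beta)
  finally show ?thesis .
qed

text \<open>The promise on genuine instances is carried over to the averaged process. The loss
  \<open>2 * T * sqrt (2 ^ n)\<close> arises once for permutations and once for Simon functions,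
  which gives the factor 4 in the final comparison.\<close>

lemma sum_mean_of_bounds:
  assumes h: "h \<in> hard_funs n" and M: "is_effect last_sys M"
  shows "(\<And>r P. r \<in> tags \<Longrightarrow> P \<in> instances h r \<Longrightarrow> c \<le> value_of M (wrap P)) \<Longrightarrow>
      num_masks * (2 ^ n * c - 2 * T * sqrt (2 ^ n)) \<le> (\<Sum>(g, G)\<in>mask_pairs. mean_of M G h)"
    and "(\<And>r P. r \<in> tags \<Longrightarrow> P \<in> instances h r \<Longrightarrow> value_of M (wrap P) \<le> c) \<Longrightarrow>
      (\<Sum>(g, G)\<in>mask_pairs. mean_of M G h) \<le> num_masks * (2 ^ n * c + 2 * T * sqrt (2 ^ n))"
proof -
  let ?S = "\<lambda>r. \<Sum>g\<in>bits n. \<Sum>G\<in>masks g. value_of M (ideal_of G h r)"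
  let ?V = "\<lambda>r. \<Sum>P\<in>instances h r. value_of M (wrap P)"
  let ?e = "num_masks * (2 * T * sqrt (2 ^ n))"
  note close = sum_masks_close[OF h _ M, unfolded abs_le_iff]
  have pos: "real (card tags) > 0"
    using card_tags_pos by simp
  show "num_masks * (2 ^ n * c - 2 * T * sqrt (2 ^ n)) \<le> (\<Sum>(g, G)\<in>mask_pairs. mean_of M G h)"
    if c: "\<And>r P. r \<in> tags \<Longrightarrow> P \<in> instances h r \<Longrightarrow> c \<le> value_of M (wrap P)"
  proof -
    have "(\<Sum>r\<in>tags. num_masks * (2 ^ n * c - 2 * T * sqrt (2 ^ n))) \<le> (\<Sum>r\<in>tags. ?S r)"
    proof (rule sum_mono)
      fix r assume r: "r \<in> tags"
      have "num_masks * c \<le> ?V r"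
        using sum_mono[of "instances h r" "\<lambda>_. c", OF c[OF r]] by (simp add: card_instances[OF h r])
      then have "2 ^ n * (num_masks * c) \<le> 2 ^ n * ?V r"
        by (intro mult_left_mono) auto
      moreover have "num_masks * (2 ^ n * c - 2 * T * sqrt (2 ^ n)) = 2 ^ n * (num_masks * c) - ?e"
        by (simp add: algebra_simps)
      ultimately show "num_masks * (2 ^ n * c - 2 * T * sqrt (2 ^ n)) \<le> ?S r"
        using close[OF r] by linarith
    qed
    then show ?thesis
      unfolding sum_mean_of using pos by (simp add: pos_le_divide_eq mult.commute)
  qed
  show "(\<Sum>(g, G)\<in>mask_pairs. mean_of M G h) \<le> num_masks * (2 ^ n * c + 2 * T * sqrt (2 ^ n))"
    if c: "\<And>r P. r \<in> tags \<Longrightarrow> P \<in> instances h r \<Longrightarrow> value_of M (wrap P) \<le> c"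
  proof -
    have "(\<Sum>r\<in>tags. ?S r) \<le> (\<Sum>r\<in>tags. num_masks * (2 ^ n * c + 2 * T * sqrt (2 ^ n)))"
    proof (rule sum_mono)
      fix r assume r: "r \<in> tags"
      have "?V r \<le> num_masks * c"
        using sum_mono[of "instances h r" _ "\<lambda>_. c", OF c[OF r]] by (simp add: card_instances[OF h r])
      then have "2 ^ n * ?V r \<le> 2 ^ n * (num_masks * c)"
        by (intro mult_left_mono) auto
      moreover have "num_masks * (2 ^ n * c + 2 * T * sqrt (2 ^ n)) = 2 ^ n * (num_masks * c) + ?e"
        by (simp add: algebra_simps)
      ultimately show "?S r \<le> num_masks * (2 ^ n * c + 2 * T * sqrt (2 ^ n))"
        using close[OF r] by linarith
    qed
    then show ?thesis
      unfolding sum_mean_of using pos by (simp add: pos_divide_le_eq mult.commute)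
  qed
qed

theorem permutation_lower_bound:
  assumes no: "\<And>\<pi> r P. \<pi> permutes bits n \<Longrightarrow> r \<in> bits n \<rightarrow> bits n \<Longrightarrow> P \<in> instances \<pi> r \<Longrightarrow>
      2 / 3 \<le> 1 - accept_prob A B T alg (wrap P)"
    and yes: "\<And>\<pi> s r P. \<pi> permutes bits n \<Longrightarrow> length s = n \<Longrightarrow> hd s \<Longrightarrow> r \<in> bits n \<rightarrow> bits n \<Longrightarrow>
      P \<in> instances (\<pi> \<circ> coset_rep s) r \<Longrightarrow> 2 / 3 \<le> accept_prob A B T alg (wrap P)"
  shows "sqrt (2 ^ n) / 150 \<le> real T"
proof -
  \<comment> \<open>Any permutation would do: \<open>perms\<close>, \<open>shifts\<close>,
    \<open>tables\<close> and \<open>blowup\<close> are the same for every \<open>G\<close>.\<close>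
  interpret simon_process n A B alg T "K0 id" \<omega> \<nu> "\<delta> id"
    by (rule process[OF permutes_id])
  define M where "M = (\<lambda>i j. (if i = j then 1 else 0) - accept alg i j :: complex)"
  have M: "is_effect last_sys M"
    unfolding M_def using alg by (intro is_effect_complement) (auto simp: is_query_alg_def)
  have val: "value_of M (wrap P) = 1 - accept_prob A B T alg (wrap P)" if "P \<in> instances h r" for h r P
    unfolding value_of_def M_def
    by (rule expect_complement_run) (use alg that wrap_permutes in \<open>auto simp: instances_def\<close>)
  have tab: "r \<in> tables \<Longrightarrow> r \<in> bits n \<rightarrow> bits n" for r
    by (auto simp: tables_def)
  have hard: "\<pi> \<in> perms \<Longrightarrow> \<pi> \<in> hard_funs n" "\<pi> \<in> perms \<Longrightarrow> s \<in> shifts \<Longrightarrow> \<pi> \<circ> coset_rep s \<in> hard_funs n" for \<pi> s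
    unfolding hard_funs_def by blast+
  let ?R = "card shifts * card perms * (2 * blowup * (2 + blowup)) + card perms * ((real T)\<^sup>2 * (1 + blowup)\<^sup>2)"
  let ?s = "sqrt (2 ^ n) :: real"
  have upper: "(\<Sum>s\<in>shifts. \<Sum>\<pi>\<in>perms. mean_of M G \<pi> - mean_of M G (\<pi> \<circ> coset_rep s)) \<le> ?R"
    if "(g, G) \<in> mask_pairs" for g G
  proof -
    have G: "G \<in> masks g" "length g = n" "G permutes bits k"
      using that by (auto simp: mask_pairs_def masks_def)
    interpret G: simon_process n A B alg T "K0 G" \<omega> \<nu> "\<delta> G"
      by (rule process[OF G(3)])
    have "mean_of M G h = G.mean M h" for h
      by (simp add: mean_of_def G.mean_def value_of_def)
    then show ?thesis
      using G.sum_mean_le[OF M good_mask[OF G(1,2) hard(1)] good_mask[OF G(1,2) hard(2)]] by simp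
  qed
  let ?X = "\<lambda>h. \<Sum>(g, G)\<in>mask_pairs. mean_of M G h"
  have lower: "num_masks * (2 ^ n * (1 / 3) - 4 * T * ?s) \<le> ?X \<pi> - ?X (\<pi> \<circ> coset_rep s)"
    if \<pi>: "\<pi> \<in> perms" and s: "s \<in> shifts" for \<pi> s
  proof -
    have "num_masks * (2 ^ n * (2 / 3) - 2 * T * ?s) \<le> ?X \<pi>"
      using \<pi> no[OF _ tab] val by (intro sum_mean_of_bounds(1) hard M) auto
    moreover have "value_of M (wrap P) \<le> 1 / 3" if r: "r \<in> tables" and P: "P \<in> instances (\<pi> \<circ> coset_rep s) r" for r P
      using yes[OF _ _ _ tab[OF r] P] \<pi> s val[OF P] by simp
    then have "?X (\<pi> \<circ> coset_rep s) \<le> num_masks * (2 ^ n * (1 / 3) + 2 * T * ?s)"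
      using \<pi> s by (intro sum_mean_of_bounds(2) hard M) auto
    ultimately show ?thesis
      by (simp add: algebra_simps)
  qed
  have "card shifts * card perms * (num_masks * (2 ^ n * (1 / 3) - 4 * T * ?s)) =
      (\<Sum>s\<in>shifts. \<Sum>\<pi>\<in>perms. num_masks * (2 ^ n * (1 / 3) - 4 * T * ?s))"
    by simp
  also have "\<dots> \<le> (\<Sum>s\<in>shifts. \<Sum>\<pi>\<in>perms. ?X \<pi> - ?X (\<pi> \<circ> coset_rep s))"
    by (intro sum_mono lower)
  \<comment> \<open>The mask is moved to the outside, because the comparison of permutations with
    Simon functions takes place within the process of one fixed \<open>G\<close>.\<close>
  also have "\<dots> = (\<Sum>s\<in>shifts. \<Sum>\<pi>\<in>perms. \<Sum>p\<in>mask_pairs. mean_of M (snd p) \<pi> - mean_of M (snd p) (\<pi> \<circ> coset_rep s))"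
    by (simp add: sum_subtractf case_prod_beta)
  also have "\<dots> = (\<Sum>s\<in>shifts. \<Sum>p\<in>mask_pairs. \<Sum>\<pi>\<in>perms. mean_of M (snd p) \<pi> - mean_of M (snd p) (\<pi> \<circ> coset_rep s))"
    by (intro sum.cong refl sum.swap)
  also have "\<dots> = (\<Sum>p\<in>mask_pairs. \<Sum>s\<in>shifts. \<Sum>\<pi>\<in>perms. mean_of M (snd p) \<pi> - mean_of M (snd p) (\<pi> \<circ> coset_rep s))"
    by (rule sum.swap)
  also have "\<dots> \<le> (\<Sum>p\<in>mask_pairs. ?R)"
  proof (rule sum_mono)
    fix p assume "p \<in> mask_pairs"
    then show "(\<Sum>s\<in>shifts. \<Sum>\<pi>\<in>perms. mean_of M (snd p) \<pi> - mean_of M (snd p) (\<pi> \<circ> coset_rep s)) \<le> ?R"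
      using upper[of "fst p" "snd p"] by simp
  qed
  also have "\<dots> = 2 ^ n * real num_masks * ?R"
    by (simp add: card_mask_pairs)
  finally have fin: "card shifts * card perms * (num_masks * (2 ^ n * (1 / 3) - 4 * T * ?s)) \<le> 2 ^ n * real num_masks * ?R" .
  have "2 ^ n * (1 / 3) - 4 * T * ?s = 2 ^ n * (1 / 3 - 4 * T / ?s)"
  proof -
    have "a * (4 * T / c) = 4 * T * c" if "a = c * c" "c \<noteq> 0" for a c :: real
      using that by simp
    from this[of "2 ^ n" ?s] show ?thesis
      by (simp add: right_diff_distrib)
  qed
  with fin have "(2 ^ n * real num_masks) * (card shifts * card perms * (1 / 3 - 4 * T / ?s)) \<le> (2 ^ n * real num_masks) * ?R"
    by (simp only: mult_ac of_nat_mult)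
  then have "card shifts * card perms * (1 / 3 - 4 * T / ?s) \<le> ?R"
    using num_masks_pos by (simp only: mult_le_cancel_left_pos of_nat_0_less_iff mult_pos_pos zero_less_power zero_less_numeral)
  then show ?thesis
    by (intro query_bound) (simp only: of_nat_mult of_nat_numeral)
qed

end

subsection \<open>Non-adaptive algorithms\<close>

definition histories :: "'c set \<Rightarrow> nat \<Rightarrow> 'c list set" where
  "histories C t = {l. set l \<subseteq> C \<and> length l = t}"

lemma sum_histories_Suc:
  "(\<Sum>l\<in>histories C (Suc t). F l) = (\<Sum>l\<in>histories C t. \<Sum>c\<in>C. F (l @ [c]))"
proof -
  have "(\<Sum>l\<in>histories C (Suc t). F l) = (\<Sum>(l, c)\<in>histories C t \<times> C. F (l @ [c]))"
  proof (rule sum.reindex_bij_witness[of _ "\<lambda>(l, c). l @ [c]" "\<lambda>l. (butlast l, last l)"])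
    fix l assume l: "l \<in> histories C (Suc t)"
    then have "l \<noteq> []"
      by (auto simp: histories_def)
    then show "(\<lambda>(l, c). l @ [c]) (butlast l, last l) = l"
      and "(butlast l, last l) \<in> histories C t \<times> C"
      and "(case (butlast l, last l) of (l, c) \<Rightarrow> F (l @ [c])) = F l"
      using l last_in_set[of l] by (auto simp: histories_def dest: in_set_butlastD)
  qed (auto simp: histories_def)
  then show ?thesis
    by (simp add: sum.cartesian_product)
qed

lemma histories_0: "histories C 0 = {[]}"
  by (auto simp: histories_def)

text \<open>The distributive law; for probabilities it expresses that the outcomes are
  independent.\<close>

lemma sum_histories_prod:
  fixes g :: "nat \<Rightarrow> 'c \<Rightarrow> real"
  shows "(\<Sum>l\<in>histories C t. \<Prod>j<t. g j (l ! j)) = (\<Prod>j<t. \<Sum>c\<in>C. g j c)"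
proof (induction t)
  case (Suc t)
  have "(\<Prod>j<t. g j ((l @ [c]) ! j)) = (\<Prod>j<t. g j (l ! j))" if "l \<in> histories C t" for l c
    using that by (intro prod.cong) (auto simp: histories_def nth_append)
  moreover have "(l @ [c]) ! t = c" if "l \<in> histories C t" for l c
    using that by (auto simp: histories_def)
  ultimately show ?case
    by (simp add: sum_histories_Suc flip: Suc sum_distrib_left sum_distrib_right)
qed (simp add: histories_0)

lemma sum_lessThan_power_Suc:
  fixes f :: "nat \<Rightarrow> 'c::comm_monoid_add"
  shows "(\<Sum>j<m ^ Suc t. f j) = (\<Sum>w<m ^ t. \<Sum>d<m. f (w * m + d))"
proof -
  have "(\<Sum>j<m ^ Suc t. f j) = (\<Sum>w<m ^ t. sum f {w * m..<w * m + m})"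
    by (simp add: sum.nat_group mult.commute)
  also have "\<dots> = (\<Sum>w<m ^ t. \<Sum>d<m. f (w * m + d))"
  proof (rule sum.cong[OF refl])
    fix w
    show "sum f {w * m..<w * m + m} = (\<Sum>d<m. f (w * m + d))"
      by (rule sum.reindex_bij_witness[of _ "\<lambda>d. w * m + d" "\<lambda>j. j - w * m"]) auto
  qed
  finally show ?thesis .
qed

text \<open>The outcomes of the first \<open>t\<close> queries are the digits of the basis label \<open>i < m ^ t\<close>.\<close>

primrec digits :: "nat \<Rightarrow> (nat \<Rightarrow> 'c) \<Rightarrow> nat \<Rightarrow> nat \<Rightarrow> 'c list" where
  "digits m c 0 i = []"
| "digits m c (Suc t) i = digits m c t (i div m) @ [c (i mod m)]"

lemma length_digits [simp]: "length (digits m c t i) = t"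
  by (induction t arbitrary: i) auto

lemma sum_digits:
  assumes "bij_betw c {..<m} C"
  shows "(\<Sum>i<m ^ t. F (digits m c t i)) = (\<Sum>l\<in>histories C t. F l :: 'd::comm_monoid_add)"
proof (induction t arbitrary: F)
  case (Suc t)
  have "(\<Sum>i<m ^ Suc t. F (digits m c (Suc t) i)) = (\<Sum>w<m ^ t. \<Sum>d<m. F (digits m c t w @ [c d]))"
    unfolding sum_lessThan_power_Suc by (intro sum.cong) auto
  also have "\<dots> = (\<Sum>w<m ^ t. \<Sum>y\<in>C. F (digits m c t w @ [y]))"
    by (intro sum.cong refl sum.reindex_bij_betw[OF assms])
  finally show ?case
    by (simp only: Suc[of "\<lambda>l. \<Sum>y\<in>C. F (l @ [y])"] sum_histories_Suc)
qed (simp add: histories_0)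

text \<open>Every query starts from its own fixed state \<open>\<xi> t\<close> and is followed by
  the basis change \<open>V t\<close>. Its outcome is only stored, and the predicate
  \<open>acc\<close> decides on the complete list at the end.\<close>

locale product_algorithm =
  fixes A :: "'a set" and B :: "'b set" and C :: "'c set" and T :: nat
    and \<xi> :: "nat \<Rightarrow> 'a state" and V :: "nat \<Rightarrow> ('b, 'c) operator" and acc :: "'c list \<Rightarrow> bool"
    and c :: "nat \<Rightarrow> 'c" and m :: nat
  assumes fin [simp]: "finite A" "finite B"
    and \<xi>: "\<And>t. t < T \<Longrightarrow> unit_state A (\<xi> t)"
    and V: "\<And>t. t < T \<Longrightarrow> is_isometry B C (V t)"
    and c: "bij_betw c {..<m} C"
begin

definition alg :: "('a, 'b) query_alg" where
  "alg = \<lparr>sys_dim = \<lambda>t. m ^ t, work_dim = \<lambda>t. m ^ t, init = \<lambda>_. 1,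
     pre = \<lambda>t (a, w) i. if w = i then \<xi> t a else 0,
     post = \<lambda>t j (b, w). if j div m = w then V t (c (j mod m)) b else 0,
     accept = \<lambda>i j. if i = j \<and> acc (digits m c T i) then 1 else 0\<rparr>"

lemma quad_accept:
  "quad_form {..<m ^ T} (accept alg) \<psi> = of_real (\<Sum>i<m ^ T. of_bool (acc (digits m c T i)) * (cmod (\<psi> i))\<^sup>2)"
proof -
  have "quad_form {..<m ^ T} (accept alg) \<psi> =
      (\<Sum>i<m ^ T. \<Sum>j<m ^ T. if i = j then of_bool (acc (digits m c T i)) * (cnj (\<psi> i) * \<psi> i) else 0)"
    unfolding quad_form_def alg_def by (intro sum.cong) auto
  then show ?thesis
    by (simp add: complex_norm_square mult.commute del: of_real_power)
qed

lemma is_query_alg: "is_query_alg A B T alg"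
  unfolding is_query_alg_def
proof (intro conjI allI impI)
  show "unit_state {..<sys_dim alg 0} (init alg)"
    by (simp add: alg_def unit_state_def lessThan_Suc)
next
  fix t assume t: "t < T"
  show "is_isometry {..<sys_dim alg t} (A \<times> {..<work_dim alg t}) (pre alg t)"
    unfolding is_isometry_def
  proof (intro ballI)
    fix i i' assume i: "i \<in> {..<sys_dim alg t}" "i' \<in> {..<sys_dim alg t}"
    have "(\<Sum>p\<in>A \<times> {..<work_dim alg t}. cnj (pre alg t p i) * pre alg t p i') =
        (\<Sum>a\<in>A. \<Sum>w<m ^ t. if w = i then (if i = i' then cnj (\<xi> t a) * \<xi> t a else 0) else 0)"
      unfolding sum.cartesian_product alg_def by (intro sum.cong) auto
    also have "\<dots> = (if i = i' then (\<Sum>a\<in>A. cnj (\<xi> t a) * \<xi> t a) else 0)"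
      using i by (simp add: alg_def)
    also have "(\<Sum>a\<in>A. cnj (\<xi> t a) * \<xi> t a) = 1"
      using \<xi>[OF t] by (simp add: unit_state_vnorm flip: of_real_vnorm_power2)
    finally show "(\<Sum>p\<in>A \<times> {..<work_dim alg t}. cnj (pre alg t p i) * pre alg t p i') = (if i = i' then 1 else 0)" .
  qed
  show "is_isometry (B \<times> {..<work_dim alg t}) {..<sys_dim alg (Suc t)} (post alg t)"
    unfolding is_isometry_def
  proof (intro ballI)
    fix p p' assume "p \<in> B \<times> {..<work_dim alg t}" "p' \<in> B \<times> {..<work_dim alg t}"
    then obtain b w b' w' where p: "p = (b, w)" "p' = (b', w')" "b \<in> B" "b' \<in> B" "w < m ^ t" "w' < m ^ t"
      by (auto simp: alg_def)
    have "(\<Sum>j<sys_dim alg (Suc t). cnj (post alg t j p) * post alg t j p') =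
        (\<Sum>u<m ^ t. \<Sum>d<m. cnj (post alg t (u * m + d) p) * post alg t (u * m + d) p')"
      by (simp only: alg_def query_alg.simps sum_lessThan_power_Suc)
    also have "\<dots> = (\<Sum>u<m ^ t. \<Sum>d<m. if u = w then (if w = w' then cnj (V t (c d) b) * V t (c d) b' else 0) else 0)"
      unfolding p alg_def by (intro sum.cong) auto
    also have "\<dots> = (if w = w' then (\<Sum>d<m. cnj (V t (c d) b) * V t (c d) b') else 0)"
      using p by (subst sum.swap) simp
    also have "(\<Sum>d<m. cnj (V t (c d) b) * V t (c d) b') = (\<Sum>y\<in>C. cnj (V t y b) * V t y b')"
      by (rule sum.reindex_bij_betw[OF c])
    also have "\<dots> = (if b = b' then 1 else 0)"
      using V[OF t] p by (simp add: is_isometry_def)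
    finally show "(\<Sum>j<sys_dim alg (Suc t). cnj (post alg t j p) * post alg t j p') = (if p = p' then 1 else 0)"
      using p by auto
  qed
next
  have "sys_dim alg T = m ^ T"
    by (simp add: alg_def)
  then show "is_effect {..<sys_dim alg T} (accept alg)"
    unfolding is_effect_def
    by (auto simp: quad_accept intro!: sum_nonneg sum_mono2)
qed

definition amp :: "('a, 'b) operator \<Rightarrow> nat \<Rightarrow> 'c state" where
  "amp Q t = apply_op B (V t) (apply_op A Q (\<xi> t))"

lemma run_alg_eq:
  "t \<le> T \<Longrightarrow> i < m ^ t \<Longrightarrow> run_alg A B alg Q t i = (\<Prod>j<t. amp Q j (digits m c t i ! j))"
proof (induction t arbitrary: i)
  case 0
  then show ?case
    by (simp add: alg_def)
next
  case (Suc t)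
  let ?\<psi> = "run_alg A B alg Q t"
  have dims: "sys_dim alg t = m ^ t" "work_dim alg t = m ^ t"
    by (simp_all add: alg_def)
  have pre: "apply_op {..<m ^ t} (pre alg t) ?\<psi> (a, w) = \<xi> t a * ?\<psi> w" if "w < m ^ t" for a w
    using that by (simp add: apply_op_def alg_def if_distrib[of "\<lambda>x. x * _"] cong: if_cong)
  have ten: "apply_op (A \<times> {..<m ^ t}) (tensor_id Q) (apply_op {..<m ^ t} (pre alg t) ?\<psi>) (b, w) =
      apply_op A Q (\<xi> t) b * ?\<psi> w" if "w < m ^ t" for b w
    using that by (simp add: apply_tensor_id pre) (simp add: apply_op_def sum_distrib_right mult.assoc)
  have div: "i div m < m ^ t"
    using Suc.prems(2) by (simp add: less_mult_imp_div_less mult.commute)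
  have "run_alg A B alg Q (Suc t) i = (\<Sum>b\<in>B. \<Sum>w<m ^ t. post alg t i (b, w) * (apply_op A Q (\<xi> t) b * ?\<psi> w))"
    unfolding run_alg.simps dims apply_op_def[of "B \<times> _"] sum.cartesian_product
    by (intro sum.cong) (auto simp: ten)
  also have "\<dots> = (\<Sum>b\<in>B. \<Sum>w<m ^ t. if w = i div m then V t (c (i mod m)) b * (apply_op A Q (\<xi> t) b * ?\<psi> (i div m)) else 0)"
    by (intro sum.cong) (auto simp: alg_def)
  also have "\<dots> = amp Q t (c (i mod m)) * ?\<psi> (i div m)"
    using div by (simp add: amp_def apply_op_def[of B] sum_distrib_right mult.assoc)
  also have "\<dots> = (\<Prod>j<Suc t. amp Q j (digits m c (Suc t) i ! j))"
    using Suc.IH[OF _ div] Suc.prems by (simp add: nth_append)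
  finally show ?case .
qed

theorem accept_prob_eq:
  "accept_prob A B T alg Q = (\<Sum>l\<in>histories C T. of_bool (acc l) * (\<Prod>j<T. (cmod (amp Q j (l ! j)))\<^sup>2))"
proof -
  have "accept_prob A B T alg Q = (\<Sum>i<m ^ T. of_bool (acc (digits m c T i)) * (cmod (run_alg A B alg Q T i))\<^sup>2)"
    unfolding accept_prob_def by (subst alg_def) (simp add: quad_accept)
  also have "\<dots> = (\<Sum>i<m ^ T. of_bool (acc (digits m c T i)) * (\<Prod>j<T. (cmod (amp Q j (digits m c T i ! j)))\<^sup>2))"
    by (intro sum.cong) (auto simp: run_alg_eq prod_norm[symmetric] prod_power_distrib)
  also have "\<dots> = (\<Sum>l\<in>histories C T. of_bool (acc l) * (\<Prod>j<T. (cmod (amp Q j (l ! j)))\<^sup>2))"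
    by (rule sum_digits[OF c])
  finally show ?thesis .
qed

end

section \<open>Query complexity as an infimum\<close>

lemma query_complexity_le:
  "solves A B orc Pr T \<A> \<Longrightarrow> query_complexity A B orc Pr \<le> enat T"
  unfolding query_complexity_def by (rule Inf_lower) blast

lemma query_complexity_ge:
  assumes "\<And>T \<A>. solves A B orc Pr T \<A> \<Longrightarrow> c \<le> real T"
  shows "ereal c \<le> ereal_of_enat (query_complexity A B orc Pr)"
proof (cases "query_complexity A B orc Pr")
  case (enat T)
  let ?S = "{enat T | T. \<exists>\<A>. solves A B orc Pr T \<A>}"
  have "?S \<noteq> {}"
    using enat unfolding query_complexity_def by (metis Inf_empty enat.distinct(1) top_enat_def)
  \<comment> \<open>A nonempty set of extended naturals contains its infimum, so an optimal
    algorithm exists.\<close>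
  then have "Inf ?S \<in> ?S"
    by (meson ex_in_conv wellorder_InfI)
  then show ?thesis
    using assms enat unfolding query_complexity_def by auto
qed simp

subsection \<open>Classical collision search\<close>

text \<open>Basis states are queried and the answers are read in the standard basis, so the list of
  outcomes is deterministic and \<open>acc\<close> looks for a collision in it.\<close>

lemma collision_algorithm:
  fixes Pr :: promise_problem and w hash :: "bool list \<Rightarrow> bool list"
  assumes w: "\<And>x. x \<in> set xs \<Longrightarrow> length (w x) = k"
    and val: "\<And>f x. f \<in> fst Pr \<union> snd Pr \<Longrightarrow> x \<in> set xs \<Longrightarrow> length (f (w x)) = l"
    and yes: "\<And>f. f \<in> fst Pr \<Longrightarrow> \<exists>x\<in>set xs. \<exists>y\<in>set xs. x \<noteq> y \<and> hash (f (w x)) = hash (f (w y))"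
    and no: "\<And>f. f \<in> snd Pr \<Longrightarrow> inj_on (\<lambda>x. hash (f (w x))) (set xs)"
  shows "query_complexity (bits k) (bits l) basis_op Pr \<le> enat (length xs)"
proof -
  let ?T = "length xs" and ?B = "bits l"
  let ?\<xi> = "\<lambda>t a. of_bool (a = w (xs ! t)) :: complex"
  define acc where "acc ys \<longleftrightarrow> (\<exists>i<?T. \<exists>j<?T. xs ! i \<noteq> xs ! j \<and> hash (ys ! i) = hash (ys ! j))" for ys
  obtain c :: "nat \<Rightarrow> bool list" where c: "bij_betw c {..<card ?B} ?B"
    using ex_bij_betw_nat_finite[OF finite_bits, of l] by (auto simp: lessThan_atLeast0)
  interpret product_algorithm "bits k" ?B ?B ?T ?\<xi> "\<lambda>_. basis_op id" acc c "card ?B"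
  proof
    show "unit_state (bits k) (?\<xi> t)" if "t < ?T" for t
    proof -
      have "(\<Sum>a\<in>bits k. (cmod (?\<xi> t a))\<^sup>2) = (\<Sum>a\<in>bits k. if a = w (xs ! t) then 1 else 0)"
        by (intro sum.cong) auto
      then show ?thesis
        using w that by (simp add: unit_state_def)
    qed
    show "is_isometry ?B ?B (basis_op id)" if "t < ?T" for t
      by (rule is_isometry_basis_op) auto
  qed (use c in auto)
  have prob: "accept_prob (bits k) ?B ?T alg (basis_op f) = of_bool (acc (map (\<lambda>x. f (w x)) xs))"
    if f: "f \<in> fst Pr \<union> snd Pr" for f
  proof -
    let ?ys = "map (\<lambda>x. f (w x)) xs"
    have amp: "amp (basis_op f) t y = of_bool (y = ?ys ! t)" if t: "t < ?T" for t y
    proof -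
      have len: "length (w (xs ! t)) = k" "length (f (w (xs ! t))) = l"
        using w val[OF f] t by auto
      have "apply_op (bits k) (basis_op f) (?\<xi> t) b = (\<Sum>a\<in>bits k. if a = w (xs ! t) then of_bool (b = f (w (xs ! t))) else 0)" for b
        unfolding apply_op_def by (intro sum.cong) (auto simp: basis_op_def)
      then have "apply_op (bits k) (basis_op f) (?\<xi> t) b = of_bool (b = ?ys ! t)" for b
        using len t by simp
      then have "amp (basis_op f) t y = (\<Sum>b\<in>?B. if b = ?ys ! t then of_bool (y = ?ys ! t) else 0)"
        unfolding amp_def apply_op_def[of ?B] by (intro sum.cong) (auto simp: basis_op_def)
      then show ?thesis
        using len t by simp
    qed
    have prod: "(\<Prod>j<?T. (cmod (amp (basis_op f) j (l' ! j)))\<^sup>2) = of_bool (l' = ?ys)"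
      if l': "l' \<in> histories ?B ?T" for l'
    proof (cases "l' = ?ys")
      case False
      then obtain j where "j < ?T" "l' ! j \<noteq> ?ys ! j"
        using l' nth_equalityI[of l' ?ys] by (auto simp: histories_def)
      then have "\<exists>j\<in>{..<?T}. (cmod (amp (basis_op f) j (l' ! j)))\<^sup>2 = 0"
        by (intro bexI[of _ j]) (auto simp: amp)
      then show ?thesis
        using False by (simp add: prod_zero)
    qed (simp add: amp)
    have "?ys \<in> histories ?B ?T"
      using val[OF f] by (auto simp: histories_def)
    moreover have "finite (histories ?B ?T)"
      unfolding histories_def by (rule finite_lists_length_eq) simp
    moreover have "accept_prob (bits k) ?B ?T alg (basis_op f) =
        (\<Sum>l'\<in>histories ?B ?T. if l' = ?ys then of_bool (acc ?ys) else 0)"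
      unfolding accept_prob_eq by (intro sum.cong) (auto simp: prod)
    ultimately show ?thesis
      by simp
  qed
  have "acc (map (\<lambda>x. f (w x)) xs)" if f: "f \<in> fst Pr" for f
  proof -
    obtain x y where "x \<in> set xs" "y \<in> set xs" "x \<noteq> y" "hash (f (w x)) = hash (f (w y))"
      using yes[OF f] by blast
    then show ?thesis
      unfolding acc_def by (fastforce simp: in_set_conv_nth)
  qed
  moreover have "\<not> acc (map (\<lambda>x. f (w x)) xs)" if f: "f \<in> snd Pr" for f
    using inj_onD[OF no[OF f]] unfolding acc_def by auto
  ultimately have "solves (bits k) ?B basis_op Pr ?T alg"
    unfolding solves_def using is_query_alg prob by auto
  then show ?thesis
    by (rule query_complexity_le)
qed

text \<open>Every shift is the sum of a string supported on the first half of the positions and a string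
  supported on the second half.\<close>

lemma difference_cover:
  assumes "n \<ge> 1"
  obtains xs :: "bool list list" where "set xs \<subseteq> bits n" "real (length xs) \<le> 3 * 2 powr (real n / 2)"
    "\<And>s. length s = n \<Longrightarrow> \<exists>x\<in>set xs. bxor x s \<in> set xs"
proof -
  define m where "m = n div 2"
  define L where "L k = List.n_lists k [False, True]" for k
  have L: "set (L k) = bits k" "length (L k) = 2 ^ k" for k
    by (auto simp: L_def set_n_lists length_n_lists bits_def numeral_2_eq_2)
  define xs where "xs = map (\<lambda>a. a @ zeros (n - m)) (L m) @ map (\<lambda>b. zeros m @ b) (L (n - m))"
  have m: "m \<le> n" "2 * m \<le> n" "2 * (n - m) \<le> n + 1"
    by (auto simp: m_def)
  have "set xs \<subseteq> bits n"
    using m by (auto simp: xs_def L)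
  moreover have "real (length xs) \<le> 3 * 2 powr (real n / 2)"
  proof -
    have "2 ^ m = 2 powr real m"
      by (simp add: powr_realpow)
    also have "\<dots> \<le> 2 powr (real n / 2)"
      using m(2) by (intro powr_mono) auto
    finally have 1: "2 ^ m \<le> 2 powr (real n / 2)" .
    have "2 ^ (n - m) = 2 powr real (n - m)"
      by (simp add: powr_realpow)
    \<comment> \<open>For odd \<open>n\<close> the second half is longer by one, which costs a
      factor \<open>sqrt 2\<close>, bounded by 2. With the first half this gives the constant
      3.\<close>
    also have "\<dots> \<le> 2 powr (1 / 2 + real n / 2)"
      using m by (intro powr_mono) (auto simp: field_simps simp flip: of_nat_diff)
    also have "\<dots> = sqrt 2 * 2 powr (real n / 2)"
      by (simp add: powr_add powr_half_sqrt)
    also have "\<dots> \<le> 2 * 2 powr (real n / 2)"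
      using sqrt2_less_2 by (intro mult_right_mono) auto
    finally show ?thesis
      using 1 by (simp add: xs_def L)
  qed
  moreover have "\<exists>x\<in>set xs. bxor x s \<in> set xs" if s: "length s = n" for s
  proof (intro bexI)
    have "bxor (take m s @ zeros (n - m)) s = zeros m @ drop m s"
    proof (rule nth_equalityI)
      fix i assume "i < length (bxor (take m s @ zeros (n - m)) s)"
      then have i: "i < n"
        using s m by simp
      then show "bxor (take m s @ zeros (n - m)) s ! i = (zeros m @ drop m s) ! i"
        using s m by (cases "i < m") (auto simp: nth_append)
    qed (use s m in auto)
    then show "bxor (take m s @ zeros (n - m)) s \<in> set xs"
      using s by (auto simp: xs_def L)
    show "take m s @ zeros (n - m) \<in> set xs"
      using s m by (auto simp: xs_def L)
  qed
  ultimately show ?thesis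
    using that by blast
qed

lemma bxor_self: "length x = n \<Longrightarrow> bxor x x = zeros n"
  by (rule nth_equalityI) auto

lemma collision_query_complexity:
  fixes Pr :: promise_problem and w hash :: "bool list \<Rightarrow> bool list"
  assumes n: "n \<ge> 1" and w: "\<And>x. length x = n \<Longrightarrow> length (w x) = k"
    and val: "\<And>f x. f \<in> fst Pr \<union> snd Pr \<Longrightarrow> length x = n \<Longrightarrow> length (f (w x)) = l"
    and yes: "\<And>f. f \<in> fst Pr \<Longrightarrow> \<exists>h. yes_fun n h \<and> (\<forall>x\<in>bits n. hash (f (w x)) = h x)"
    and no: "\<And>f. f \<in> snd Pr \<Longrightarrow> \<exists>h. no_fun n h \<and> (\<forall>x\<in>bits n. hash (f (w x)) = h x)"
  shows "ereal_of_enat (query_complexity (bits k) (bits l) basis_op Pr) \<le> ereal (3 * 2 powr (real n / 2))"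
proof -
  obtain xs :: "bool list list" where xs: "set xs \<subseteq> bits n" "real (length xs) \<le> 3 * 2 powr (real n / 2)"
      "\<And>s. length s = n \<Longrightarrow> \<exists>x\<in>set xs. bxor x s \<in> set xs"
    using difference_cover[OF n] by blast
  have len: "x \<in> set xs \<Longrightarrow> length x = n" for x
    using xs(1) by auto
  have "query_complexity (bits k) (bits l) basis_op Pr \<le> enat (length xs)"
  proof (rule collision_algorithm)
    fix f assume "f \<in> fst Pr"
    then obtain h s where s: "simon_function n s h" and h: "\<And>x. length x = n \<Longrightarrow> hash (f (w x)) = h x"
      using yes unfolding yes_fun_def by force
    then have sn: "length s = n" "s \<noteq> zeros n"
      by (auto simp: simon_function_def)
    obtain x where x: "x \<in> set xs" "bxor x s \<in> set xs"
      using xs(3)[OF sn(1)] by blast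
    have "x \<noteq> bxor x s"
    proof
      assume "x = bxor x s"
      then have "bxor x (bxor x s) = bxor x x"
        by simp
      then show False
        using bxor_bxor[of x s] bxor_self len[OF x(1)] sn by simp
    qed
    moreover have "h x = h (bxor x s)"
      using s len x by (auto simp: simon_function_def)
    ultimately show "\<exists>x\<in>set xs. \<exists>y\<in>set xs. x \<noteq> y \<and> hash (f (w x)) = hash (f (w y))"
      using x h len by metis
  next
    fix f assume "f \<in> snd Pr"
    then obtain h where "no_fun n h" and h: "\<And>x. length x = n \<Longrightarrow> hash (f (w x)) = h x"
      using no by force
    then have "inj_on h (bits n)"
      by (simp add: no_fun_def bij_betw_def)
    then have "inj_on h (set xs)"
      using xs(1) by (rule inj_on_subset)
    then show "inj_on (\<lambda>x. hash (f (w x))) (set xs)"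
      using h len by (simp add: inj_on_def)
  qed (use w val len in auto)
  then have "ereal_of_enat (query_complexity (bits k) (bits l) basis_op Pr) \<le> ereal_of_enat (enat (length xs))"
    by (simp only: ereal_of_enat_le_iff)
  also have "\<dots> \<le> ereal (3 * 2 powr (real n / 2))"
    using xs(2) by simp
  finally show ?thesis .
qed

subsection \<open>Fourier sampling\<close>

text \<open>The character \<open>(-1)^(x . y)\<close> of the group of bit strings, where
  \<open>x . y\<close> is the inner product modulo 2.\<close>

fun chi :: "bool list \<Rightarrow> bool list \<Rightarrow> real" where
  "chi (a # x) (b # y) = (if a \<and> b then - 1 else 1) * chi x y"
| "chi _ _ = 1"

lemma chi_cases: "chi x y = 1 \<or> chi x y = - 1"
  by (induction x y rule: chi.induct) auto

lemma chi_square [simp]: "chi x y * chi x y = 1" "\<bar>chi x y\<bar> = 1"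
  using chi_cases[of x y] by auto

lemma chi_zeros [simp]: "chi (zeros k) y = 1"
proof (induction k arbitrary: y)
  case (Suc k)
  then show ?case
    by (cases y) (auto simp: zeros_def)
qed (simp add: zeros_def)

lemma chi_bxor: "length x = length y \<Longrightarrow> length y = length z \<Longrightarrow> chi (bxor x y) z = chi x z * chi y z"
  by (induction x y z rule: list_induct3) (auto simp: bxor_def)

lemma sum_bits_Suc: "(\<Sum>y\<in>bits (Suc k). f y) = (\<Sum>y\<in>bits k. f (True # y) + f (False # y))"
proof -
  have "bits (Suc k) = (#) True ` bits k \<union> (#) False ` bits k"
    by (auto simp: bits_def length_Suc_conv image_iff)
  then have "(\<Sum>y\<in>bits (Suc k). f y) = (\<Sum>y\<in>(#) True ` bits k. f y) + (\<Sum>y\<in>(#) False ` bits k. f y)"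
    by (simp only:) (rule sum.union_disjoint, auto)
  then show ?thesis
    by (simp add: sum.reindex sum.distrib)
qed

lemma chi_orthogonal:
  "length x = k \<Longrightarrow> length x' = k \<Longrightarrow> (\<Sum>y\<in>bits k. chi x y * chi x' y) = (if x = x' then 2 ^ k else 0)"
proof (induction k arbitrary: x x')
  case 0
  have "bits 0 = {[]}"
    by (auto simp: bits_def)
  then show ?case
    using 0 by simp
next
  case (Suc k)
  then obtain a u a' u' where x: "x = a # u" "x' = a' # u'" "length u = k" "length u' = k"
    by (auto simp: length_Suc_conv)
  have "(\<Sum>y\<in>bits (Suc k). chi x y * chi x' y) =
      (1 + (if a = a' then 1 else - 1)) * (\<Sum>y\<in>bits k. chi u y * chi u' y)"
    unfolding sum_bits_Suc sum_distrib_left x by (intro sum.cong) auto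
  then show ?case
    using Suc.IH[OF x(3,4)] x by auto
qed

text \<open>\<open>1 + chi s y\<close> is twice the indicator of the kernel, and the nontrivial
  character \<open>chi s\<close> sums to zero.\<close>

lemma card_chi_kernel:
  assumes "length s = k" "s \<noteq> zeros k"
  shows "2 * real (card {y \<in> bits k. chi s y = 1}) = 2 ^ k"
proof -
  have "2 * real (card {y \<in> bits k. chi s y = 1}) = (\<Sum>y\<in>{y \<in> bits k. chi s y = 1}. 2)"
    by simp
  also have "\<dots> = (\<Sum>y\<in>bits k. 1 + chi s y * chi (zeros k) y)"
  proof (rule sum.mono_neutral_cong_left)
    show "\<forall>y\<in>bits k - {y \<in> bits k. chi s y = 1}. 1 + chi s y * chi (zeros k) y = 0"
    proof
      fix y assume "y \<in> bits k - {y \<in> bits k. chi s y = 1}"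
      then show "1 + chi s y * chi (zeros k) y = 0"
        using chi_cases[of s y] by auto
    qed
  qed auto
  also have "\<dots> = 2 ^ k"
    unfolding sum.distrib using chi_orthogonal[OF assms(1), of "zeros k"] assms(2) by simp
  finally show ?thesis .
qed

definition hadamard :: "nat \<Rightarrow> (bool list \<times> bool list, bool list \<times> bool list) operator" where
  "hadamard k = (\<lambda>(y, z') (x, z). if z = z' then of_real (chi x y / sqrt (2 ^ k)) else 0)"

lemma hadamard_isometry: "is_isometry (bits k \<times> bits l) (bits k \<times> bits l) (hadamard k)"
  unfolding is_isometry_def
proof (intro ballI)
  fix p p' assume "p \<in> bits k \<times> bits l" "p' \<in> bits k \<times> bits l"
  then obtain x z x' z' where p: "p = (x, z)" "p' = (x', z')" "length x = k" "length x' = k" "length z = l"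
    by auto
  have "(\<Sum>q\<in>bits k \<times> bits l. cnj (hadamard k q p) * hadamard k q p') =
      (\<Sum>y\<in>bits k. \<Sum>v\<in>bits l. if v = z then (if z = z' then of_real (chi x y * chi x' y / 2 ^ k) else 0) else 0)"
    unfolding sum.cartesian_product p
    by (intro sum.cong) (auto simp: hadamard_def simp flip: of_real_mult of_real_divide)
  also have "\<dots> = (if z = z' then of_real ((\<Sum>y\<in>bits k. chi x y * chi x' y) / 2 ^ k) else 0)"
    using p by (simp add: sum_divide_distrib)
  finally show "(\<Sum>q\<in>bits k \<times> bits l. cnj (hadamard k q p) * hadamard k q p') = (if p = p' then 1 else 0)"
    using p by (simp add: chi_orthogonal)
qed

lemma xor_oracle_isometry:
  assumes "\<And>x. length x = k \<Longrightarrow> length (f x) = l"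
  shows "is_isometry (bits k \<times> bits l) (bits k \<times> bits l) (xor_oracle f)"
  unfolding xor_oracle_def
proof (rule is_isometry_basis_op)
  have "z = z'" if "length x = k" "length z = l" "length z' = l" "bxor z (f x) = bxor z' (f x)" for x z z'
  proof -
    have "bxor (bxor z (f x)) (f x) = z" "bxor (bxor z' (f x)) (f x) = z'"
      using that(1-3) assms by (simp_all add: bxor_bxor_right)
    then show ?thesis
      using that(4) by metis
  qed
  then show "inj_on (\<lambda>(x, z). (x, bxor z (f x))) (bits k \<times> bits l)"
    by (auto simp: inj_on_def)
qed (use assms in auto)

lemma apply_xor_oracle:
  assumes "\<And>x. length x = k \<Longrightarrow> length (f x) = l" "length x = k" "length z = l"
  shows "apply_op (bits k \<times> bits l) (xor_oracle f) \<psi> (x, z) = \<psi> (x, bxor z (f x))"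
proof -
  have iff: "(x, z) = (x', bxor z' (f x')) \<longleftrightarrow> (x', z') = (x, bxor z (f x))" if "length z' = l" "length x' = k" for x' z'
  proof (cases "x' = x")
    case True
    have "bxor (bxor z (f x)) (f x) = z" "bxor (bxor z' (f x)) (f x) = z'"
      using that assms by (simp_all add: bxor_bxor_right)
    then have "z = bxor z' (f x) \<longleftrightarrow> z' = bxor z (f x)"
      by metis
    then show ?thesis
      using True by simp
  qed simp
  have "apply_op (bits k \<times> bits l) (xor_oracle f) \<psi> (x, z) =
      (\<Sum>p\<in>bits k \<times> bits l. if p = (x, bxor z (f x)) then \<psi> p else 0)"
    unfolding apply_op_def
  proof (rule sum.cong[OF refl])
    fix p assume "p \<in> bits k \<times> bits l"
    then obtain x' z' where p: "p = (x', z')" "length x' = k" "length z' = l"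
      by auto
    show "xor_oracle f (x, z) p * \<psi> p = (if p = (x, bxor z (f x)) then \<psi> p else 0)"
      unfolding p(1) xor_oracle_def basis_op_def prod.case iff[OF p(3,2)] by simp
  qed
  then show ?thesis
    using assms by simp
qed

lemma bxor_eq_zeros_iff: "length x = n \<Longrightarrow> length y = n \<Longrightarrow> bxor x y = zeros n \<longleftrightarrow> x = y"
  by (auto simp: list_eq_iff_nth_eq)

lemma take_bxor: "take q (bxor x y) = bxor (take q x) (take q y)"
  by (simp add: bxor_def take_map take_zip)

lemma of_bool_all_less: "of_bool (\<forall>j<t. P j) = (\<Prod>j<t. of_bool (P j) :: real)" for t :: nat
  by (induction t) (auto simp: less_Suc_eq)

text \<open>One query, with the garbage part of the output register in the uniform superposition so that
  the garbage leaves no trace, followed by a Hadamard transform of the input register.\<close>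

locale simon_sampling =
  fixes n k l q :: nat and w :: "bool list \<Rightarrow> bool list" and pr :: "bool list"
  assumes w: "\<And>x. length x = n \<Longrightarrow> length (w x) = k" "inj_on w (bits n)"
    and w_bxor: "\<And>x y. length x = n \<Longrightarrow> length y = n \<Longrightarrow> w (bxor x y) = bxor (w x) (w y)"
    and q: "q = length pr + n" "q \<le> l"
begin

definition start :: "(bool list \<times> bool list) state" where
  "start = (\<lambda>(x, z). of_bool (x \<in> w ` bits n \<and> take q z = zeros q) / of_real (sqrt (2 ^ n * 2 ^ (l - q))))"

lemma card_take: "length u = q \<Longrightarrow> card {z \<in> bits l. take q z = u} = 2 ^ (l - q)"
proof -
  assume u: "length u = q"
  have "{z \<in> bits l. take q z = u} = (@) u ` bits (l - q)"
  proof
    show "{z \<in> bits l. take q z = u} \<subseteq> (@) u ` bits (l - q)"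
    proof
      fix z assume "z \<in> {z \<in> bits l. take q z = u}"
      then have "z = u @ drop q z" "length (drop q z) = l - q"
        by auto
      then show "z \<in> (@) u ` bits (l - q)"
        by (metis bits_iff image_eqI)
    qed
  qed (use u q in auto)
  moreover have "inj_on ((@) u) (bits (l - q))"
    by (simp add: inj_on_def)
  ultimately show ?thesis
    by (simp add: card_image)
qed

lemma unit_start: "unit_state (bits k \<times> bits l) start"
proof -
  have "(\<Sum>p\<in>bits k \<times> bits l. (cmod (start p))\<^sup>2) =
      (\<Sum>p\<in>w ` bits n \<times> {z \<in> bits l. take q z = zeros q}. 1 / (2 ^ n * 2 ^ (l - q)))"
    by (rule sum.mono_neutral_cong_right) (use w in \<open>auto simp: start_def norm_divide power_divide\<close>)
  also have "\<dots> = 1"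
    by (simp add: card_cartesian_product card_image[OF w(2)] card_take[of "zeros q", simplified])
  finally show ?thesis
    by (simp add: unit_state_def)
qed

definition sample :: "input \<Rightarrow> (bool list \<times> bool list) state" where
  "sample f = apply_op (bits k \<times> bits l) (hadamard k) (apply_op (bits k \<times> bits l) (xor_oracle f) start)"

context
  fixes f h :: input
  assumes f: "\<And>x. length x = k \<Longrightarrow> length (f x) = l"
    and fh: "\<And>x. length x = n \<Longrightarrow> take q (f (w x)) = pr @ h x"
    and h: "\<And>x. length x = n \<Longrightarrow> length (h x) = n"
begin

text \<open>The start state depends on the output register only through its first \<open>q\<close>
  bits, which hold \<open>pr\<close> and \<open>h\<close>. The garbage XORed into the rest therefore
  leaves the amplitude unchanged.\<close>

lemma sample_eq:
  assumes "length y = k" "length z = l"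
  shows "sample f (y, z) = of_real ((\<Sum>x\<in>{x \<in> bits n. take q z = pr @ h x}. chi (w x) y) /
    (sqrt (2 ^ n * 2 ^ (l - q)) * sqrt (2 ^ k)))"
proof -
  let ?c = "sqrt (2 ^ n * 2 ^ (l - q)) * sqrt (2 ^ k) :: real"
  have "sample f (y, z) = (\<Sum>x\<in>bits k. \<Sum>z'\<in>bits l. if z' = z then of_real (chi x y / sqrt (2 ^ k)) * start (x, bxor z (f x)) else 0)"
    unfolding sample_def apply_op_def[of "bits k \<times> bits l" "hadamard k"] sum.cartesian_product
    by (intro sum.cong) (auto simp: hadamard_def apply_xor_oracle[OF f])
  also have "\<dots> = (\<Sum>x\<in>bits k. of_real (chi x y / sqrt (2 ^ k)) * start (x, bxor z (f x)))"
    using assms by simp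
  also have "\<dots> = (\<Sum>x\<in>w ` {x \<in> bits n. take q z = pr @ h x}. of_real (chi x y / ?c))"
  proof (rule sum.mono_neutral_cong_right)
    have key: "take q (bxor z (f (w x))) = zeros q \<longleftrightarrow> take q z = pr @ h x" if x: "length x = n" for x
      using fh[OF x] q h[OF x] assms bxor_eq_zeros_iff[of "take q z" q "pr @ h x"] by (simp add: take_bxor)
    show "\<forall>x\<in>bits k - w ` {x \<in> bits n. take q z = pr @ h x}.
        of_real (chi x y / sqrt (2 ^ k)) * start (x, bxor z (f x)) = 0"
      using key by (auto simp: start_def)
    show "of_real (chi x y / sqrt (2 ^ k)) * start (x, bxor z (f x)) = of_real (chi x y / ?c)"
      if "x \<in> w ` {x \<in> bits n. take q z = pr @ h x}" for x
      using that key by (auto simp: start_def)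
  qed (use w in auto)
  also have "\<dots> = (\<Sum>x\<in>{x \<in> bits n. take q z = pr @ h x}. of_real (chi (w x) y / ?c))"
    by (subst sum.reindex[OF inj_on_subset[OF w(2)]]) auto
  finally show ?thesis
    by (simp add: sum_divide_distrib)
qed

lemma sum_sample: "(\<Sum>p\<in>bits k \<times> bits l. (cmod (sample f p))\<^sup>2) = 1"
proof -
  have "vnorm (bits k \<times> bits l) (sample f) = 1"
    using unit_start unfolding sample_def unit_state_vnorm
    by (simp add: vnorm_isometry[OF _ hadamard_isometry] vnorm_isometry[OF _ xor_oracle_isometry[OF f]])
  then show ?thesis
    by (simp flip: vnorm_power2)
qed

text \<open>The points compatible with \<open>z\<close> are permuted by adding \<open>s\<close>,
  which multiplies their character sum by \<open>chi (w s) y\<close>. A nonzero sum forces this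
  factor to be 1.\<close>

lemma sample_yes:
  assumes s: "simon_function n s h" and y: "length y = k" "length z = l" and "sample f (y, z) \<noteq> 0"
  shows "chi (w s) y = 1"
proof -
  let ?X = "{x \<in> bits n. take q z = pr @ h x}"
  have sn: "length s = n"
    using s by (simp add: simon_function_def)
  have "h (bxor x s) = h x" if "length x = n" for x
  proof -
    have "h x = h (bxor x s)"
      using s that sn by (simp add: simon_function_def)
    then show ?thesis ..
  qed
  then have "(\<Sum>x\<in>?X. chi (w x) y) = (\<Sum>x\<in>?X. chi (w (bxor x s)) y)"
    using sn by (intro sum.reindex_bij_witness[of _ "\<lambda>x. bxor x s" "\<lambda>x. bxor x s"]) (auto simp: bxor_bxor_right)
  also have "\<dots> = (\<Sum>x\<in>?X. chi (w x) y * chi (w s) y)"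
    using w sn y by (intro sum.cong) (auto simp: w_bxor chi_bxor)
  finally have "(\<Sum>x\<in>?X. chi (w x) y) = (\<Sum>x\<in>?X. chi (w x) y) * chi (w s) y"
    unfolding sum_distrib_right .
  moreover have "(\<Sum>x\<in>?X. chi (w x) y) \<noteq> 0"
  proof
    assume z: "(\<Sum>x\<in>?X. chi (w x) y) = 0"
    have "sample f (y, z) = 0"
      unfolding sample_eq[OF y] z by simp
    then show False
      using assms(4) by simp
  qed
  ultimately show ?thesis
    by simp
qed

text \<open>At most one point is compatible with \<open>z\<close>, so the probability of
  \<open>(y, z)\<close> does not depend on \<open>y\<close>. Thus \<open>y\<close> is uniform, and a
  nontrivial character equals 1 on half of the group.\<close>

lemma sample_no:
  assumes h_bij: "no_fun n h" and s: "length s = n" "s \<noteq> zeros n"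
  shows "(\<Sum>(y, z)\<in>bits k \<times> bits l. of_bool (chi (w s) y = 1) * (cmod (sample f (y, z)))\<^sup>2) = 1 / 2"
proof -
  let ?X = "\<lambda>z. {x \<in> bits n. take q z = pr @ h x}"
  define c where "c = sqrt (2 ^ n * 2 ^ (l - q)) * sqrt (2 ^ k :: real)"
  define g where "g z = of_bool (?X z \<noteq> {}) / c\<^sup>2" for z
  have g: "(cmod (sample f (y, z)))\<^sup>2 = g z" if yz: "length y = k" "length z = l" for y z
  proof (cases "?X z = {}")
    case True
    then have "sample f (y, z) = 0"
      using sample_eq[OF yz] by (simp only: sum.empty) simp
    then show ?thesis
      using True by (simp add: g_def)
  next
    case False
    then obtain x where x: "x \<in> ?X z"
      by blast
    have "x' = x" if "x' \<in> ?X z" for x'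
      using x that h_bij by (auto simp: no_fun_def bij_betw_def inj_on_def)
    then have X: "?X z = {x}"
      using x by blast
    have "sample f (y, z) = of_real (chi (w x) y / c)"
      unfolding sample_eq[OF yz] X by (simp add: c_def)
    then show ?thesis
      using X by (simp add: g_def norm_divide power_divide power2_eq_square[of "chi _ _"])
  qed
  have total: "2 ^ k * (\<Sum>z\<in>bits l. g z) = 1"
  proof -
    have "1 = (\<Sum>y\<in>bits k. \<Sum>z\<in>bits l. (cmod (sample f (y, z)))\<^sup>2)"
      using sum_sample by (simp add: sum.cartesian_product case_prod_beta)
    also have "\<dots> = (\<Sum>y\<in>bits k. \<Sum>z\<in>bits l. g z)"
      by (intro sum.cong) (auto simp: g)
    finally show ?thesis
      by simp
  qed
  \<comment> \<open>\<open>w\<close> is additive and injective, so it maps only the zero string to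
    zero.\<close>
  have "w s \<noteq> zeros k"
  proof
    assume ws: "w s = zeros k"
    have "w (zeros n) = bxor (w s) (w s)"
      using w_bxor[OF s(1) s(1)] s(1) bxor_eq_zeros_iff[OF s(1) s(1)] by simp
    then have "w (zeros n) = w s"
      using ws w(1)[OF s(1)] bxor_eq_zeros_iff[of "w s" k "w s"] by simp
    then show False
      using w(2) s by (auto simp: inj_on_def)
  qed
  then have half: "2 * real (card {y \<in> bits k. chi (w s) y = 1}) = 2 ^ k"
    using w(1)[OF s(1)] by (intro card_chi_kernel)
  have "(\<Sum>(y, z)\<in>bits k \<times> bits l. of_bool (chi (w s) y = 1) * (cmod (sample f (y, z)))\<^sup>2) =
      (\<Sum>y\<in>bits k. \<Sum>z\<in>bits l. of_bool (chi (w s) y = 1) * g z)"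
    unfolding sum.cartesian_product by (intro sum.cong) (auto simp: g)
  also have "\<dots> = (\<Sum>y\<in>bits k. of_bool (chi (w s) y = 1)) * (\<Sum>z\<in>bits l. g z)"
    by (rule sum_product[symmetric])
  also have "(\<Sum>y\<in>bits k. of_bool (chi (w s) y = 1)) = real (card {y \<in> bits k. chi (w s) y = 1})"
    by (simp add: Int_def)
  also have "real (card {y \<in> bits k. chi (w s) y = 1}) * (\<Sum>z\<in>bits l. g z) = 1 / 2"
  proof -
    have "2 * (real (card {y \<in> bits k. chi (w s) y = 1}) * (\<Sum>z\<in>bits l. g z)) = 2 ^ k * (\<Sum>z\<in>bits l. g z)"
      by (simp only: mult.assoc[symmetric] half)
    then show ?thesis
      using total by linarith
  qed
  finally show ?thesis .
qed

end

text \<open>The error is one-sided. The algorithm accepts if some nonzero \<open>s\<close> is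
  orthogonal to all samples, which is certain for YES inputs. For NO inputs each of fewer than
  \<open>2 ^ n\<close> strings survives with probability \<open>(1 / 2) ^ (n + 2)\<close>, hence at
  most 1/4 in total; with one sample less this union bound would give only 1/2.\<close>

theorem xor_query_complexity:
  fixes Pr :: promise_problem
  assumes val: "\<And>f x. f \<in> fst Pr \<union> snd Pr \<Longrightarrow> length x = k \<Longrightarrow> length (f x) = l"
    and yes: "\<And>f. f \<in> fst Pr \<Longrightarrow> \<exists>h. yes_fun n h \<and> (\<forall>x\<in>bits n. take q (f (w x)) = pr @ h x)"
    and no: "\<And>f. f \<in> snd Pr \<Longrightarrow> \<exists>h. no_fun n h \<and> (\<forall>x\<in>bits n. take q (f (w x)) = pr @ h x)"
  shows "query_complexity (bits k \<times> bits l) (bits k \<times> bits l) xor_oracle Pr \<le> enat (n + 2)"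
proof -
  let ?C = "bits k \<times> bits l" and ?T = "n + 2"
  define orth where "orth ys s \<longleftrightarrow> (\<forall>j<?T. chi (w s) (fst (ys ! j)) = 1)" for ys :: "(bool list \<times> bool list) list" and s
  define acc where "acc ys \<longleftrightarrow> (\<exists>s\<in>bits n - {zeros n}. orth ys s)" for ys :: "(bool list \<times> bool list) list"
  obtain c :: "nat \<Rightarrow> bool list \<times> bool list" where c: "bij_betw c {..<card ?C} ?C"
    using ex_bij_betw_nat_finite[of ?C] by (auto simp: lessThan_atLeast0)
  interpret product_algorithm ?C ?C ?C ?T "\<lambda>_. start" "\<lambda>_. hadamard k" acc c "card ?C"
    by unfold_locales (use unit_start hadamard_isometry c in auto)
  let ?p = "\<lambda>f ys. \<Prod>j<?T. (cmod (sample f (ys ! j)))\<^sup>2"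
  have prob: "accept_prob ?C ?C ?T alg (xor_oracle f) = (\<Sum>ys\<in>histories ?C ?T. of_bool (acc ys) * ?p f ys)" for f
    unfolding accept_prob_eq by (simp add: amp_def sample_def)
  have fin_h: "finite (histories ?C ?T)"
    unfolding histories_def by (rule finite_lists_length_eq) simp
  have "accept_prob ?C ?C ?T alg (xor_oracle f) = 1" if f: "f \<in> fst Pr" for f
  proof -
    obtain h s where s: "simon_function n s h" and fh: "\<And>x. length x = n \<Longrightarrow> take q (f (w x)) = pr @ h x"
      using yes[OF f] unfolding yes_fun_def by auto
    have h: "\<And>x. length x = n \<Longrightarrow> length (h x) = n"
      using s by (auto simp: simon_function_def)
    note val_f = val[of f, OF UnI1[OF f]]
    have "acc ys \<or> ?p f ys = 0" if ys: "ys \<in> histories ?C ?T" for ys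
    proof (rule disjCI)
      assume nz: "?p f ys \<noteq> 0"
      have "chi (w s) (fst (ys ! j)) = 1" if j: "j < ?T" for j
      proof -
        have "ys ! j \<in> ?C"
          using ys j unfolding histories_def by (metis (mono_tags, lifting) mem_Collect_eq nth_mem subset_iff)
        moreover have "sample f (ys ! j) \<noteq> 0"
        proof
          assume "sample f (ys ! j) = 0"
          then have "\<exists>j\<in>{..<?T}. (cmod (sample f (ys ! j)))\<^sup>2 = 0"
            using j by (intro bexI[of _ j]) auto
          then have "?p f ys = 0"
            by (intro prod_zero) auto
          then show False
            using nz by simp
        qed
        ultimately show ?thesis
          using sample_yes[of f h s "fst (ys ! j)" "snd (ys ! j)", OF val_f fh h s] by auto
      qed
      then show "acc ys"
        using s unfolding acc_def orth_def simon_function_def by blast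
    qed
    then have "accept_prob ?C ?C ?T alg (xor_oracle f) = (\<Sum>ys\<in>histories ?C ?T. ?p f ys)"
      unfolding prob by (intro sum.cong) auto
    also have "\<dots> = (\<Prod>j<?T. \<Sum>p\<in>?C. (cmod (sample f p))\<^sup>2)"
      by (rule sum_histories_prod)
    also have "\<dots> = 1"
      by (simp add: sum_sample[of f h, OF val_f fh h])
    finally show ?thesis .
  qed
  moreover have "accept_prob ?C ?C ?T alg (xor_oracle f) \<le> 1 / 3" if f: "f \<in> snd Pr" for f
  proof -
    obtain h where bij: "no_fun n h" and fh: "\<And>x. length x = n \<Longrightarrow> take q (f (w x)) = pr @ h x"
      using no[OF f] by auto
    have h: "\<And>x. length x = n \<Longrightarrow> length (h x) = n"
      using bij by (auto simp: no_fun_def bij_betw_def)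
    note val_f = val[of f, OF UnI2[OF f]]
    have "of_bool (acc ys) \<le> (\<Sum>s\<in>bits n - {zeros n}. of_bool (orth ys s) :: real)" for ys
    proof (cases "acc ys")
      case True
      then obtain s where "s \<in> bits n - {zeros n}" "orth ys s"
        unfolding acc_def by blast
      then show ?thesis
        using member_le_sum[of s "bits n - {zeros n}" "\<lambda>s. of_bool (orth ys s) :: real"] by simp
    qed (simp add: sum_nonneg)
    then have "accept_prob ?C ?C ?T alg (xor_oracle f) \<le>
        (\<Sum>ys\<in>histories ?C ?T. (\<Sum>s\<in>bits n - {zeros n}. of_bool (orth ys s)) * ?p f ys)"
      unfolding prob by (intro sum_mono mult_right_mono prod_nonneg) auto
    also have "\<dots> = (\<Sum>s\<in>bits n - {zeros n}. \<Sum>ys\<in>histories ?C ?T. of_bool (orth ys s) * ?p f ys)"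
      unfolding sum_distrib_right by (rule sum.swap)
    also have "\<dots> = (\<Sum>s\<in>bits n - {zeros n}. (1 / 2) ^ ?T)"
    proof (rule sum.cong[OF refl])
      fix s assume "s \<in> bits n - {zeros n}"
      then have s: "length s = n" "s \<noteq> zeros n"
        by auto
      let ?g = "\<lambda>p. of_bool (chi (w s) (fst p) = 1) * (cmod (sample f p))\<^sup>2"
      have "of_bool (orth ys s) = (\<Prod>j<?T. of_bool (chi (w s) (fst (ys ! j)) = 1) :: real)" for ys
        unfolding orth_def by (rule of_bool_all_less)
      then have "(\<Sum>ys\<in>histories ?C ?T. of_bool (orth ys s) * ?p f ys) =
          (\<Sum>ys\<in>histories ?C ?T. \<Prod>j<?T. ?g (ys ! j))"
        by (simp only: prod.distrib)
      also have "\<dots> = (\<Prod>j<?T. \<Sum>p\<in>?C. ?g p)"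
        by (rule sum_histories_prod)
      also have "(\<Sum>p\<in>?C. ?g p) = 1 / 2"
        using sample_no[of f h s, OF val_f fh h bij s] by (simp add: case_prod_beta)
      finally show "(\<Sum>ys\<in>histories ?C ?T. of_bool (orth ys s) * ?p f ys) = (1 / 2) ^ ?T"
        by simp
    qed
    also have "\<dots> = card (bits n - {zeros n}) * (1 / 2) ^ ?T"
      by simp
    also have "\<dots> \<le> real (card (bits n)) * (1 / 2) ^ ?T"
      using card_mono[OF finite_bits Diff_subset, of n "{zeros n}"]
      by (intro mult_right_mono of_nat_mono) auto
    also have "\<dots> = 1 / 4"
      by (simp add: power_add power_divide field_simps)
    finally show ?thesis
      by simp
  qed
  ultimately have "solves ?C ?C xor_oracle Pr ?T alg"
    unfolding solves_def using is_query_alg by auto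
  then show ?thesis
    by (rule query_complexity_le)
qed

end

subsection \<open>The three problems\<close>

lemma bxor_append: "length x = length x' \<Longrightarrow> bxor (x @ y) (x' @ y') = bxor x x' @ bxor y y'"
  by (simp add: bxor_def)

lemma bxor_Cons: "bxor (a # x) (b # y) = (a \<noteq> b) # bxor x y"
  by (simp add: bxor_def)

lemma bxor_zeros: "bxor (zeros n) (zeros n) = zeros n"
  by (rule bxor_self) simp

lemma yes_fun_length: "yes_fun n h \<Longrightarrow> length x = n \<Longrightarrow> length (h x) = n"
  by (auto simp: yes_fun_def simon_function_def)

lemma no_fun_length: "no_fun n h \<Longrightarrow> length x = n \<Longrightarrow> length (h x) = n"
  by (auto simp: no_fun_def bij_betw_def)

lemma garbage_simonE:
  assumes "f \<in> fst (garbage_simon n) \<union> snd (garbage_simon n)" "length x = n"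
  shows "length (f x) = 3 * n"
  using assms yes_fun_length no_fun_length by (fastforce simp: garbage_simon_def garbage_fun_def)

lemma permutation_problem_length:
  "f \<in> fst (perm_garbage_simon n) \<union> snd (perm_garbage_simon n) \<Longrightarrow> length x = 3 * n + 1 \<Longrightarrow>
     length (f x) = 3 * n + 1"
  "f \<in> fst (compressed_perm_garbage_simon n) \<union> snd (compressed_perm_garbage_simon n) \<Longrightarrow>
     length x = 2 * n + 2 \<Longrightarrow> length (f x) = 2 * n + 2"
  by (auto simp: perm_garbage_simon_def perm_garbage_instance_def compressed_perm_garbage_simon_def
      compressed_instance_def permutes_bits_length)

lemma garbage_simon_head:
  "f \<in> fst (garbage_simon n) \<Longrightarrow> \<exists>h. yes_fun n h \<and> (\<forall>x\<in>bits n. take n (f x) = [] @ h x)"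
  "f \<in> snd (garbage_simon n) \<Longrightarrow> \<exists>h. no_fun n h \<and> (\<forall>x\<in>bits n. take n (f x) = [] @ h x)"
proof -
  have head: "\<forall>x\<in>bits n. take n (garbage_fun h r x) = [] @ h x" if "\<And>x. length x = n \<Longrightarrow> length (h x) = n" for h r
    using that by (simp add: garbage_fun_def)
  show "\<exists>h. yes_fun n h \<and> (\<forall>x\<in>bits n. take n (f x) = [] @ h x)" if f: "f \<in> fst (garbage_simon n)"
  proof -
    obtain h r where "yes_fun n h" "f = garbage_fun h r"
      using f unfolding garbage_simon_def by auto
    then show ?thesis
      using head yes_fun_length by blast
  qed
  show "\<exists>h. no_fun n h \<and> (\<forall>x\<in>bits n. take n (f x) = [] @ h x)" if f: "f \<in> snd (garbage_simon n)"
  proof -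
    obtain h r where "no_fun n h" "f = garbage_fun h r"
      using f unfolding garbage_simon_def by auto
    then show ?thesis
      using head no_fun_length by blast
  qed
qed

lemma perm_garbage_head:
  "P \<in> fst (perm_garbage_simon n) \<Longrightarrow> \<exists>h. yes_fun n h \<and>
      (\<forall>x\<in>bits n. take (Suc n) (P (False # x @ zeros n @ zeros n)) = [True] @ h x)"
  "P \<in> snd (perm_garbage_simon n) \<Longrightarrow> \<exists>h. no_fun n h \<and>
      (\<forall>x\<in>bits n. take (Suc n) (P (False # x @ zeros n @ zeros n)) = [True] @ h x)"
proof -
  have head: "\<forall>x\<in>bits n. take (Suc n) (P (False # x @ zeros n @ zeros n)) = [True] @ h x"
    if "perm_garbage_instance n h P" "\<And>x. length x = n \<Longrightarrow> length (h x) = n" for h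
    using that by (auto simp: perm_garbage_instance_def)
  show "\<exists>h. yes_fun n h \<and>
      (\<forall>x\<in>bits n. take (Suc n) (P (False # x @ zeros n @ zeros n)) = [True] @ h x)"
    if "P \<in> fst (perm_garbage_simon n)"
    using that head yes_fun_length unfolding perm_garbage_simon_def fst_conv by blast
  show "\<exists>h. no_fun n h \<and>
      (\<forall>x\<in>bits n. take (Suc n) (P (False # x @ zeros n @ zeros n)) = [True] @ h x)"
    if "P \<in> snd (perm_garbage_simon n)"
    using that head no_fun_length unfolding perm_garbage_simon_def snd_conv by blast
qed

lemma compressed_head:
  "P \<in> fst (compressed_perm_garbage_simon n) \<Longrightarrow> \<exists>h. yes_fun n h \<and>
      (\<forall>x\<in>bits n. take (Suc n) (P (False # x @ [False] @ zeros n)) = [True] @ h x)"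
  "P \<in> snd (compressed_perm_garbage_simon n) \<Longrightarrow> \<exists>h. no_fun n h \<and>
      (\<forall>x\<in>bits n. take (Suc n) (P (False # x @ [False] @ zeros n)) = [True] @ h x)"
proof -
  have head: "\<forall>x\<in>bits n. take (Suc n) (P (False # x @ [False] @ zeros n)) = [True] @ h x"
    if "compressed_instance n h P" "\<And>x. length x = n \<Longrightarrow> length (h x) = n" for h
    using that by (auto simp: compressed_instance_def)
  show "\<exists>h. yes_fun n h \<and>
      (\<forall>x\<in>bits n. take (Suc n) (P (False # x @ [False] @ zeros n)) = [True] @ h x)"
    if "P \<in> fst (compressed_perm_garbage_simon n)"
    using that head yes_fun_length unfolding compressed_perm_garbage_simon_def fst_conv by blast
  show "\<exists>h. no_fun n h \<and>
      (\<forall>x\<in>bits n. take (Suc n) (P (False # x @ [False] @ zeros n)) = [True] @ h x)"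
    if "P \<in> snd (compressed_perm_garbage_simon n)"
    using that head no_fun_length unfolding compressed_perm_garbage_simon_def snd_conv by blast
qed

lemma Q_XOR_garbage: "Q_XOR n (3 * n) (garbage_simon n) \<le> enat (n + 2)"
proof -
  interpret simon_sampling n n "3 * n" n "\<lambda>x. x" "[]"
    by unfold_locales auto
  show ?thesis
    unfolding Q_XOR_def by (rule xor_query_complexity) (fact garbage_simonE garbage_simon_head)+
qed

lemma Q_XOR_perm: "Q_XOR (3 * n + 1) (3 * n + 1) (perm_garbage_simon n) \<le> enat (n + 2)"
proof -
  interpret simon_sampling n "3 * n + 1" "3 * n + 1" "Suc n" "\<lambda>x. False # x @ zeros n @ zeros n" "[True]"
    by unfold_locales (auto simp: bxor_append bxor_Cons bxor_zeros inj_on_def)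
  show ?thesis
    unfolding Q_XOR_def
    by (rule xor_query_complexity) (fact permutation_problem_length(1) perm_garbage_head)+
qed

lemma Q_XOR_compressed: "Q_XOR (2 * n + 2) (2 * n + 2) (compressed_perm_garbage_simon n) \<le> enat (n + 2)"
proof -
  interpret simon_sampling n "2 * n + 2" "2 * n + 2" "Suc n" "\<lambda>x. False # x @ [False] @ zeros n" "[True]"
    by unfold_locales (auto simp: bxor_append bxor_Cons bxor_zeros inj_on_def)
  show ?thesis
    unfolding Q_XOR_def
    by (rule xor_query_complexity) (fact permutation_problem_length(2) compressed_head)+
qed

section \<open>Upper bounds for the forward oracles\<close>

lemma erasing_oracle_eq: "erasing_oracle = basis_op" and in_place_oracle_eq: "in_place_oracle = basis_op"
  by (simp_all add: erasing_oracle_def[abs_def] in_place_oracle_def[abs_def])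

lemma collision_upper_bound:
  fixes Pr :: promise_problem and w :: "bool list \<Rightarrow> bool list"
  assumes "n \<ge> 1" "\<And>x. length x = n \<Longrightarrow> length (w x) = k"
    and val: "\<And>f x. f \<in> fst Pr \<union> snd Pr \<Longrightarrow> length x = k \<Longrightarrow> length (f x) = l"
    and yes: "\<And>f. f \<in> fst Pr \<Longrightarrow> \<exists>h. yes_fun n h \<and> (\<forall>x\<in>bits n. take q (f (w x)) = pr @ h x)"
    and no: "\<And>f. f \<in> snd Pr \<Longrightarrow> \<exists>h. no_fun n h \<and> (\<forall>x\<in>bits n. take q (f (w x)) = pr @ h x)"
  shows "ereal_of_enat (query_complexity (bits k) (bits l) basis_op Pr) \<le> ereal (3 * 2 powr (real n / 2))"
proof (rule collision_query_complexity[where hash = "\<lambda>y. drop (length pr) (take q y)"])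
  have drop: "\<forall>x\<in>bits n. drop (length pr) (take q (f (w x))) = h x"
    if "\<forall>x\<in>bits n. take q (f (w x)) = pr @ h x" for f h
    using that by simp
  show "\<exists>h. yes_fun n h \<and> (\<forall>x\<in>bits n. drop (length pr) (take q (f (w x))) = h x)" if "f \<in> fst Pr" for f
    using yes[OF that] drop by blast
  show "\<exists>h. no_fun n h \<and> (\<forall>x\<in>bits n. drop (length pr) (take q (f (w x))) = h x)" if "f \<in> snd Pr" for f
    using no[OF that] drop by blast
qed (use assms in auto)

lemma Q_erase_le:
  assumes "n \<ge> 1"
  shows "ereal_of_enat (Q_erase n (3 * n) (garbage_simon n)) \<le> ereal (3 * 2 powr (real n / 2))"
  unfolding Q_erase_def erasing_oracle_eq
  by (rule collision_upper_bound[where w = "\<lambda>x. x" and q = n and pr = "[]"])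
    (assumption | fact assms garbage_simonE garbage_simon_head)+

lemma Q_IP_perm_le:
  assumes "n \<ge> 1"
  shows "ereal_of_enat (Q_IP (3 * n + 1) (perm_garbage_simon n)) \<le> ereal (3 * 2 powr (real n / 2))"
  unfolding Q_IP_def in_place_oracle_eq
  by (rule collision_upper_bound[where w = "\<lambda>x. False # x @ zeros n @ zeros n" and q = "Suc n" and pr = "[True]"])
    (fact assms permutation_problem_length(1) perm_garbage_head | simp)+

lemma Q_IP_compressed_le:
  assumes "n \<ge> 1"
  shows "ereal_of_enat (Q_IP (2 * n + 2) (compressed_perm_garbage_simon n)) \<le> ereal (3 * 2 powr (real n / 2))"
  unfolding Q_IP_def in_place_oracle_eq
  by (rule collision_upper_bound[where w = "\<lambda>x. False # x @ [False] @ zeros n" and q = "Suc n" and pr = "[True]"])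
    (fact assms permutation_problem_length(2) compressed_head | simp)+

section \<open>Lower bounds for the forward oracles\<close>

lemma perm_garbage_simonI:
  "yes_fun n h \<Longrightarrow> perm_garbage_instance n h P \<Longrightarrow> P \<in> fst (perm_garbage_simon n)"
  "no_fun n h \<Longrightarrow> perm_garbage_instance n h P \<Longrightarrow> P \<in> snd (perm_garbage_simon n)"
  unfolding perm_garbage_simon_def fst_conv snd_conv by blast+

lemma compressed_simonI:
  "yes_fun n h \<Longrightarrow> compressed_instance n h P \<Longrightarrow> P \<in> fst (compressed_perm_garbage_simon n)"
  "no_fun n h \<Longrightarrow> compressed_instance n h P \<Longrightarrow> P \<in> snd (compressed_perm_garbage_simon n)"
  unfolding compressed_perm_garbage_simon_def fst_conv snd_conv by blast+

text \<open>The two points of a coset differ in their first bit. Hence the first bit is an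
  admissible bit table, and the compressed values remain injective.\<close>

lemma hard_funs_inj: "h \<in> hard_funs n \<Longrightarrow> n \<ge> 1 \<Longrightarrow> length x = n \<Longrightarrow> length y = n \<Longrightarrow> h x = h y \<Longrightarrow>
    hd x = hd y \<Longrightarrow> x = y"
proof -
  assume h: "h \<in> hard_funs n" and n: "n \<ge> 1" and len: "length x = n" "length y = n"
    and eq: "h x = h y" "hd x = hd y"
  consider "h permutes bits n" | \<pi> s where "h = \<pi> \<circ> coset_rep s" "\<pi> permutes bits n" "length s = n" "hd s"
    using h by (auto simp: hard_funs_def)
  then show "x = y"
  proof cases
    case 1
    then show ?thesis
      using eq(1) permutes_inj[OF 1] by (simp add: inj_eq)
  next
    case 2
    then have "coset_rep s x = coset_rep s y"
      using eq(1) permutes_inj[of \<pi>] by (simp add: inj_eq)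
    then have "y = x \<or> y = bxor x s"
      using coset_rep_eq_iff[OF n 2(3,4) len] by simp
    moreover have "hd (bxor x s) \<noteq> hd x"
      using hd_bxor[of x s] len 2 n by fastforce
    ultimately show ?thesis
      using eq(2) by auto
  qed
qed

lemma perm_garbage_lower_bound:
  assumes n: "n \<ge> 1" and W: "wrapped_oracle A B dec lab emb J (3 * n + 1) (3 * n + 1)"
    and solves: "solves A B (wrapped_oracle.wrap dec emb J) (perm_garbage_simon n) T \<A>"
  shows "sqrt (2 ^ n) / 150 \<le> real T"
proof -
  interpret wrapped_oracle A B dec lab emb J "3 * n + 1" "3 * n + 1"
    by (rule W)
  \<comment> \<open>The decoy values \<open>e g x\<close> start with \<open>False\<close>, away from
    all genuine values, which start with \<open>True\<close>. The mask \<open>g\<close> occupies a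
    block that is zero in promised inputs.\<close>
  interpret permutation_family A B dec lab emb J "3 * n + 1" n "\<lambda>x. False # x @ zeros n @ zeros n"
    "\<lambda>x y z. True # y @ x @ z" "\<lambda>g x. False # x @ g @ zeros n" T \<A>
  proof unfold_locales
    show "is_query_alg A B T \<A>"
      using solves by (simp add: solves_def)
    show "inj_on (\<lambda>(x, z). True # h x @ x @ z) (bits n \<times> bits n)" if "h \<in> hard_funs n" for h
      using hard_funs_length[OF that] by (auto simp: inj_on_def)
  qed (use n in \<open>auto simp: inj_on_def\<close>)
  have inst: "P \<in> instances h r \<Longrightarrow> r \<in> bits n \<rightarrow> bits n \<Longrightarrow> perm_garbage_instance n h P" for P h r
    unfolding instances_def perm_garbage_instance_def by auto
  show ?thesis
  proof (rule permutation_lower_bound)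
    fix \<pi> r P assume "\<pi> permutes bits n" "r \<in> bits n \<rightarrow> bits n" "P \<in> instances \<pi> r"
    then have "P \<in> snd (perm_garbage_simon n)"
      by (intro perm_garbage_simonI(2) no_fun_permutes inst)
    then show "2 / 3 \<le> 1 - accept_prob A B T \<A> (wrap P)"
      using solves by (simp add: solves_def)
  next
    fix \<pi> s r P assume *: "\<pi> permutes bits n" "length s = n" "hd s" "r \<in> bits n \<rightarrow> bits n"
      "P \<in> instances (\<pi> \<circ> coset_rep s) r"
    have "P \<in> fst (perm_garbage_simon n)"
      by (rule perm_garbage_simonI(1)[OF yes_fun_coset_rep[OF n *(2,3,1)] inst[OF *(5,4)]])
    then show "2 / 3 \<le> accept_prob A B T \<A> (wrap P)"
      using solves by (simp add: solves_def)
  qed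
qed

lemma compressed_lower_bound:
  assumes n: "n \<ge> 1" and W: "wrapped_oracle A B dec lab emb J (2 * n + 2) (2 * n + 2)"
    and solves: "solves A B (wrapped_oracle.wrap dec emb J) (compressed_perm_garbage_simon n) T \<A>"
  shows "sqrt (2 ^ n) / 150 \<le> real T"
proof -
  interpret wrapped_oracle A B dec lab emb J "2 * n + 2" "2 * n + 2"
    by (rule W)
  \<comment> \<open>The first bit of \<open>x\<close> is the separator, and the last block still
    leaves \<open>n\<close> bits for the mask.\<close>
  interpret permutation_family A B dec lab emb J "2 * n + 2" n "\<lambda>x. False # x @ [False] @ zeros n"
    "\<lambda>x y z. True # y @ [hd x] @ z" "\<lambda>g x. False # x @ [False] @ g" T \<A>
  proof unfold_locales
    show "is_query_alg A B T \<A>"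
      using solves by (simp add: solves_def)
    show "inj_on (\<lambda>(x, z). True # h x @ [hd x] @ z) (bits n \<times> bits n)" if "h \<in> hard_funs n" for h
      using hard_funs_length[OF that] hard_funs_inj[OF that n] by (auto simp: inj_on_def)
  qed (use n in \<open>auto simp: inj_on_def\<close>)
  have inst: "compressed_instance n h P"
    if "P \<in> instances h r" "r \<in> bits n \<rightarrow> bits n" "h \<in> hard_funs n" for P h r
  proof -
    have "inj_on (\<lambda>x. (h x, hd x)) (bits n)"
      using hard_funs_inj[OF that(3) n] by (auto simp: inj_on_def)
    then show ?thesis
      using that(1,2) unfolding instances_def compressed_instance_def by blast
  qed
  show ?thesis
  proof (rule permutation_lower_bound)
    fix \<pi> r P assume *: "\<pi> permutes bits n" "r \<in> bits n \<rightarrow> bits n" "P \<in> instances \<pi> r"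
    then have "\<pi> \<in> hard_funs n"
      by (simp add: hard_funs_def)
    then have "P \<in> snd (compressed_perm_garbage_simon n)"
      using * by (intro compressed_simonI(2) no_fun_permutes inst)
    then show "2 / 3 \<le> 1 - accept_prob A B T \<A> (wrap P)"
      using solves by (simp add: solves_def)
  next
    fix \<pi> s r P assume *: "\<pi> permutes bits n" "length s = n" "hd s" "r \<in> bits n \<rightarrow> bits n"
      "P \<in> instances (\<pi> \<circ> coset_rep s) r"
    then have hard: "\<pi> \<circ> coset_rep s \<in> hard_funs n"
      unfolding hard_funs_def by auto
    have "P \<in> fst (compressed_perm_garbage_simon n)"
      by (rule compressed_simonI(1)[OF yes_fun_coset_rep[OF n *(2,3,1)] inst[OF *(5,4) hard]])
    then show "2 / 3 \<le> accept_prob A B T \<A> (wrap P)"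
      using solves by (simp add: solves_def)
  qed
qed

lemma sqrt_power_eq: "1 / 150 * 2 powr (real n / 2) = sqrt (2 ^ n) / 150"
proof -
  have "2 powr (real n / 2) = (2 powr real n) powr (1 / 2)"
    by (simp add: powr_powr)
  also have "\<dots> = sqrt (2 ^ n)"
    by (simp add: powr_half_sqrt powr_realpow)
  finally show ?thesis
    by simp
qed

lemma wrap_plain_eq: "wrapped_oracle.wrap Some id J = basis_op"
  by (rule ext) (rule wrap_plain)

lemma wrap_bypass_eq:
  assumes "is_isometry (bits k) (bits l) J"
  shows "wrapped_oracle.wrap bypass_dec (Pair True) (\<lambda>(c', b) (c, a). if c' then 0 else J b a) =
    (\<lambda>f. bypass J (basis_op f))"
  by (rule ext) (rule wrap_bypass[OF assms])

lemma query_lower_bounds: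
  assumes n: "n \<ge> 1"
  shows "ereal (1 / 150 * 2 powr (real n / 2)) \<le> ereal_of_enat (Q_erase n (3 * n) (garbage_simon n))"
    and "ereal (1 / 150 * 2 powr (real n / 2)) \<le> ereal_of_enat (Q_IP (3 * n + 1) (perm_garbage_simon n))"
    and "ereal (1 / 150 * 2 powr (real n / 2)) \<le> ereal_of_enat (Q_IP (2 * n + 2) (compressed_perm_garbage_simon n))"
  unfolding Q_erase_def Q_IP_def erasing_oracle_eq in_place_oracle_eq sqrt_power_eq
proof (safe intro!: query_complexity_ge)
  fix T and \<A> :: "(bool list, bool list) query_alg"
  show "sqrt (2 ^ n) / 150 \<le> real T" if "solves (bits n) (bits (3 * n)) basis_op (garbage_simon n) T \<A>"
    using wrapped_oracle.erase_lower_bound[OF wrapped_oracle_plain n refl refl] that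
    by (simp add: wrap_plain_eq)
  show "sqrt (2 ^ n) / 150 \<le> real T"
    if "solves (bits (3 * n + 1)) (bits (3 * n + 1)) basis_op (perm_garbage_simon n) T \<A>"
    using perm_garbage_lower_bound[OF n wrapped_oracle_plain, unfolded wrap_plain_eq, OF that] .
  show "sqrt (2 ^ n) / 150 \<le> real T"
    if "solves (bits (2 * n + 2)) (bits (2 * n + 2)) basis_op (compressed_perm_garbage_simon n) T \<A>"
    using compressed_lower_bound[OF n wrapped_oracle_plain, unfolded wrap_plain_eq, OF that] .
qed

lemma bypass_lower_bounds:
  assumes n: "n \<ge> 1"
  shows "is_isometry (bits n) (bits (3 * n)) J \<Longrightarrow>
      ereal (1 / 150 * 2 powr (real n / 2)) \<le> ereal_of_enat (Q_erase_bypass n (3 * n) J (garbage_simon n))"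
    and "is_isometry (bits (3 * n + 1)) (bits (3 * n + 1)) J \<Longrightarrow>
      ereal (1 / 150 * 2 powr (real n / 2)) \<le> ereal_of_enat (Q_IP_bypass (3 * n + 1) J (perm_garbage_simon n))"
    and "is_isometry (bits (2 * n + 2)) (bits (2 * n + 2)) J \<Longrightarrow>
      ereal (1 / 150 * 2 powr (real n / 2)) \<le>
        ereal_of_enat (Q_IP_bypass (2 * n + 2) J (compressed_perm_garbage_simon n))"
  unfolding Q_erase_bypass_def Q_IP_bypass_def erasing_oracle_eq in_place_oracle_eq sqrt_power_eq
proof (safe intro!: query_complexity_ge)
  fix T and \<A> :: "(bool \<times> bool list, bool \<times> bool list) query_alg"
  show "sqrt (2 ^ n) / 150 \<le> real T"
    if "is_isometry (bits n) (bits (3 * n)) J"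
      "solves (UNIV \<times> bits n) (UNIV \<times> bits (3 * n)) (\<lambda>f. bypass J (basis_op f)) (garbage_simon n) T \<A>"
    using wrapped_oracle.erase_lower_bound[OF wrapped_oracle_bypass[OF that(1)] n refl refl] that(2)
    by (simp add: wrap_bypass_eq[OF that(1)])
  show "sqrt (2 ^ n) / 150 \<le> real T"
    if "is_isometry (bits (3 * n + 1)) (bits (3 * n + 1)) J"
      "solves (UNIV \<times> bits (3 * n + 1)) (UNIV \<times> bits (3 * n + 1)) (\<lambda>f. bypass J (basis_op f))
         (perm_garbage_simon n) T \<A>"
    using perm_garbage_lower_bound[OF n wrapped_oracle_bypass[OF that(1)],
        unfolded wrap_bypass_eq[OF that(1)], OF that(2)] .
  show "sqrt (2 ^ n) / 150 \<le> real T"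
    if "is_isometry (bits (2 * n + 2)) (bits (2 * n + 2)) J"
      "solves (UNIV \<times> bits (2 * n + 2)) (UNIV \<times> bits (2 * n + 2)) (\<lambda>f. bypass J (basis_op f))
         (compressed_perm_garbage_simon n) T \<A>"
    using compressed_lower_bound[OF n wrapped_oracle_bypass[OF that(1)],
        unfolded wrap_bypass_eq[OF that(1)], OF that(2)] .
qed

section \<open>Asymptotic form of the bounds\<close>

lemma is_ThetaI:
  assumes "c > 0" "C > 0" "\<And>n. n \<ge> 1 \<Longrightarrow> ereal (c * g n) \<le> ereal_of_enat (q n)"
    "\<And>n. n \<ge> 1 \<Longrightarrow> ereal_of_enat (q n) \<le> ereal (C * g n)"
  shows "is_Theta q g"
  using assms unfolding is_Theta_def by blast

lemma card_powr_quarter: "real (card (bits (2 * n + 2))) powr (1 / 4) = sqrt 2 * 2 powr (real n / 2)"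
proof -
  have "real (card (bits (2 * n + 2))) = 2 powr real (2 * n + 2)"
    unfolding card_bits by (subst powr_realpow) simp_all
  then have "real (card (bits (2 * n + 2))) powr (1 / 4) = 2 powr (real (2 * n + 2) * (1 / 4))"
    by (simp only: powr_powr)
  also have "real (2 * n + 2) * (1 / 4) = 1 / 2 + real n / 2"
    by simp
  finally have "real (card (bits (2 * n + 2))) powr (1 / 4) = 2 powr (1 / 2 + real n / 2)" .
  then show ?thesis
    by (simp add: powr_add powr_half_sqrt)
qed

lemma is_Theta_compressed_quarter:
  "is_Theta (\<lambda>n. Q_IP (2 * n + 2) (compressed_perm_garbage_simon n))
     (\<lambda>n. real (card (bits (2 * n + 2))) powr (1 / 4))"
proof (rule is_ThetaI)
  fix n :: nat assume n: "n \<ge> 1"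
  \<comment> \<open>The fourth root of the number of points is \<open>sqrt 2\<close> times
    \<open>2 powr (n / 2)\<close>; halving the constant absorbs \<open>sqrt 2 < 2\<close>.\<close>
  have "1 / 300 * (sqrt 2 * 2 powr (real n / 2)) \<le> 1 / 150 * 2 powr (real n / 2)"
    using sqrt2_less_2 by simp
  then show "ereal (1 / 300 * real (card (bits (2 * n + 2))) powr (1 / 4)) \<le>
      ereal_of_enat (Q_IP (2 * n + 2) (compressed_perm_garbage_simon n))"
    unfolding card_powr_quarter using query_lower_bounds(3)[OF n] by (meson ereal_less_eq(3) order_trans)
  have "1 * 2 powr (real n / 2) \<le> sqrt 2 * 2 powr (real n / 2)"
    by (intro mult_right_mono) auto
  then have "3 * 2 powr (real n / 2) \<le> 3 * (sqrt 2 * 2 powr (real n / 2))"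
    by simp
  then show "ereal_of_enat (Q_IP (2 * n + 2) (compressed_perm_garbage_simon n)) \<le>
      ereal (3 * real (card (bits (2 * n + 2))) powr (1 / 4))"
    unfolding card_powr_quarter using Q_IP_compressed_le[OF n] by (meson ereal_less_eq(3) order_trans)
qed auto

theorem theorem1p1:
  "(\<forall>n\<ge>1. Q_XOR n (3 * n) (garbage_simon n) \<le> enat (n + 2)) \<and>
   is_Theta (\<lambda>n. Q_erase n (3 * n) (garbage_simon n)) (\<lambda>n. 2 powr (real n / 2)) \<and>
   (\<forall>n\<ge>1. Q_XOR (3 * n + 1) (3 * n + 1) (perm_garbage_simon n) \<le> enat (n + 2)) \<and>
   is_Theta (\<lambda>n. Q_IP (3 * n + 1) (perm_garbage_simon n)) (\<lambda>n. 2 powr (real n / 2)) \<and>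
   (\<forall>n\<ge>1. card (bits (2 * n + 2)) = 2 ^ (2 * n + 2) \<and>
           card (bits (2 * n + 2)) = 4 * (card (bits n))\<^sup>2 \<and> card (bits n) = 2 ^ n) \<and>
   (\<forall>n\<ge>1. Q_XOR (2 * n + 2) (2 * n + 2) (compressed_perm_garbage_simon n) \<le> enat (n + 2)) \<and>
   is_Theta (\<lambda>n. Q_IP (2 * n + 2) (compressed_perm_garbage_simon n))
     (\<lambda>n. 2 powr (real n / 2)) \<and>
   is_Theta (\<lambda>n. Q_IP (2 * n + 2) (compressed_perm_garbage_simon n))
     (\<lambda>n. real (card (bits (2 * n + 2))) powr (1 / 4)) \<and>
   (\<exists>c>0. \<forall>n\<ge>1. \<forall>J. is_isometry (bits n) (bits (3 * n)) J \<longrightarrow>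
      ereal (c * 2 powr (real n / 2)) \<le> ereal_of_enat (Q_erase_bypass n (3 * n) J (garbage_simon n))) \<and>
   (\<exists>c>0. \<forall>n\<ge>1. \<forall>J. is_isometry (bits (3 * n + 1)) (bits (3 * n + 1)) J \<longrightarrow>
      ereal (c * 2 powr (real n / 2)) \<le> ereal_of_enat (Q_IP_bypass (3 * n + 1) J (perm_garbage_simon n))) \<and>
   (\<exists>c>0. \<forall>n\<ge>1. \<forall>J. is_isometry (bits (2 * n + 2)) (bits (2 * n + 2)) J \<longrightarrow>
      ereal (c * 2 powr (real n / 2))
        \<le> ereal_of_enat (Q_IP_bypass (2 * n + 2) J (compressed_perm_garbage_simon n)))"
proof (intro conjI)
  show "is_Theta (\<lambda>n. Q_erase n (3 * n) (garbage_simon n)) (\<lambda>n. 2 powr (real n / 2))"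
    "is_Theta (\<lambda>n. Q_IP (3 * n + 1) (perm_garbage_simon n)) (\<lambda>n. 2 powr (real n / 2))"
    "is_Theta (\<lambda>n. Q_IP (2 * n + 2) (compressed_perm_garbage_simon n)) (\<lambda>n. 2 powr (real n / 2))"
    by (rule is_ThetaI[of "1 / 150" 3]; use query_lower_bounds Q_erase_le Q_IP_perm_le Q_IP_compressed_le in simp)+
  show "\<forall>n\<ge>1. card (bits (2 * n + 2)) = 2 ^ (2 * n + 2) \<and>
      card (bits (2 * n + 2)) = 4 * (card (bits n))\<^sup>2 \<and> card (bits n) = 2 ^ n"
    by (simp add: power_add power_mult power2_eq_square flip: power_mult_distrib)
  show "\<exists>c>0. \<forall>n\<ge>1. \<forall>J. is_isometry (bits n) (bits (3 * n)) J \<longrightarrow>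
      ereal (c * 2 powr (real n / 2)) \<le> ereal_of_enat (Q_erase_bypass n (3 * n) J (garbage_simon n))"
    using bypass_lower_bounds(1) by (intro exI[of _ "1 / 150"]) auto
  show "\<exists>c>0. \<forall>n\<ge>1. \<forall>J. is_isometry (bits (3 * n + 1)) (bits (3 * n + 1)) J \<longrightarrow>
      ereal (c * 2 powr (real n / 2)) \<le> ereal_of_enat (Q_IP_bypass (3 * n + 1) J (perm_garbage_simon n))"
    using bypass_lower_bounds(2) by (intro exI[of _ "1 / 150"]) auto
  show "\<exists>c>0. \<forall>n\<ge>1. \<forall>J. is_isometry (bits (2 * n + 2)) (bits (2 * n + 2)) J \<longrightarrow>
      ereal (c * 2 powr (real n / 2))
        \<le> ereal_of_enat (Q_IP_bypass (2 * n + 2) J (compressed_perm_garbage_simon n))"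
    using bypass_lower_bounds(3) by (intro exI[of _ "1 / 150"]) auto
qed (use Q_XOR_garbage Q_XOR_perm Q_XOR_compressed is_Theta_compressed_quarter in auto)

end
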